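(* Let $T>0$, $\lambda>0$, $u_0\in H^2(\mathbb{T}^3)$, and let $u=(u_1,u_2,u_3)$ be the solution on $[0,T)$ (in the sense of the context) of the Kuramoto-Sivashinsky equation $$\partial_t u+(u\cdot\nabla)u+\lambda\Delta u+\Delta^2u=0\ \text{ in }\mathbb{T}^3\times[0,T],\qquad u(0)=u_0 .$$ If $u_1,u_2\in L^2\big(0,T;\dot B^{-1/2}_{\infty,\infty}(\mathbb{T}^3)\big)\cap L^2\big(0,T;\dot B^{1/2}_{\infty,\infty}(\mathbb{T}^3)\big)$, then the equation admits a global strong solution, i.e. $u\in L^\infty([0,T];H^2(\mathbb{T}^3))\cap L^2([0,T];H^4(\mathbb{T}^3))$.
   Context: $\mathbb{T}^3=\mathbb{R}^3/(2\pi\mathbb{Z}^3)$; $u:\mathbb{T}^3\times[0,T]\to\mathbb{R}^3$ is not assumed divergence free. Strong solution on $[0,T')$: $u\in L^\infty([0,T');H^2(\mathbb{T}^3))\cap L^2([0,T');H^4(\mathbb{T}^3))$ such that for every smooth $\psi$ on $\mathbb{T}^3$, $\langle\partial_tu,\psi\rangle+(u\cdot\nabla u,\psi)+(\Delta u,\Delta\psi)=\lambda(\nabla u,\nabla\psi)$, with $u(0)=u_0$. By "solution on $[0,T)$" we mean a function that is a strong solution on $[0,T')$ for every $0<T'<T$. Homogeneous toroidal Besov spaces (here $d=3$): let $\mathcal{D}_0(\mathbb{T}^d)$ be the smooth $2\pi$-periodic functions with zero integral and $\mathcal{D}_0'(\mathbb{T}^d)$ its dual. Fix $\phi\in C^\infty(\mathbb{R}^d)$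 with $0\le\phi\le1$, $\operatorname{supp}\phi\subset\{1/2<|\xi|<2\}$, $\sum_{j\in\mathbb{Z}}\phi(2^{-j}\xi)=1$ for $\xi\ne0$, and set $\varphi_j(x)=\sum_{m\in\mathbb{Z}^d}\phi(2^{-j}m)e^{im\cdot x}$. For $s\in\mathbb{R}$, $1\le p,q\le\infty$, $\dot B^s_{p,q}(\mathbb{T}^d)$ is the set of $f\in\mathcal{D}_0'(\mathbb{T}^d)$ with $\|f\|_{\dot B^s_{p,q}}=\big\|\big(2^{sj}\|\varphi_j*f\|_{L^p(\mathbb{T}^d)}\big)_{j\in\mathbb{Z}}\big\|_{\ell^q(\mathbb{Z})}<\infty$. *)

theory Defs
  imports "HOL-Analysis.Analysis" "HOL-Probability.Essential_Supremum"
begin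

text \<open>
  Functions on the torus \<open>T^3 = R^3/(2 pi Z^3)\<close> are represented by 2\<open>\<pi>\<close>-periodic functions on
  \<open>real^3\<close>; integrals over the torus are (unnormalised) Lebesgue integrals over one period cell.
\<close>

definition periodic :: "(real^3 \<Rightarrow> 'b) \<Rightarrow> bool" where
  "periodic f \<longleftrightarrow> (\<forall>x j. f (x + axis j (2 * pi)) = f x)"

definition torus_measure :: "(real^3) measure" where
  "torus_measure = lebesgue_on (cbox 0 (\<chi> i. 2 * pi))"

section \<open>Smooth functions\<close>

definition dir_deriv :: "'a::euclidean_space \<Rightarrow> ('a \<Rightarrow> 'b::real_normed_vector) \<Rightarrow> 'a \<Rightarrow> 'b" where
  "dir_deriv v f x = frechet_derivative f (at x) v"

definition smooth :: "('a::euclidean_space \<Rightarrow> 'b::real_normed_vector) \<Rightarrow> bool" where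
  "smooth f \<longleftrightarrow> (\<forall>vs x. foldr dir_deriv vs f differentiable (at x))"

abbreviation partial :: "3 \<Rightarrow> (real^3 \<Rightarrow> 'b::real_normed_vector) \<Rightarrow> real^3 \<Rightarrow> 'b" where
  "partial j \<equiv> dir_deriv (axis j 1)"

definition smooth_periodic :: "(real^3 \<Rightarrow> 'b::real_normed_vector) set" where
  "smooth_periodic = {\<psi>. smooth \<psi> \<and> periodic \<psi>}"

section \<open>Sobolev spaces on the torus\<close>

definition frequency :: "int^3 \<Rightarrow> real^3" where
  "frequency m = (\<chi> i. of_int (m $ i))"

definition L2_torus :: "(real^3 \<Rightarrow> real) set" where
  "L2_torus = {f. periodic f \<and> f \<in> borel_measurable torus_measure \<and>
                  integrable torus_measure (\<lambda>x. (f x)\<^sup>2)}"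

definition fourier_coeff :: "(real^3 \<Rightarrow> real) \<Rightarrow> int^3 \<Rightarrow> complex" where
  "fourier_coeff f m =
     (LINT x|torus_measure. complex_of_real (f x) * exp (- \<i> * complex_of_real (frequency m \<bullet> x)))
       / complex_of_real ((2 * pi) ^ 3)"

definition sobolev_term :: "nat \<Rightarrow> (real^3 \<Rightarrow> real^3) \<Rightarrow> int^3 \<Rightarrow> real" where
  "sobolev_term s f m =
     (1 + (norm (frequency m))\<^sup>2) ^ s * (\<Sum>i\<in>UNIV. (cmod (fourier_coeff (\<lambda>x. f x $ i) m))\<^sup>2)"

text \<open>Vector-valued \<open>H^s(T^3)\<close>.\<close>

definition sobolev :: "nat \<Rightarrow> (real^3 \<Rightarrow> real^3) set" where
  "sobolev s = {f. (\<forall>i. (\<lambda>x. f x $ i) \<in> L2_torus) \<and> sobolev_term s f summable_on UNIV}"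

definition sobolev_norm :: "nat \<Rightarrow> (real^3 \<Rightarrow> real^3) \<Rightarrow> real" where
  "sobolev_norm s f = sqrt (\<Sum>\<^sub>\<infinity>m. sobolev_term s f m)"

definition is_weak_partial :: "3 \<Rightarrow> (real^3 \<Rightarrow> real) \<Rightarrow> (real^3 \<Rightarrow> real) \<Rightarrow> bool" where
  "is_weak_partial j f g \<longleftrightarrow>
     (\<forall>\<psi>\<in>smooth_periodic. (LINT x|torus_measure. f x * partial j \<psi> x)
                             = - (LINT x|torus_measure. g x * \<psi> x))"

text \<open>A representative; square integrable weak derivatives are unique up to null sets.\<close>

definition weak_partial :: "3 \<Rightarrow> (real^3 \<Rightarrow> real) \<Rightarrow> (real^3 \<Rightarrow> real)" where
  "weak_partial j f = (SOME g. g \<in> L2_torus \<and> is_weak_partial j f g)"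

section \<open>Bochner spaces\<close>

text \<open>
  A normed space of functions or functionals is given by its carrier \<open>X\<close> and its norm \<open>N\<close>; only
  values of \<open>N\<close> on \<open>X\<close> matter. Measurability is strong measurability: almost everywhere \<open>N\<close>-limit
  of \<open>X\<close>-valued simple functions.
\<close>

definition strongly_measurable ::
    "real set \<Rightarrow> 'b::minus set \<Rightarrow> ('b \<Rightarrow> real) \<Rightarrow> (real \<Rightarrow> 'b) \<Rightarrow> bool" where
  "strongly_measurable I X N u \<longleftrightarrow>
     (AE t in lebesgue_on I. u t \<in> X) \<and>
     (\<exists>s :: nat \<Rightarrow> real \<Rightarrow> 'b.
        (\<forall>n. simple_function (lebesgue_on I) (s n) \<and> s n ` I \<subseteq> X) \<and>
        (AE t in lebesgue_on I. (\<lambda>n. N (s n t - u t)) \<longlonglongrightarrow> 0))"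

definition bochner_Linf ::
    "real set \<Rightarrow> 'b::minus set \<Rightarrow> ('b \<Rightarrow> real) \<Rightarrow> (real \<Rightarrow> 'b) set" where
  "bochner_Linf I X N =
     {u. strongly_measurable I X N u \<and> (\<exists>C. AE t in lebesgue_on I. N (u t) \<le> C)}"

definition bochner_L2 ::
    "real set \<Rightarrow> 'b::minus set \<Rightarrow> ('b \<Rightarrow> real) \<Rightarrow> (real \<Rightarrow> 'b) set" where
  "bochner_L2 I X N =
     {u. strongly_measurable I X N u \<and> (\<integral>\<^sup>+t. ennreal ((N (u t))\<^sup>2) \<partial>lebesgue_on I) < \<infinity>}"

section \<open>Strong solutions of the Kuramoto-Sivashinsky equation\<close>

definition torus_inner :: "(real^3 \<Rightarrow> real^3) \<Rightarrow> (real^3 \<Rightarrow> real^3) \<Rightarrow> real" where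
  "torus_inner f g = (LINT x|torus_measure. f x \<bullet> g x)"

definition convection :: "(real^3 \<Rightarrow> real^3) \<Rightarrow> real^3 \<Rightarrow> real^3" where
  "convection f x = (\<chi> i. \<Sum>j\<in>UNIV. f x $ j * weak_partial j (\<lambda>y. f y $ i) x)"

definition weak_laplacian :: "(real^3 \<Rightarrow> real^3) \<Rightarrow> real^3 \<Rightarrow> real^3" where
  "weak_laplacian f x = (\<chi> i. \<Sum>j\<in>UNIV. weak_partial j (weak_partial j (\<lambda>y. f y $ i)) x)"

definition laplacian :: "(real^3 \<Rightarrow> real^3) \<Rightarrow> real^3 \<Rightarrow> real^3" where
  "laplacian \<psi> x = (\<Sum>j\<in>UNIV. partial j (partial j \<psi>) x)"

text \<open>The pairing \<open>(\<nabla>f, \<nabla>\<psi>)\<close> of a Sobolev function \<open>f\<close> with a smooth \<open>\<psi>\<close>.\<close>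

definition grad_inner :: "(real^3 \<Rightarrow> real^3) \<Rightarrow> (real^3 \<Rightarrow> real^3) \<Rightarrow> real" where
  "grad_inner f \<psi> = (LINT x|torus_measure.
     (\<Sum>i\<in>UNIV. \<Sum>j\<in>UNIV. weak_partial j (\<lambda>y. f y $ i) x * (partial j \<psi> x $ i)))"

text \<open>\<open>h\<close> is the distributional derivative of \<open>g\<close> on the open interval \<open>(0, b)\<close>.\<close>

definition is_distr_deriv :: "real \<Rightarrow> (real \<Rightarrow> real) \<Rightarrow> (real \<Rightarrow> real) \<Rightarrow> bool" where
  "is_distr_deriv b g h \<longleftrightarrow>
     (\<forall>\<theta> :: real \<Rightarrow> real. smooth \<theta> \<and> closure {t. \<theta> t \<noteq> 0} \<subseteq> {0<..<b} \<longrightarrow>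
        (LINT t|lebesgue_on {0<..<b}. g t * deriv \<theta> t)
          = - (LINT t|lebesgue_on {0<..<b}. h t * \<theta> t))"

text \<open>
  Strong solution on \<open>[0, b)\<close>. The term \<open>\<langle>\<partial>\<^sub>t u, \<psi>\<rangle>\<close> is the distributional derivative of
  \<open>t \<mapsto> (u(t), \<psi>)\<close>. Since \<open>u\<close> is determined only for almost every time, the initial condition
  refers to the continuous representatives of the functions \<open>t \<mapsto> (u(t), \<psi>)\<close>.
\<close>

definition strong_solution ::
    "real \<Rightarrow> (real^3 \<Rightarrow> real^3) \<Rightarrow> real \<Rightarrow> (real \<Rightarrow> real^3 \<Rightarrow> real^3) \<Rightarrow> bool" where
  "strong_solution lam u0 b u \<longleftrightarrow>
     u \<in> bochner_Linf {0..<b} (sobolev 2) (sobolev_norm 2) \<and>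
     u \<in> bochner_L2 {0..<b} (sobolev 4) (sobolev_norm 4) \<and>
     (\<forall>\<psi>\<in>smooth_periodic.
        is_distr_deriv b (\<lambda>t. torus_inner (u t) \<psi>)
          (\<lambda>t. lam * grad_inner (u t) \<psi> - torus_inner (convection (u t)) \<psi>
                 - torus_inner (weak_laplacian (u t)) (laplacian \<psi>))) \<and>
     (\<forall>\<psi>\<in>smooth_periodic.
        \<exists>g. continuous_on {0..<b} g \<and>
            (AE t in lebesgue_on {0..<b}. g t = torus_inner (u t) \<psi>) \<and>
            g 0 = torus_inner u0 \<psi>)"

definition solution_on ::
    "real \<Rightarrow> (real^3 \<Rightarrow> real^3) \<Rightarrow> real \<Rightarrow> (real \<Rightarrow> real^3 \<Rightarrow> real^3) \<Rightarrow> bool" where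
  "solution_on lam u0 T u \<longleftrightarrow> (\<forall>b. 0 < b \<and> b < T \<longrightarrow> strong_solution lam u0 b u)"

section \<open>Homogeneous toroidal Besov spaces\<close>

definition dyadic_cutoff :: "(real^3 \<Rightarrow> real) \<Rightarrow> bool" where
  "dyadic_cutoff \<phi> \<longleftrightarrow>
     smooth \<phi> \<and> (\<forall>\<xi>. 0 \<le> \<phi> \<xi> \<and> \<phi> \<xi> \<le> 1) \<and>
     closure {\<xi>. \<phi> \<xi> \<noteq> 0} \<subseteq> {\<xi>. 1/2 < norm \<xi> \<and> norm \<xi> < 2} \<and>
     (\<forall>\<xi>. \<xi> \<noteq> 0 \<longrightarrow> ((\<lambda>j::int. \<phi> ((2 powi (- j)) *\<^sub>R \<xi>)) has_sum 1) UNIV)"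

definition D0 :: "(real^3 \<Rightarrow> complex) set" where
  "D0 = {\<psi> \<in> smooth_periodic. (LINT x|torus_measure. \<psi> x) = 0}"

text \<open>
  The topological dual of \<open>D0\<close>, whose topology is given by the suprema of all iterated partial
  derivatives. A functional is a total function whose values outside \<open>D0\<close> are irrelevant.
\<close>

definition D0' :: "((real^3 \<Rightarrow> complex) \<Rightarrow> complex) set" where
  "D0' = {F.
     (\<forall>\<psi>\<in>D0. \<forall>\<eta>\<in>D0. F (\<lambda>x. \<psi> x + \<eta> x) = F \<psi> + F \<eta>) \<and>
     (\<forall>c. \<forall>\<psi>\<in>D0. F (\<lambda>x. c * \<psi> x) = c * F \<psi>) \<and>
     (\<exists>C N. \<forall>\<psi>\<in>D0. cmod (F \<psi>) \<le>
        C * (\<Sum>js | length js \<le> N. SUP x. cmod (foldr partial js \<psi> x)))}"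

definition to_D0' :: "(real^3 \<Rightarrow> real) \<Rightarrow> (real^3 \<Rightarrow> complex) \<Rightarrow> complex" where
  "to_D0' f \<psi> = (LINT x|torus_measure. complex_of_real (f x) * \<psi> x)"

text \<open>The sum has only finitely many nonzero terms, and none at frequency \<open>0\<close>.\<close>

definition dyadic_kernel :: "(real^3 \<Rightarrow> real) \<Rightarrow> int \<Rightarrow> real^3 \<Rightarrow> complex" where
  "dyadic_kernel \<phi> j x =
     (\<Sum>\<^sub>\<infinity>m. complex_of_real (\<phi> ((2 powi (- j)) *\<^sub>R frequency m))
              * exp (\<i> * complex_of_real (frequency m \<bullet> x)))"

definition dyadic_block ::
    "(real^3 \<Rightarrow> real) \<Rightarrow> int \<Rightarrow> ((real^3 \<Rightarrow> complex) \<Rightarrow> complex) \<Rightarrow> real^3 \<Rightarrow> complex" where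
  "dyadic_block \<phi> j F x = F (\<lambda>y. dyadic_kernel \<phi> j (x - y))"

text \<open>The norm and space for \<open>p = q = \<infinity>\<close>.\<close>

definition besov_inf_enorm ::
    "(real^3 \<Rightarrow> real) \<Rightarrow> real \<Rightarrow> ((real^3 \<Rightarrow> complex) \<Rightarrow> complex) \<Rightarrow> ennreal" where
  "besov_inf_enorm \<phi> s F =
     (SUP j::int. ennreal (2 powr (s * of_int j))
                    * esssup torus_measure (\<lambda>x. ennreal (cmod (dyadic_block \<phi> j F x))))"

definition besov_inf ::
    "(real^3 \<Rightarrow> real) \<Rightarrow> real \<Rightarrow> ((real^3 \<Rightarrow> complex) \<Rightarrow> complex) set" where
  "besov_inf \<phi> s = {F \<in> D0'. besov_inf_enorm \<phi> s F < \<infinity>}"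

definition besov_inf_norm ::
    "(real^3 \<Rightarrow> real) \<Rightarrow> real \<Rightarrow> ((real^3 \<Rightarrow> complex) \<Rightarrow> complex) \<Rightarrow> real" where
  "besov_inf_norm \<phi> s F = enn2real (besov_inf_enorm \<phi> s F)"

end

theory Submission
  imports Defs "HOL-Probability.Characteristic_Functions"
begin

text \<open>
  The term \<open>((u \<cdot> \<nabla>) u, u)\<close> of the energy balance is a sum of integrals of \<open>u\<^sub>j \<partial>\<^sub>j u\<^sub>i u\<^sub>i\<close>. For
  \<open>i = j = 3\<close> the integrand is a derivative; every other term has a factor \<open>u\<^sub>1\<close> or \<open>u\<^sub>2\<close>, and
  integration by parts removes the mean of that factor. On the torus the dyadic blocks start at
  frequency one, so \<open>B\<^sup>1\<^sup>/\<^sup>2\<^sub>\<infinity>\<^sub>\<infinity>\<close> alone bounds the fluctuation of \<open>u\<^sub>1\<close> and \<open>u\<^sub>2\<close> uniformly, by some \<open>A(t)\<close>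
  with \<open>A \<in> L\<^sup>2(0, T)\<close>. Hence \<open>d/dt E\<^sub>0 + E\<^sub>2 / 2 \<le> C (1 + A\<^sup>2) E\<^sub>0\<close>, where \<open>E\<^sub>s\<close> is the squared \<open>H\<^sup>s\<close> norm, and
  Gronwall gives \<open>E\<^sub>2 \<in> L\<^sup>1(0, T)\<close>. Since \<open>H\<^sup>2\<close> embeds into \<open>L\<^sup>\<infinity>\<close> one also has
  \<open>d/dt E\<^sub>2 + E\<^sub>4 / 2 \<le> C (1 + E\<^sub>2) E\<^sub>2\<close>, whose Gronwall kernel is now integrable up to time \<open>T\<close>.

  Functions in \<open>H\<^sup>4\<close> have Fourier coefficients that are absolutely summable with weight
  \<open>1 + |m|\<^sup>2\<close>, so all products are handled through absolutely convergent series, which are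
  integrals over the counting measure of the lattice of frequencies.
\<close>

text \<open>Since u is not divergence free, the cubic term of the L^2 balance does not cancel, and
  an estimate by norms of u alone would be superlinear in the energy. Bounding one factor by A(t)
  makes it linear, while the dissipation absorbs the gradient. The first Gronwall step then yields
  exactly the kernel E_2 of the second. The exponent 1/2 matters through the summability of 2^(-j/2)
  over j >= 0.

  The equation is available only against smooth test fields that do not depend on time, and u only
  for almost every time, so u itself cannot serve as a test field. The balances are therefore
  obtained frequency by frequency: testing with one trigonometric mode makes each Fourier
  coefficient absolutely continuous in time, its squared modulus is written as a time integral, and
  the sum over frequencies is exchanged with that integral by Fubini. The bounds of u in L^inf H^2
  and L^2 H^4 up to any b < T supply the absolute convergence. The energies built in this way are
  defined at every time, as the Gronwall argument requires.\<close>

abbreviation lattice :: "(int^3) measure" where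
  "lattice \<equiv> count_space UNIV"

section \<open>Sums over countable sets as integrals, and the Cauchy-Schwarz inequality\<close>

lemma sums_swap:
  fixes f :: "'i::countable \<Rightarrow> 'x \<Rightarrow> 'c::{banach,second_countable_topology}"
  assumes M: "sigma_finite_measure M"
    and [measurable]: "\<And>i. f i \<in> borel_measurable M"
    and fin: "(\<integral>\<^sup>+x. (\<integral>\<^sup>+i. ennreal (norm (f i x)) \<partial>count_space UNIV) \<partial>M) < \<infinity>"
  shows "AE x in M. integrable (count_space UNIV) (\<lambda>i. f i x)"
    and "integrable M (\<lambda>x. LINT i|count_space UNIV. f i x)"
    and "\<And>i. integrable M (f i)"
    and "integrable (count_space UNIV) (\<lambda>i. LINT x|M. f i x)"
    and "(LINT x|M. LINT i|count_space UNIV. f i x) = (LINT i|count_space UNIV. LINT x|M. f i x)"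
proof -
  interpret M: sigma_finite_measure M by fact
  interpret Z: sigma_finite_measure "count_space (UNIV::'i set)"
    by (rule sigma_finite_measure_count_space)
  interpret P: pair_sigma_finite "count_space (UNIV::'i set)" M ..
  \<comment> \<open>A countable index set makes joint measurability follow from that of the slices.
    The finiteness hypothesis has the sum inside, the order in which the applications verify it;
    Tonelli reverses it.\<close>
  have meas: "(\<lambda>(i, x). f i x) \<in> borel_measurable (count_space UNIV \<Otimes>\<^sub>M M)"
    by (rule measurable_pair_measure_countable1) auto
  have "(\<integral>\<^sup>+p. ennreal (norm (case p of (i, x) \<Rightarrow> f i x)) \<partial>(count_space UNIV \<Otimes>\<^sub>M M))
      = (\<integral>\<^sup>+x. (\<integral>\<^sup>+i. ennreal (norm (f i x)) \<partial>count_space UNIV) \<partial>M)"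
    using meas by (subst P.nn_integral_snd[symmetric]) (auto simp: split_beta')
  then have int: "integrable (count_space UNIV \<Otimes>\<^sub>M M) (\<lambda>(i, x). f i x)"
    using meas fin by (intro integrableI_bounded) auto
  show "AE x in M. integrable (count_space UNIV) (\<lambda>i. f i x)"
    using P.AE_integrable_snd[OF int] .
  show "integrable M (\<lambda>x. LINT i|count_space UNIV. f i x)"
    using P.integrable_snd[OF int] .
  show "integrable M (f i)" for i
    using P.AE_integrable_fst[OF int] by (simp add: AE_count_space)
  show "integrable (count_space UNIV) (\<lambda>i. LINT x|M. f i x)"
    using P.integrable_fst[OF int] .
  show "(LINT x|M. LINT i|count_space UNIV. f i x) = (LINT i|count_space UNIV. LINT x|M. f i x)"
    using P.Fubini_integral[OF int] .
qed

lemma le_integral_count_space: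
  fixes f :: "'i \<Rightarrow> real"
  assumes "integrable (count_space UNIV) f" "\<And>i. f i \<ge> 0"
  shows "f i \<le> (LINT i|count_space UNIV. f i)"
proof -
  have "(LINT j|count_space UNIV. indicator {i} j * f j) \<le> (LINT i|count_space UNIV. f i)"
    by (intro integral_mono integrable_mult_indicator[where 'b=real, simplified] assms)
      (auto simp: indicator_def assms)
  moreover have "(LINT j|count_space UNIV. indicator {i} j * f j) = f i"
  proof -
    have *: "{a. indicator {i} a * f a \<noteq> 0} \<subseteq> {i}" by (auto simp: indicator_def)
    then have "finite {a. indicator {i} a * f a \<noteq> 0}"
      by (rule finite_subset) simp
    moreover have "(\<Sum>a | indicator {i} a * f a \<noteq> 0. indicator {i} a * f a) = (\<Sum>a\<in>{i}. indicator {i} a * f a)"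
      by (rule sum.mono_neutral_left) (use * in auto)
    ultimately show ?thesis
      by (subst lebesgue_integral_count_space_finite_support) (simp_all only: UNIV_I simp_thms, simp)
  qed
  ultimately show ?thesis by simp
qed

lemma infsum_eq_lebesgue_integral:
  fixes f :: "'i \<Rightarrow> 'c::{banach,second_countable_topology}"
  assumes "integrable (count_space UNIV) f"
  shows "infsum f UNIV = (LINT i|count_space UNIV. f i)"
  using assms infsetsum_infsum[of f UNIV]
  by (simp add: infsetsum_def Infinite_Set_Sum.abs_summable_on_def)

text \<open>Connects the unordered sums in the definition of the Sobolev spaces with Bochner
  integrals over a counting measure: for nonnegative terms summability is absolute.\<close>

lemma integrable_iff_summable_on_nonneg:
  fixes f :: "'i \<Rightarrow> real"
  assumes "\<And>i. f i \<ge> 0"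
  shows "integrable (count_space UNIV) f \<longleftrightarrow> f summable_on UNIV"
proof -
  have "integrable (count_space UNIV) f \<longleftrightarrow> Infinite_Set_Sum.abs_summable_on f UNIV"
    by (simp add: Infinite_Set_Sum.abs_summable_on_def)
  also have "\<dots> \<longleftrightarrow> Infinite_Sum.abs_summable_on f UNIV"
    by (simp only: abs_summable_equivalent)
  also have "\<dots> \<longleftrightarrow> f summable_on UNIV"
    using assms by simp
  finally show ?thesis .
qed

lemma integral_reindex_count_space:
  fixes f :: "'i \<Rightarrow> 'c::{banach,second_countable_topology}"
  assumes "bij g"
  shows "(LINT i|count_space UNIV. f (g i)) = (LINT i|count_space UNIV. f i)"
    and "integrable (count_space UNIV) (\<lambda>i. f (g i)) \<longleftrightarrow> integrable (count_space UNIV) f"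
proof -
  have "bij_betw g UNIV UNIV" using assms by simp
  from distr_bij_count_space[OF this]
  have d: "distr (count_space UNIV) (count_space UNIV) g = count_space UNIV" .
  show "(LINT i|count_space UNIV. f (g i)) = (LINT i|count_space UNIV. f i)"
    using integral_distr[of g "count_space UNIV" "count_space UNIV" f] by (simp add: d)
  show "integrable (count_space UNIV) (\<lambda>i. f (g i)) \<longleftrightarrow> integrable (count_space UNIV) f"
    using integrable_distr_eq[of g "count_space UNIV" "count_space UNIV" f] by (simp add: d)
qed

text \<open>The integral of (s f - r g)^2 is a nonnegative quadratic form in (s, r), and suitable
  values of s and r give the discriminant inequality.\<close>

lemma Cauchy_Schwarz_integral:
  fixes f g :: "'a \<Rightarrow> real"
  assumes [measurable]: "f \<in> borel_measurable M" "g \<in> borel_measurable M"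
    and f: "integrable M (\<lambda>x. (f x)\<^sup>2)" and g: "integrable M (\<lambda>x. (g x)\<^sup>2)"
  shows "integrable M (\<lambda>x. f x * g x)"
    and "(LINT x|M. f x * g x)\<^sup>2 \<le> (LINT x|M. (f x)\<^sup>2) * (LINT x|M. (g x)\<^sup>2)"
proof -
  show fg: "integrable M (\<lambda>x. f x * g x)"
  proof (rule Bochner_Integration.integrable_bound)
    show "integrable M (\<lambda>x. (f x)\<^sup>2 + (g x)\<^sup>2)" using f g by simp
    have "\<bar>a * b\<bar> \<le> \<bar>a\<^sup>2 + b\<^sup>2\<bar>" for a b :: real
    proof -
      have "2 * \<bar>a * b\<bar> \<le> a\<^sup>2 + b\<^sup>2"
        using sum_squares_bound[of "\<bar>a\<bar>" "\<bar>b\<bar>"] by (simp add: abs_mult)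
      then show ?thesis by linarith
    qed
    then show "AE x in M. norm (f x * g x) \<le> norm ((f x)\<^sup>2 + (g x)\<^sup>2)" by simp
  qed simp
  define A B C where "A = (LINT x|M. (f x)\<^sup>2)" and "B = (LINT x|M. f x * g x)" and "C = (LINT x|M. (g x)\<^sup>2)"
  have quad: "0 \<le> s\<^sup>2 * A - 2 * s * r * B + r\<^sup>2 * C" for s r
  proof -
    have "0 \<le> (LINT x|M. (s * f x - r * g x)\<^sup>2)" by (rule integral_nonneg_AE) simp
    also have "(\<lambda>x. (s * f x - r * g x)\<^sup>2) = (\<lambda>x. s\<^sup>2 * (f x)\<^sup>2 - (2 * s * r) * (f x * g x) + r\<^sup>2 * (g x)\<^sup>2)"
      by (auto simp: power2_eq_square algebra_simps)
    also have "(LINT x|M. \<dots> x) = s\<^sup>2 * A - 2 * s * r * B + r\<^sup>2 * C"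
      using f g fg unfolding A_def B_def C_def by simp
    finally show ?thesis .
  qed
  have A0: "A \<ge> 0" "C \<ge> 0" unfolding A_def C_def by (auto intro!: integral_nonneg_AE)
  have "B\<^sup>2 \<le> A * C"
  proof (cases "A = 0")
    case True
    show ?thesis
    proof (rule ccontr)
      assume "\<not> B\<^sup>2 \<le> A * C"
      then have "B \<noteq> 0" using True by auto
      \<comment> \<open>With A = 0 the form at (t, 1) is C - 2 t B, and this t makes it equal to - C
        - 2.\<close>
      define t where "t = (C + 1) / B"
      have "t * B = C + 1" using \<open>B \<noteq> 0\<close> by (simp add: t_def)
      moreover have "0 \<le> C - 2 * (t * B)" using quad[of t 1] True by (simp add: mult.assoc)
      ultimately show False using A0 by simp
    qed
  next
    case False
    then have "A > 0" using A0 by simp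
    \<comment> \<open>The choice s = B, r = A turns the form into A (A C - B^2).\<close>
    have "0 \<le> A * (A * C - B\<^sup>2)"
      using quad[of B A] by (simp add: power2_eq_square algebra_simps)
    then show ?thesis using \<open>A > 0\<close> by (simp add: zero_le_mult_iff)
  qed
  then show "(LINT x|M. f x * g x)\<^sup>2 \<le> (LINT x|M. (f x)\<^sup>2) * (LINT x|M. (g x)\<^sup>2)"
    unfolding A_def B_def C_def .
qed

section \<open>Integration over the torus\<close>

lemma frequency_nth [simp]: "frequency m $ i = of_int (m $ i)"
  by (simp add: frequency_def)

lemma frequency_add: "frequency (m + n) = frequency m + frequency n"
  by (simp add: vec_eq_iff)

lemma frequency_uminus [simp]: "frequency (- m) = - frequency m"
  by (simp add: vec_eq_iff)

lemma frequency_zero [simp]: "frequency 0 = 0"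
  by (simp add: vec_eq_iff)

abbreviation cell :: "(real^3) set" where
  "cell \<equiv> cbox 0 (\<chi> i. 2 * pi)"

lemma mem_cell: "x \<in> cell \<longleftrightarrow> (\<forall>i. 0 \<le> x $ i \<and> x $ i \<le> 2 * pi)"
  by (simp add: mem_box_cart)

lemma space_torus [simp]: "space torus_measure = cell"
  by (simp add: torus_measure_def)

lemma borel_measurable_torusI [measurable_dest]:
  "f \<in> borel_measurable borel \<Longrightarrow> f \<in> borel_measurable torus_measure"
  unfolding torus_measure_def
  by (rule measurable_restrict_space1) (simp add: measurable_completion)

lemma continuous_imp_measurable_torus:
  fixes f :: "real^3 \<Rightarrow> 'b::topological_space"
  assumes "continuous_on UNIV f" shows "f \<in> borel_measurable torus_measure"
  using borel_measurable_continuous_onI[OF assms] by (rule borel_measurable_torusI)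

lemma finite_measure_torus: "finite_measure torus_measure"
  unfolding torus_measure_def by (simp add: finite_measure_lebesgue_on)

interpretation torus: finite_measure torus_measure
  by (rule finite_measure_torus)

lemma sigma_finite_torus: "sigma_finite_measure torus_measure"
  by unfold_locales

lemma measure_torus: "measure torus_measure cell = (2 * pi) ^ 3"
proof -
  have "measure torus_measure cell = measure lebesgue cell"
    unfolding torus_measure_def by (simp add: measure_restrict_space)
  also have "\<dots> = measure lborel cell" by (simp add: measure_completion)
  also have "\<dots> = (\<Prod>i\<in>(UNIV::3 set). (2 * pi))"
    by (subst content_cbox_if_cart) (auto simp: interval_eq_empty_cart not_less)
  finally show ?thesis by simp
qed

lemma torus_integral_borel:
  fixes f :: "real^3 \<Rightarrow> 'b::{banach,second_countable_topology}"
  assumes "f \<in> borel_measurable borel"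
  shows "(LINT x|torus_measure. f x) = (LINT x|lborel. indicator cell x *\<^sub>R f x)"
proof -
  have "(LINT x|torus_measure. f x) = (LINT x|lebesgue. indicator cell x *\<^sub>R f x)"
    unfolding torus_measure_def by (subst integral_restrict_space) auto
  also have "\<dots> = (LINT x|lborel. indicator cell x *\<^sub>R f x)"
    using assms by (intro integral_completion) simp
  finally show ?thesis .
qed

lemma continuous_bounded_compact:
  fixes f :: "'a::topological_space \<Rightarrow> 'b::real_normed_vector"
  assumes "continuous_on UNIV f" "compact K"
  obtains B where "B > 0" "\<And>x. x \<in> K \<Longrightarrow> norm (f x) \<le> B"
proof -
  have "compact (f ` K)"
    by (rule compact_continuous_image[OF continuous_on_subset[OF assms(1)] assms(2)]) simp
  then have "bounded (f ` K)" by (rule compact_imp_bounded)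
  then obtain B where "B > 0" "\<forall>x\<in>f ` K. norm x \<le> B" using bounded_pos by blast
  then show ?thesis using that by auto
qed

lemma integrable_torus_bounded:
  fixes f :: "real^3 \<Rightarrow> 'b::{banach,second_countable_topology}"
  assumes "f \<in> borel_measurable torus_measure" "\<And>x. x \<in> cell \<Longrightarrow> norm (f x) \<le> B"
  shows "integrable torus_measure f"
  by (rule torus.integrable_const_bound[where B=B]) (use assms in auto)

lemma integrable_torus_continuous:
  fixes f :: "real^3 \<Rightarrow> 'b::{banach,second_countable_topology}"
  assumes "continuous_on UNIV f"
  shows "integrable torus_measure f"
proof -
  obtain B where "\<And>x. x \<in> cell \<Longrightarrow> norm (f x) \<le> B"
    using continuous_bounded_compact[OF assms compact_cbox] by metis
  then show ?thesis
    using assms by (intro integrable_torus_bounded continuous_imp_measurable_torus)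
qed

lemma axis_eq_scaleR: "axis j c = c *\<^sub>R (axis j 1 :: real^3)"
  by (simp add: vec_eq_iff axis_def)

text \<open>Shifting the cell by \<open>s\<close> along an axis replaces one slab by its translate by a period.\<close>

lemma torus_integral_shift:
  fixes f :: "real^3 \<Rightarrow> 'b::{banach,second_countable_topology}"
  assumes per: "periodic f" and cont: "continuous_on UNIV f" and s: "0 \<le> s" "s \<le> 2 * pi"
  shows "(LINT x|torus_measure. f (x + s *\<^sub>R axis j 1)) = (LINT x|torus_measure. f x)"
proof -
  let ?e = "axis j 1 :: real^3"
  have [measurable]: "f \<in> borel_measurable borel"
    by (rule borel_measurable_continuous_onI[OF cont])
  have transl: "(LINT x|lborel. h (c + x)) = (LINT x|lborel. h x)"
    if "h \<in> borel_measurable borel" for h :: "real^3 \<Rightarrow> 'b" and c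
    by (subst (2) lborel_distr_plus[symmetric, of c], subst integral_distr) (use that in auto)
  define S where "S = {x\<in>cell. x $ j \<le> s}"
  have "S = cell \<inter> {x. x $ j \<le> s}" by (auto simp: S_def)
  moreover have "closed {x::real^3. x $ j \<le> s}" by (intro closed_Collect_le continuous_intros)
  ultimately have S': "closed S" by (auto intro: closed_Int)
  have cS: "compact S" using S' S_def by (metis (no_types, lifting) bounded_cbox bounded_subset compact_eq_bounded_closed mem_Collect_eq subsetI)
  have [measurable]: "S \<in> sets borel" using S' by (rule borel_closed)
  have int: "integrable lborel (\<lambda>x. indicator K x *\<^sub>R f x)" if "compact K" for K
    using borel_integrable_compact[OF that continuous_on_subset[OF cont]] by simp
  \<comment> \<open>The closed slabs overlap the rest of the cell in hyperplanes, at the values s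
    and 2 pi of coordinate j. The indicator identity below fails there, so these null sets are
    discarded.\<close>
  have null: "AE x in lborel. (x::real^3) $ j \<noteq> c" for c
  proof -
    have "negligible {x::real^3. x $ j = c}"
      using negligible_standard_hyperplane[of "axis j 1 :: real^3" c]
      by (simp add: axis_in_Basis_iff inner_axis)
    then have "AE x in lebesgue. x \<notin> {x::real^3. x $ j = c}"
      by (metis AE_not_in negligible_iff_null_sets)
    then show ?thesis by (simp add: AE_completion_iff)
  qed
  have slab: "(LINT x|lborel. indicator S (x - (2 * pi) *\<^sub>R ?e) *\<^sub>R f x) = (LINT x|lborel. indicator S x *\<^sub>R f x)"
  proof -
    have "f ((2 * pi) *\<^sub>R ?e + x) = f x" for x
      using per unfolding periodic_def by (metis add.commute axis_eq_scaleR)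
    then show ?thesis
      by (subst transl[symmetric, where c="(2 * pi) *\<^sub>R ?e"]) simp_all
  qed
  have cS2: "compact ((+) ((2 * pi) *\<^sub>R ?e) ` S)" using cS by (rule compact_translation)
  have ind2: "indicator ((+) ((2 * pi) *\<^sub>R ?e) ` S) x = (indicator S (x - (2 * pi) *\<^sub>R ?e) :: real)" for x
    by (auto simp: indicator_def image_iff algebra_simps intro: bexI[of _ "x - (2 * pi) *\<^sub>R ?e"])
  have int2: "integrable lborel (\<lambda>x. indicator S (x - (2 * pi) *\<^sub>R ?e) *\<^sub>R f x)"
    using int[OF cS2] by (simp add: ind2)
  have "(LINT x|torus_measure. f (x + s *\<^sub>R ?e)) = (LINT x|lborel. indicator cell x *\<^sub>R f (x + s *\<^sub>R ?e))"
    by (rule torus_integral_borel) simp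
  also have "\<dots> = (LINT x|lborel. indicator cell (x - s *\<^sub>R ?e) *\<^sub>R f x)"
    by (subst (2) transl[symmetric, where c="s *\<^sub>R ?e"]) (simp_all add: add.commute)
  also have "\<dots> = (LINT x|lborel. indicator cell x *\<^sub>R f x - indicator S x *\<^sub>R f x
                      + indicator S (x - (2 * pi) *\<^sub>R ?e) *\<^sub>R f x)"
  proof (rule integral_cong_AE)
    show "AE x in lborel. indicator cell (x - s *\<^sub>R ?e) *\<^sub>R f x
        = indicator cell x *\<^sub>R f x - indicator S x *\<^sub>R f x + indicator S (x - (2 * pi) *\<^sub>R ?e) *\<^sub>R f x"
      using null[of s] null[of "2 * pi"]
    proof eventually_elim
      case (elim x)
      have "(indicator cell (x - s *\<^sub>R ?e) :: real)
          = indicator cell x - indicator S x + indicator S (x - (2 * pi) *\<^sub>R ?e)"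
      proof (cases "\<forall>i. i \<noteq> j \<longrightarrow> 0 \<le> x $ i \<and> x $ i \<le> 2 * pi")
        case True
        have *: "x - c *\<^sub>R ?e \<in> cell \<longleftrightarrow> c \<le> x $ j \<and> x $ j \<le> 2 * pi + c" for c
          using True by (auto simp: mem_cell axis_def)
        have **: "x \<in> cell \<longleftrightarrow> 0 \<le> x $ j \<and> x $ j \<le> 2 * pi"
          using *[of 0] by simp
        show ?thesis
          using elim s by (auto simp: indicator_def S_def * **) 
      next
        case False
        then obtain i where i: "i \<noteq> j" "\<not> (0 \<le> x $ i \<and> x $ i \<le> 2 * pi)" by blast
        have "x - c *\<^sub>R ?e \<notin> cell" for c
        proof -
          have "(x - c *\<^sub>R ?e) $ i = x $ i" using i(1) by (simp add: axis_def)
          then show ?thesis using i(2) unfolding mem_cell by metis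
        qed
        moreover from this[of 0] have "x \<notin> cell" by simp
        ultimately show ?thesis by (auto simp: indicator_def S_def)
      qed
      then show ?case by (simp add: scaleR_left.add scaleR_left.diff)
    qed
  qed measurable
  also have "\<dots> = (LINT x|lborel. indicator cell x *\<^sub>R f x)"
    using int[OF compact_cbox] int[OF cS] int2 slab by simp
  also have "\<dots> = (LINT x|torus_measure. f x)" by (simp add: torus_integral_borel)
  finally show ?thesis .
qed

lemma has_vector_derivative_quotient:
  fixes x e :: "'a::real_vector" and f :: "'a \<Rightarrow> 'b::real_normed_vector"
  assumes "((\<lambda>s. f (x + s *\<^sub>R e)) has_vector_derivative g) (at 0)"
  shows "((\<lambda>s. (1 / s) *\<^sub>R (f (x + s *\<^sub>R e) - f x)) \<longlongrightarrow> g) (at (0::real))"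
proof -
  have "(\<lambda>h. norm (f (x + h *\<^sub>R e) - f x - h *\<^sub>R g) / norm h) \<midarrow>0\<rightarrow> 0"
    using assms unfolding has_vector_derivative_def has_derivative_at by auto
  moreover have "\<forall>\<^sub>F h in at 0. norm (f (x + h *\<^sub>R e) - f x - h *\<^sub>R g) / norm h
      = norm ((1 / h) *\<^sub>R (f (x + h *\<^sub>R e) - f x) - g)"
  proof (rule eventually_at_filter[THEN iffD2, OF always_eventually], intro allI impI)
    fix h :: real assume "h \<noteq> 0"
    then have "(1 / h) *\<^sub>R (f (x + h *\<^sub>R e) - f x) - g = (1 / h) *\<^sub>R (f (x + h *\<^sub>R e) - f x - h *\<^sub>R g)"
      by (simp add: scaleR_right_diff_distrib)
    then show "norm (f (x + h *\<^sub>R e) - f x - h *\<^sub>R g) / norm h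
        = norm ((1 / h) *\<^sub>R (f (x + h *\<^sub>R e) - f x) - g)" by simp
  qed
  ultimately have "(\<lambda>h. norm ((1 / h) *\<^sub>R (f (x + h *\<^sub>R e) - f x) - g)) \<midarrow>0\<rightarrow> 0"
    by (rule Lim_transform_eventually)
  then show ?thesis using Lim_null tendsto_norm_zero_iff by blast
qed

text \<open>Difference quotients of a periodic function integrate to zero by shift invariance, and
  they converge dominatedly to the derivative. This is the form in which integration by parts on the
  torus is used throughout.\<close>

lemma torus_integral_derivative_zero:
  fixes f g :: "real^3 \<Rightarrow> 'b::{banach,second_countable_topology}"
  assumes per: "periodic f" and cont: "continuous_on UNIV f" and contg: "continuous_on UNIV g"
    and deriv: "\<And>x. ((\<lambda>s. f (x + s *\<^sub>R axis j 1)) has_vector_derivative g x) (at 0)"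
  shows "(LINT x|torus_measure. g x) = 0"
proof -
  let ?e = "axis j 1 :: real^3"
  have deriv': "((\<lambda>s. f (x + s *\<^sub>R ?e)) has_vector_derivative g (x + r *\<^sub>R ?e)) (at r)" for x r
  proof -
    have "((\<lambda>s. f ((x + r *\<^sub>R ?e) + s *\<^sub>R ?e)) \<circ> (\<lambda>s. s - r) has_vector_derivative 1 *\<^sub>R g (x + r *\<^sub>R ?e)) (at r)"
      by (rule vector_diff_chain_at) (auto intro!: derivative_eq_intros deriv)
    then show ?thesis by (simp add: o_def algebra_simps)
  qed
  \<comment> \<open>The cell is enlarged by 1 because the steps 1 / (n + 1) of the difference
    quotients may leave it by at most that much.\<close>
  obtain B where B: "B > 0" "\<And>x. x \<in> cbox 0 (\<chi> i. 2 * pi + 1) \<Longrightarrow> norm (g x) \<le> B"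
    using continuous_bounded_compact[OF contg compact_cbox] by blast
  define q where "q n x = real (Suc n) *\<^sub>R (f (x + (1 / real (Suc n)) *\<^sub>R ?e) - f x)" for n x
  have cq: "continuous_on UNIV (q n)" for n
    unfolding q_def by (intro continuous_intros continuous_on_compose2[OF cont]) auto
  have "(\<lambda>n. LINT x|torus_measure. q n x) \<longlonglongrightarrow> (LINT x|torus_measure. g x)"
  proof (rule integral_dominated_convergence[where w="\<lambda>_. B"])
    show "AE x in torus_measure. (\<lambda>n. q n x) \<longlonglongrightarrow> g x"
    proof (rule AE_I2)
      fix x
      have "((\<lambda>s. (1 / s) *\<^sub>R (f (x + s *\<^sub>R ?e) - f x)) \<longlongrightarrow> g x) (at 0)"
        using deriv[of x] by (rule has_vector_derivative_quotient)
      moreover have "filterlim (\<lambda>n. 1 / real (Suc n)) (at 0) sequentially"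
        by (intro filterlim_atI) (use LIMSEQ_Suc[OF lim_1_over_n] in auto)
      ultimately have "(\<lambda>n. (1 / (1 / real (Suc n))) *\<^sub>R (f (x + (1 / real (Suc n)) *\<^sub>R ?e) - f x)) \<longlonglongrightarrow> g x"
        by (rule filterlim_compose)
      then show "(\<lambda>n. q n x) \<longlonglongrightarrow> g x" by (simp add: q_def)
    qed
    show "AE x in torus_measure. norm (q n x) \<le> B" for n
    proof (rule AE_I2)
      fix x assume "x \<in> space torus_measure"
      then have x: "x \<in> cell" by simp
      let ?s = "1 / real (Suc n)"
      have s: "0 < ?s" "?s \<le> 1" by auto
      have "norm (f (x + ?s *\<^sub>R ?e) - f (x + 0 *\<^sub>R ?e)) \<le> B * norm (?s - 0)"
      proof (rule differentiable_bound[where S="{0..?s}" and f'="\<lambda>r h. h *\<^sub>R g (x + r *\<^sub>R ?e)" and f = "\<lambda>s. f (x + s *\<^sub>R ?e)"])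
        fix r assume r: "r \<in> {0..?s}"
        show "((\<lambda>s. f (x + s *\<^sub>R ?e)) has_derivative (\<lambda>h. h *\<^sub>R g (x + r *\<^sub>R ?e))) (at r within {0..?s})"
          using deriv'[of x r] unfolding has_vector_derivative_def by (rule has_derivative_at_withinI)
        have "x + r *\<^sub>R ?e \<in> cbox 0 (\<chi> i. 2 * pi + 1)"
          unfolding mem_box_cart
        proof
          fix i
          have "0 \<le> x $ i" "x $ i \<le> 2 * pi" using x by (auto simp: mem_cell)
          moreover have "0 \<le> r" "r \<le> 1" using r s(2) by (auto simp del: divide_le_eq_1 intro: order_trans)
          ultimately show "0 $ i \<le> (x + r *\<^sub>R ?e) $ i \<and> (x + r *\<^sub>R ?e) $ i \<le> (\<chi> i. 2 * pi + 1) $ i"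
            by (auto simp: axis_def)
        qed
        then have "norm (g (x + r *\<^sub>R ?e)) \<le> B" by (rule B)
        then show "onorm (\<lambda>h. h *\<^sub>R g (x + r *\<^sub>R ?e)) \<le> B"
          by (intro onorm_le) (simp add: mult.commute[of B] mult_left_mono)
      qed (use s in auto)
      then have "norm (f (x + ?s *\<^sub>R ?e) - f x) \<le> B * ?s" by simp
      then have "real (Suc n) * norm (f (x + ?s *\<^sub>R ?e) - f x) \<le> real (Suc n) * (B * ?s)"
        by (intro mult_left_mono) auto
      then show "norm (q n x) \<le> B" unfolding q_def norm_scaleR by simp
    qed
  qed (auto intro: continuous_imp_measurable_torus contg cq)
  moreover have "(LINT x|torus_measure. q n x) = 0" for n
  proof -
    have "1 / real (Suc n) \<le> 1" by simp
    also have "1 \<le> 2 * pi" using pi_gt3 by simp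
    finally have s: "1 / real (Suc n) \<le> 2 * pi" .
    have "integrable torus_measure (\<lambda>x. f (x + (1 / real (Suc n)) *\<^sub>R ?e))"
      by (intro integrable_torus_continuous continuous_on_compose2[OF cont] continuous_intros) auto
    then show ?thesis
      unfolding q_def using torus_integral_shift[OF per cont _ s, of j] integrable_torus_continuous[OF cont]
      by simp
  qed
  ultimately have "(\<lambda>n. 0) \<longlonglongrightarrow> (LINT x|torus_measure. g x)" by simp
  then show ?thesis by (simp add: LIMSEQ_const_iff)
qed

section \<open>Trigonometric modes\<close>

definition emode :: "int^3 \<Rightarrow> real^3 \<Rightarrow> complex" where
  "emode m x = cis (frequency m \<bullet> x)"

lemma norm_emode [simp]: "cmod (emode m x) = 1"
  by (simp add: emode_def)

lemma emode_add: "emode (m + n) x = emode m x * emode n x"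
  by (simp add: emode_def frequency_add inner_add_left cis_mult)

lemma emode_zero [simp]: "emode 0 x = 1"
  by (simp add: emode_def)

lemma cnj_emode: "cnj (emode m x) = emode (- m) x"
  by (simp add: emode_def cis_cnj)

lemma emode_shift: "emode m (x + s *\<^sub>R axis j 1) = cis (s * of_int (m $ j)) * emode m x"
  by (simp add: emode_def inner_add_right inner_axis cis_mult add.commute)

lemma periodic_emode: "periodic (emode m)"
  unfolding periodic_def
proof (intro allI)
  fix x j
  have "emode m (x + axis j (2 * pi)) = emode m (x + (2 * pi) *\<^sub>R axis j 1)"
    by (simp add: axis_eq_scaleR[of j "2 * pi"])
  also have "\<dots> = emode m x"
    unfolding emode_shift by (simp add: cis_multiple_2pi)
  finally show "emode m (x + axis j (2 * pi)) = emode m x" .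
qed

lemma continuous_emode [continuous_intros]: "continuous_on S (emode m)"
  unfolding emode_def by (intro continuous_intros)

lemma emode_measurable [measurable]: "emode m \<in> borel_measurable torus_measure"
  by (intro continuous_imp_measurable_torus continuous_intros)

lemma has_vector_derivative_emode:
  "((\<lambda>s. emode m (x + s *\<^sub>R axis j 1)) has_vector_derivative \<i> * of_int (m $ j) * emode m x) (at 0)"
proof -
  have "((\<lambda>s. cis (s * of_int (m $ j))) has_vector_derivative \<i> * of_int (m $ j)) (at 0)"
  proof -
    have "((\<lambda>z. exp (\<i> * (z * of_int (m $ j)))) has_field_derivative \<i> * of_int (m $ j)) (at (of_real 0))"
      by (auto intro!: derivative_eq_intros)
    from has_vector_derivative_real_field[OF this] show ?thesis by (simp add: cis_conv_exp)
  qed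
  then show ?thesis
    unfolding emode_shift by (rule has_vector_derivative_mult_left)
qed

text \<open>A mode of nonzero frequency is a constant multiple of its own derivative along an
  axis.\<close>

lemma torus_integral_emode:
  "(LINT x|torus_measure. emode m x) = (if m = 0 then of_real ((2 * pi) ^ 3) else 0)"
proof (cases "m = 0")
  case True
  then show ?thesis by (simp add: measure_torus scaleR_conv_of_real)
next
  case False
  then obtain j where j: "m $ j \<noteq> 0" by (auto simp: vec_eq_iff)
  have "(LINT x|torus_measure. \<i> * of_int (m $ j) * emode m x) = 0"
    by (rule torus_integral_derivative_zero[where f="emode m" and j=j])
      (auto intro!: continuous_intros periodic_emode has_vector_derivative_emode)
  then show ?thesis using j False by simp
qed

lemma fourier_coeff_eq:
  "fourier_coeff f m = (LINT x|torus_measure. of_real (f x) * emode (- m) x) / of_real ((2 * pi) ^ 3)"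
  by (simp add: fourier_coeff_def emode_def cis_conv_exp)

section \<open>Uniqueness of Fourier coefficients\<close>

lemma integrable_torus_mult:
  fixes f :: "real^3 \<Rightarrow> real" and h :: "real^3 \<Rightarrow> 'b::{banach,second_countable_topology}"
  assumes f: "integrable torus_measure f" and h: "continuous_on UNIV h"
  shows "integrable torus_measure (\<lambda>x. f x *\<^sub>R h x)"
proof -
  obtain B where B: "\<And>x. x \<in> cell \<Longrightarrow> norm (h x) \<le> B"
    using continuous_bounded_compact[OF h compact_cbox] by metis
  have [measurable]: "h \<in> borel_measurable torus_measure"
    by (rule continuous_imp_measurable_torus[OF h])
  have [measurable]: "f \<in> borel_measurable torus_measure" using f by simp
  show ?thesis
  proof (rule Bochner_Integration.integrable_bound)
    show "integrable torus_measure (\<lambda>x. B * f x)" using f by simp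
    have "norm (f x *\<^sub>R h x) \<le> norm (B * f x)" if "x \<in> cell" for x
    proof -
      have "\<bar>f x\<bar> * norm (h x) \<le> \<bar>f x\<bar> * \<bar>B\<bar>" using B[OF that] by (intro mult_left_mono) auto
      then show ?thesis by (simp add: abs_mult mult.commute)
    qed
    then show "AE x in torus_measure. norm (f x *\<^sub>R h x) \<le> norm (B * f x)"
      by (intro AE_I2) simp
  qed measurable
qed

text \<open>The torus as a product of unit circles. Trigonometric functions do not separate the
  points of the closed cell, whose opposite faces carry equal values, but coordinates separate the
  points of this image, as Stone-Weierstrass demands.\<close>

definition torus_embedding :: "real^3 \<Rightarrow> complex^3" where
  "torus_embedding x = (\<chi> i. cis (x $ i))"

lemma continuous_torus_embedding: "continuous_on S torus_embedding"
  unfolding torus_embedding_def by (intro continuous_intros)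

text \<open>One of the two angles has to be interior, since 0 and 2 pi have the same image.\<close>

lemma cis_inj_on_period:
  assumes "cis a = cis b" "0 \<le> a" "a \<le> 2 * pi" "0 < b" "b < 2 * pi"
  shows "a = b"
proof -
  have "cis (a - b) = 1" using assms(1) by (simp add: cis_divide[symmetric])
  then have "cos (a - b) = 1" by (metis cis.sel(1) one_complex.sel(1))
  then obtain n :: int where n: "a - b = of_int n * 2 * pi"
    using cos_one_2pi_int by auto
  have "\<bar>of_int n * (2 * pi)\<bar> < 1 * (2 * pi)" using n assms by auto
  then have "\<bar>of_int n :: real\<bar> < 1" by (simp add: abs_mult)
  then have "n = 0" by linarith
  then show ?thesis using n by simp
qed

text \<open>Stone-Weierstrass on the embedded torus. \<open>K\<close> collects the continuous
  functions that \<open>f\<close> annihilates together with all their products with modes. It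
  contains 1 because every coefficient of \<open>f\<close> vanishes, and it is stable under sums,
  scalars and multiplication by modes.\<close>

lemma integral_against_continuous_zero:
  assumes f: "integrable torus_measure f"
    and zero: "\<And>m. fourier_coeff f m = 0"
    and G: "continuous_on UNIV (G :: complex^3 \<Rightarrow> real)"
  shows "(LINT x|torus_measure. f x * G (torus_embedding x)) = 0"
proof -
  define K where "K = {h :: real^3 \<Rightarrow> complex. continuous_on UNIV h \<and>
    (\<forall>m. (LINT x|torus_measure. f x *\<^sub>R (h x * emode m x)) = 0)}"
  have intK: "integrable torus_measure (\<lambda>x. f x *\<^sub>R (h x * emode m x))" if "h \<in> K" for h m
    by (rule integrable_torus_mult[OF f]) (use that in \<open>auto simp: K_def intro!: continuous_intros\<close>)
  have Kadd: "(\<lambda>x. g x + h x) \<in> K" if "g \<in> K" "h \<in> K" for g h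
    using that intK[OF that(1)] intK[OF that(2)]
    by (auto simp: K_def ring_distribs scaleR_right_distrib intro!: continuous_intros)
  have Kscale: "(\<lambda>x. c * h x) \<in> K" if "h \<in> K" for c h
    using that by (auto simp: K_def mult.assoc mult_scaleR_right[symmetric] simp del: mult_scaleR_right intro!: continuous_intros)
  have Kmode: "(\<lambda>x. emode k x * h x) \<in> K" if "h \<in> K" for k h
  proof -
    have *: "(emode k x * h x) * emode m x = h x * emode (k + m) x" for x m
      by (simp add: emode_add ac_simps)
    have "(LINT x|torus_measure. f x *\<^sub>R ((emode k x * h x) * emode m x)) = 0" for m
      unfolding * using that by (simp add: K_def)
    with that show ?thesis by (simp add: K_def continuous_on_mult continuous_emode)
  qed
  have K1: "(\<lambda>x. 1) \<in> K"
    unfolding K_def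
  proof (clarsimp)
    fix m
    have "(LINT x|torus_measure. of_real (f x) * emode m x) = 0"
      using zero[of "- m"] by (simp add: fourier_coeff_eq)
    then show "(LINT x|torus_measure. f x *\<^sub>R emode m x) = 0" by (simp add: scaleR_conv_of_real)
  qed
  \<comment> \<open>\<open>R\<close> consists of the real multipliers that preserve
    \<open>K\<close>. Products of multipliers are multipliers at once, so only the real and
    imaginary parts of the coordinates, each a combination of two modes, need a computation.\<close>
  define R where "R = {g :: complex^3 \<Rightarrow> real. continuous_on UNIV g \<and>
     (\<forall>h\<in>K. (\<lambda>x. of_real (g (torus_embedding x)) * h x) \<in> K)}"
  let ?S = "torus_embedding ` cell"
  have Re_R: "(\<lambda>z. Re (z $ i)) \<in> R" for i
    unfolding R_def
  proof (intro CollectI conjI ballI)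
    show "continuous_on UNIV (\<lambda>z::complex^3. Re (z $ i))" by (intro continuous_intros)
    fix h assume h: "h \<in> K"
    have "of_real (Re (torus_embedding x $ i)) * h x
        = (1/2) * (emode (axis i 1) x * h x) + (1/2) * (emode (- axis i 1) x * h x)" for x
    proof -
      have "frequency (axis i 1) \<bullet> x = x $ i"
      proof -
        have "frequency (axis i 1) = axis i 1" by (simp add: vec_eq_iff axis_def)
        then show ?thesis by (simp add: inner_axis')
      qed
      then have "emode (axis i 1) x + emode (- axis i 1) x = 2 * of_real (cos (x $ i))"
        by (simp add: emode_def complex_eq_iff)
      then have "of_real (cos (x $ i)) = (emode (axis i 1) x + emode (- axis i 1) x) / 2" by simp
      then show ?thesis by (simp add: torus_embedding_def field_simps)
    qed
    then show "(\<lambda>x. of_real (Re (torus_embedding x $ i)) * h x) \<in> K"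
      by (simp only:) (intro Kadd Kscale Kmode h)
  qed
  have Im_R: "(\<lambda>z. Im (z $ i)) \<in> R" for i
    unfolding R_def
  proof (intro CollectI conjI ballI)
    show "continuous_on UNIV (\<lambda>z::complex^3. Im (z $ i))" by (intro continuous_intros)
    fix h assume h: "h \<in> K"
    have "of_real (Im (torus_embedding x $ i)) * h x
        = (- \<i>/2) * (emode (axis i 1) x * h x) + (\<i>/2) * (emode (- axis i 1) x * h x)" for x
    proof -
      have "frequency (axis i 1) \<bullet> x = x $ i"
      proof -
        have "frequency (axis i 1) = axis i 1" by (simp add: vec_eq_iff axis_def)
        then show ?thesis by (simp add: inner_axis')
      qed
      then have "(- \<i>/2) * emode (axis i 1) x + (\<i>/2) * emode (- axis i 1) x = of_real (sin (x $ i))"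
        by (simp add: emode_def complex_eq_iff)
      then show ?thesis by (simp add: torus_embedding_def algebra_simps flip: distrib_left)
    qed
    then show "(\<lambda>x. of_real (Im (torus_embedding x $ i)) * h x) \<in> K"
      by (simp only:) (intro Kadd Kscale Kmode h)
  qed
  interpret function_ring_on R ?S
  proof
    show "compact ?S" by (intro compact_continuous_image continuous_torus_embedding compact_cbox)
    show "continuous_on ?S g" if "g \<in> R" for g
      using that continuous_on_subset by (auto simp: R_def)
    show "(\<lambda>x. g x + h x) \<in> R" if "g \<in> R" "h \<in> R" for g h
      using that by (auto simp: R_def ring_distribs intro!: continuous_intros Kadd)
    show "(\<lambda>x. g x * h x) \<in> R" if "g \<in> R" "h \<in> R" for g h
      using that by (auto simp: R_def mult.assoc intro!: continuous_intros)
    show "(\<lambda>_. c) \<in> R" for c by (auto simp: R_def Kscale)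
    show "\<exists>g\<in>R. g z \<noteq> g w" if "z \<noteq> w" for z w
    proof -
      obtain i where "z $ i \<noteq> w $ i" using \<open>z \<noteq> w\<close> by (auto simp: vec_eq_iff)
      then have "Re (z $ i) \<noteq> Re (w $ i) \<or> Im (z $ i) \<noteq> Im (w $ i)" by (simp add: complex_eq_iff)
      then show ?thesis
        using bexI[of "\<lambda>g. g z \<noteq> g w", OF _ Re_R[of i]] bexI[of "\<lambda>g. g z \<noteq> g w", OF _ Im_R[of i]] by blast
    qed
  qed
  let ?I = "LINT x|torus_measure. f x * G (torus_embedding x)"
  have cE: "continuous_on UNIV (\<lambda>x. g (torus_embedding x))" if "continuous_on UNIV g" for g :: "complex^3 \<Rightarrow> real"
    by (rule continuous_on_compose2[OF that continuous_torus_embedding]) simp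
  have "\<bar>?I\<bar> \<le> e * (LINT x|torus_measure. \<bar>f x\<bar>)" if e: "e > 0" for e
  proof -
    obtain g where g: "g \<in> R" "\<And>z. z \<in> ?S \<Longrightarrow> \<bar>G z - g z\<bar> < e"
      using Stone_Weierstrass_basic[OF continuous_on_subset[OF G] e] by auto
    have cg: "continuous_on UNIV g" using g by (simp add: R_def)
    have i1: "integrable torus_measure (\<lambda>x. f x * g (torus_embedding x))"
      using integrable_torus_mult[OF f cE[OF cg]] by simp
    have i2: "integrable torus_measure (\<lambda>x. f x * G (torus_embedding x))"
      using integrable_torus_mult[OF f cE[OF G]] by simp
    have "(\<lambda>x. of_real (g (torus_embedding x)) * 1) \<in> K" using g K1 by (auto simp: R_def)
    then have "(LINT x|torus_measure. f x *\<^sub>R (of_real (g (torus_embedding x)) * 1 * emode 0 x)) = 0"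
      unfolding K_def by blast
    then have "(LINT x|torus_measure. complex_of_real (f x * g (torus_embedding x))) = 0"
      by (simp add: scaleR_conv_of_real)
    then have "(LINT x|torus_measure. f x * g (torus_embedding x)) = 0"
      by (subst (asm) integral_complex_of_real) simp
    then have "?I = (LINT x|torus_measure. f x * G (torus_embedding x) - f x * g (torus_embedding x))"
      using i1 i2 by simp
    also have "\<bar>\<dots>\<bar> \<le> (LINT x|torus_measure. \<bar>f x * G (torus_embedding x) - f x * g (torus_embedding x)\<bar>)"
      by (rule integral_abs_bound)
    also have "\<dots> \<le> (LINT x|torus_measure. e * \<bar>f x\<bar>)"
    proof (rule integral_mono)
      fix x assume "x \<in> space torus_measure"
      then have "\<bar>G (torus_embedding x) - g (torus_embedding x)\<bar> \<le> e" using g(2) by (simp add: less_imp_le)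
      then have "\<bar>f x\<bar> * \<bar>G (torus_embedding x) - g (torus_embedding x)\<bar> \<le> \<bar>f x\<bar> * e"
        by (intro mult_left_mono) auto
      then show "\<bar>f x * G (torus_embedding x) - f x * g (torus_embedding x)\<bar> \<le> e * \<bar>f x\<bar>"
        by (simp add: right_diff_distrib[symmetric] abs_mult mult.commute)
    qed (use i1 i2 f in auto)
    finally show ?thesis by simp
  qed
  note bound = this
  have "((\<lambda>e. e * (LINT x|torus_measure. \<bar>f x\<bar>)) \<longlongrightarrow> 0 * (LINT x|torus_measure. \<bar>f x\<bar>)) (at_right 0)"
    by (intro tendsto_intros)
  then have "\<bar>?I\<bar> \<le> 0 * (LINT x|torus_measure. \<bar>f x\<bar>)"
    by (rule tendsto_lowerbound)
      (auto intro: eventually_mono[OF eventually_at_right_less] bound)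
  then show ?thesis by simp
qed

text \<open>The tent functions \<open>G n\<close> tend to the indicator of the image of
  \<open>T\<close>. As \<open>T\<close> stays inside the open box, it avoids the faces which the
  embedding identifies, so a point of the cell is mapped into the image of \<open>T\<close> only if
  it lies in \<open>T\<close>.\<close>

lemma set_integral_closed_zero:
  assumes f: "integrable torus_measure f"
    and zero: "\<And>m. fourier_coeff f m = 0"
    and T: "closed T" "T \<subseteq> box 0 (\<chi> i. 2 * pi)"
  shows "(LINT x|torus_measure. f x * indicator T x) = 0"
proof (cases "T = {}")
  case False
  have cT: "compact T"
    using T by (meson bounded_box bounded_subset compact_eq_bounded_closed)
  let ?S = "torus_embedding ` T"
  have cS: "closed ?S" "?S \<noteq> {}"
    using compact_continuous_image[OF continuous_torus_embedding cT] False by (auto simp: compact_imp_closed)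
  define G where "G n z = max 0 (1 - real n * infdist z ?S)" for n z
  have cG: "continuous_on UNIV (G n)" for n
    unfolding G_def by (intro continuous_intros)
  have G01: "0 \<le> G n z" "G n z \<le> 1" for n z
    by (auto simp: G_def infdist_nonneg)
  have lim: "(\<lambda>n. G n (torus_embedding x)) \<longlonglongrightarrow> indicator T x" if x: "x \<in> cell" for x
  proof (cases "x \<in> T")
    case True
    then show ?thesis by (simp add: G_def)
  next
    case False
    have "torus_embedding x \<notin> ?S"
    proof
      assume "torus_embedding x \<in> ?S"
      then obtain y where y: "y \<in> T" "torus_embedding x = torus_embedding y" by auto
      have "x $ i = y $ i" for i
      proof (rule cis_inj_on_period)
        show "cis (x $ i) = cis (y $ i)" using y(2) by (simp add: torus_embedding_def vec_eq_iff)
        show "0 < y $ i" "y $ i < 2 * pi" using y(1) T(2) by (auto simp: mem_box_cart)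
      qed (use x in \<open>auto simp: mem_cell\<close>)
      then have "x = y" by (simp add: vec_eq_iff)
      then show False using y False by simp
    qed
    then have d: "infdist (torus_embedding x) ?S > 0"
      using cS by (simp add: infdist_pos_not_in_closed)
    obtain N :: nat where N: "1 / infdist (torus_embedding x) ?S < N"
      using reals_Archimedean2 by blast
    have "G n (torus_embedding x) = 0" if "n \<ge> N" for n
    proof -
      have "1 < N * infdist (torus_embedding x) ?S" using N d by (simp add: field_simps)
      also have "\<dots> \<le> n * infdist (torus_embedding x) ?S" using that d by (intro mult_right_mono) auto
      finally show ?thesis by (simp add: G_def)
    qed
    then have "\<forall>\<^sub>F n in sequentially. G n (torus_embedding x) = indicator T x"
      using False by (auto simp: eventually_sequentially)
    then show ?thesis by (rule tendsto_eventually)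
  qed
  have fm[measurable]: "f \<in> borel_measurable torus_measure" using f by simp
  have [measurable]: "(\<lambda>x. G n (torus_embedding x)) \<in> borel_measurable torus_measure" for n
    by (intro continuous_imp_measurable_torus continuous_on_compose2[OF cG continuous_torus_embedding]) simp
  have [measurable]: "(indicator T :: _ \<Rightarrow> real) \<in> borel_measurable torus_measure"
    by (intro borel_measurable_torusI borel_measurable_indicator borel_closed T)
  have "(\<lambda>n. LINT x|torus_measure. f x * G n (torus_embedding x)) \<longlonglongrightarrow> (LINT x|torus_measure. f x * indicator T x)"
  proof (rule integral_dominated_convergence[where w="\<lambda>x. \<bar>f x\<bar>"])
    show "AE x in torus_measure. (\<lambda>n. f x * G n (torus_embedding x)) \<longlonglongrightarrow> f x * indicator T x"
      by (intro AE_I2 tendsto_intros lim) simp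
    show "AE x in torus_measure. norm (f x * G n (torus_embedding x)) \<le> \<bar>f x\<bar>" for n
      using G01 by (auto simp: abs_mult intro!: mult_left_le)
  qed (use f in auto)
  then show ?thesis
    unfolding integral_against_continuous_zero[OF f zero cG] by (simp add: LIMSEQ_const_iff)
qed simp

lemma AE_torus_box: "AE x in torus_measure. x \<in> box 0 (\<chi> i. 2 * pi)"
proof -
  have "negligible (cell - box 0 (\<chi> i. 2 * pi))" by (rule negligible_frontier_interval)
  then have "AE x in lebesgue. x \<notin> cell - box 0 (\<chi> i. 2 * pi)"
    by (metis AE_not_in negligible_iff_null_sets)
  then show ?thesis
    unfolding torus_measure_def by (subst AE_restrict_space_iff) (auto elim!: eventually_mono)
qed

text \<open>Inner regularity: a closed \<open>T\<close> inside the set where \<open>f\<close> is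
  positive exhausts that set up to measure \<open>e\<close>. The integral of \<open>f\<close> over
  \<open>T\<close> vanishes although \<open>f\<close> is positive there, so \<open>T\<close> is
  null.\<close>

lemma nonpos_if_fourier_zero:
  assumes f: "integrable torus_measure f"
    and zero: "\<And>m. fourier_coeff f m = 0"
  shows "AE x in torus_measure. f x \<le> 0"
proof -
  let ?B = "box 0 (\<chi> i. 2 * pi) :: (real^3) set"
  have fm[measurable]: "f \<in> borel_measurable torus_measure" using f by simp
  define P where "P = {x \<in> ?B. f x > 0}"
  have BC: "?B \<subseteq> cell" by (rule box_subset_cbox)
  have "{x \<in> space torus_measure. f x > 0} \<in> sets torus_measure" by measurable
  then have "{x \<in> cell. f x > 0} \<in> sets lebesgue"
    by (simp add: torus_measure_def sets_restrict_space_iff)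
  then have "{x \<in> cell. f x > 0} \<inter> ?B \<in> sets lebesgue"
    by (intro sets.Int) (auto simp: borel_open open_box)
  also have "{x \<in> cell. f x > 0} \<inter> ?B = P" using BC by (auto simp: P_def)
  finally have P: "P \<in> sets lebesgue" .
  have "emeasure lebesgue P \<le> ennreal e" if e: "e > 0" for e
  proof -
    obtain T where T: "closed T" "T \<subseteq> P" "P - T \<in> lmeasurable" "emeasure lebesgue (P - T) < ennreal e"
      using sets_lebesgue_inner_closed[OF P e] .
    have TB: "T \<subseteq> ?B" using T(2) by (auto simp: P_def)
    have iT: "integrable torus_measure (\<lambda>x. f x * indicator T x)"
    proof -
      have "T \<in> sets torus_measure"
        using T(1) TB BC by (auto simp: torus_measure_def sets_restrict_space_iff borel_closed)
      then show ?thesis using integrable_mult_indicator[OF _ f, of T] by (simp add: mult.commute)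
    qed
    have fpos: "0 < f x" if "x \<in> T" for x using T(2) that by (auto simp: P_def)
    then have "0 \<le> f x * indicator T x" for x
      by (cases "x \<in> T") (auto simp: less_imp_le)
    then have "AE x in torus_measure. 0 \<le> f x * indicator T x" by (rule AE_I2)
    from integral_nonneg_eq_0_iff_AE[OF iT this] set_integral_closed_zero[OF f zero T(1) TB]
    have "AE x in torus_measure. f x * indicator T x = 0" by (rule iffD1)
    then have "AE x in torus_measure. x \<notin> T"
    proof eventually_elim
      case (elim x)
      then show ?case using fpos[of x] by (cases "x \<in> T") auto
    qed
    then have "AE x in lebesgue. x \<notin> T"
      unfolding torus_measure_def
      by (subst (asm) AE_restrict_space_iff) (use TB BC in \<open>auto elim!: eventually_mono\<close>)
    then have T0: "emeasure lebesgue T = 0"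
      using AE_iff_measurable[of T lebesgue "\<lambda>x. x \<notin> T"] T(1) by (auto simp: borel_closed)
    have "emeasure lebesgue P \<le> emeasure lebesgue (T \<union> (P - T))"
      using T P by (intro emeasure_mono) (auto simp: borel_closed)
    also have "\<dots> \<le> emeasure lebesgue T + emeasure lebesgue (P - T)"
      using T P by (intro emeasure_subadditive) (auto simp: borel_closed)
    also have "\<dots> \<le> ennreal e" using T(4) T0 by (simp add: less_imp_le)
    finally show ?thesis .
  qed
  then have "emeasure lebesgue P = 0"
    by (metis ennreal_le_epsilon add_0 le_zero_eq)
  then have "P \<in> null_sets lebesgue" using P by (auto simp: null_sets_def)
  then have "AE x in lebesgue. x \<notin> P" by (rule AE_not_in)
  then have "AE x in torus_measure. x \<notin> P"
    unfolding torus_measure_def by (subst AE_restrict_space_iff) (auto elim!: eventually_mono)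
  with AE_torus_box show ?thesis
    by eventually_elim (auto simp: P_def)
qed

lemma fourier_coeff_diff:
  assumes "integrable torus_measure f" "integrable torus_measure g"
  shows "fourier_coeff (\<lambda>x. f x - g x) m = fourier_coeff f m - fourier_coeff g m"
proof -
  have "integrable torus_measure (\<lambda>x. h x *\<^sub>R emode (- m) x)" if "integrable torus_measure h" for h
    by (rule integrable_torus_mult[OF that]) (intro continuous_intros)
  from this[OF assms(1)] this[OF assms(2)] show ?thesis
    by (simp add: fourier_coeff_eq scaleR_conv_of_real left_diff_distrib diff_divide_distrib)
qed

lemma fourier_coeff_unique:
  assumes f: "integrable torus_measure f" and g: "integrable torus_measure g"
    and eq: "\<And>m. fourier_coeff f m = fourier_coeff g m"
  shows "AE x in torus_measure. f x = g x"
proof -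
  have "AE x in torus_measure. f x - g x \<le> 0"
    by (rule nonpos_if_fourier_zero) (use f g eq in \<open>auto simp: fourier_coeff_diff\<close>)
  moreover have "AE x in torus_measure. g x - f x \<le> 0"
    by (rule nonpos_if_fourier_zero) (use f g eq in \<open>auto simp: fourier_coeff_diff\<close>)
  ultimately show ?thesis by eventually_elim auto
qed

section \<open>Absolutely convergent Fourier series\<close>

abbreviation weight :: "int^3 \<Rightarrow> real" where
  "weight m \<equiv> 1 + (norm (frequency m))\<^sup>2"

text \<open>The exponent splits the lattice weight: weight^(-2) is a product of three factors
  weight^(-2/3), one for each coordinate. In one dimension the terms decay like |k|^(-4/3), which is
  summable.\<close>

lemma integrable_int_powr:
  "integrable (count_space UNIV) (\<lambda>k::int. (1 + (of_int k)\<^sup>2) powr (- 2 / 3) :: real)"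
proof -
  let ?f = "\<lambda>k::int. (1 + (of_int k)\<^sup>2) powr (- 2 / 3) :: real"
  have "summable (\<lambda>n. real n powr (- 4 / 3))" by (simp add: summable_real_powr_iff)
  then have "summable (\<lambda>n. norm (?f (int n)))"
  proof (rule summable_comparison_test_ev[rotated])
    show "\<forall>\<^sub>F n in sequentially. norm (norm (?f (int n))) \<le> real n powr (- 4 / 3)"
      using eventually_gt_at_top[of 0]
    proof eventually_elim
      case (elim n)
      have "(1 + (real n)\<^sup>2) powr (- 2 / 3) \<le> ((real n)\<^sup>2) powr (- 2 / 3)"
        using elim by (intro powr_mono2') auto
      also have "\<dots> = real n powr (- 4 / 3)"
        using elim by (simp add: powr_powr flip: powr_numeral)
      finally show ?case by simp
    qed
  qed
  then have n: "Infinite_Set_Sum.abs_summable_on (\<lambda>n. ?f (int n)) UNIV"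
    by (simp add: abs_summable_on_nat_iff')
  then have "Infinite_Set_Sum.abs_summable_on ?f (range int)"
    by (rule abs_summable_on_reindex)
  moreover have "Infinite_Set_Sum.abs_summable_on ?f (range (\<lambda>n. - int n))"
    by (rule abs_summable_on_reindex) (use n in simp)
  ultimately have "Infinite_Set_Sum.abs_summable_on ?f (range int \<union> range (\<lambda>n. - int n))"
    by (rule abs_summable_on_union)
  also have "range int \<union> range (\<lambda>n. - int n) = UNIV"
  proof -
    have "k \<in> range int \<union> range (\<lambda>n. - int n)" for k
      by (cases k rule: int_cases2) auto
    then show ?thesis by auto
  qed
  finally show ?thesis by (simp add: Infinite_Set_Sum.abs_summable_on_def)
qed

lemma norm_frequency_ge: "\<bar>of_int (m $ i)\<bar> \<le> norm (frequency m)"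
  using component_le_norm_cart[of "frequency m" i] by simp

text \<open>Decay of order 4 in dimension 3. This convergent sum is what makes H^2 embed into the
  fields with absolutely summable coefficients.\<close>

lemma integrable_weight: "integrable lattice (\<lambda>m. 1 / (weight m)\<^sup>2)"
proof -
  let ?f = "\<lambda>k::int. (1 + (of_int k)\<^sup>2) powr (- 2 / 3) :: real"
  have "Infinite_Set_Sum.abs_summable_on (\<lambda>g. \<Prod>i\<in>(UNIV::3 set). ?f (g i)) (PiE UNIV (\<lambda>_. UNIV))"
    by (rule abs_summable_on_prod_PiE)
      (use integrable_int_powr in \<open>auto simp: Infinite_Set_Sum.abs_summable_on_def\<close>)
  then have "integrable (count_space UNIV) (\<lambda>g::3\<Rightarrow>int. \<Prod>i\<in>UNIV. ?f (g i))"
    by (simp add: Infinite_Set_Sum.abs_summable_on_def PiE_UNIV_domain)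
  moreover have bij: "bij (vec_nth :: int^3 \<Rightarrow> _)"
    unfolding bij_def inj_def surj_def
    by (metis vec_nth_inject vec_lambda_inverse UNIV_I)
  ultimately have int: "integrable lattice (\<lambda>m. \<Prod>i\<in>UNIV. ?f (m $ i))"
    by (simp only: integral_reindex_count_space(2)[OF bij, where f="\<lambda>g. \<Prod>i\<in>UNIV. ?f (g i)"])
  show ?thesis
  proof (rule Bochner_Integration.integrable_bound[OF int])
    have "1 / (weight m)\<^sup>2 \<le> (\<Prod>i\<in>UNIV. ?f (m $ i))" for m
    proof -
      have "(\<Prod>i\<in>(UNIV::3 set). (weight m) powr (- 2 / 3)) \<le> (\<Prod>i\<in>UNIV. ?f (m $ i))"
      proof (rule prod_mono, intro conjI)
        fix i
        have "(of_int (m $ i))\<^sup>2 \<le> (norm (frequency m))\<^sup>2"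
          using norm_frequency_ge[of m i] by (metis abs_ge_zero power2_abs power_mono)
        then show "(weight m) powr (- 2 / 3) \<le> ?f (m $ i)"
          by (intro powr_mono2') (auto simp: add_pos_nonneg)
      qed simp
      moreover have "(\<Prod>i\<in>(UNIV::3 set). (weight m) powr (- 2 / 3)) = 1 / (weight m)\<^sup>2"
      proof -
        have w: "weight m > 0" by (simp add: add_pos_nonneg)
        have "(\<Prod>i\<in>(UNIV::3 set). (weight m) powr (- 2 / 3)) = ((weight m) powr (- 2 / 3)) powr 3"
          by (simp add: powr_numeral)
        also have "\<dots> = weight m powr (- 2)" by (simp add: powr_powr)
        also have "\<dots> = 1 / (weight m)\<^sup>2" using w by (simp add: powr_minus_divide powr_numeral)
        finally show ?thesis .
      qed
      ultimately show ?thesis by simp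
    qed
    moreover have "0 \<le> (\<Prod>i\<in>UNIV. ?f (m $ i))" for m :: "int^3" by (intro prod_nonneg) auto
    ultimately show "AE m in lattice. norm (1 / (weight m)\<^sup>2) \<le> norm (\<Prod>i\<in>UNIV. ?f (m $ i))"
      by simp
  qed simp
qed

definition fourier_series :: "(int^3 \<Rightarrow> complex) \<Rightarrow> real^3 \<Rightarrow> complex" where
  "fourier_series a x = (LINT m|lattice. a m * emode m x)"

lemma integrable_mult_emode [simp]:
  "integrable lattice a \<Longrightarrow> integrable lattice (\<lambda>m. a m * emode m x)"
  by (rule Bochner_Integration.integrable_bound[where f=a]) (auto simp: norm_mult)

lemma norm_fourier_series_le:
  "cmod (fourier_series a x) \<le> (LINT m|lattice. cmod (a m))"
  unfolding fourier_series_def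
  using integral_norm_bound[of lattice "\<lambda>m. a m * emode m x"] by (simp add: norm_mult)

lemma continuous_fourier_series:
  assumes a: "integrable lattice a" shows "continuous_on UNIV (fourier_series a)"
proof -
  have "(fourier_series a \<longlongrightarrow> fourier_series a x) (at x within UNIV)" for x
    unfolding tendsto_at_iff_sequentially
  proof (intro allI impI)
    fix X assume "X \<longlonglongrightarrow> x"
    then have "(\<lambda>n. emode m (X n)) \<longlonglongrightarrow> emode m x" for m
      using continuous_emode[of UNIV m] by (metis UNIV_I continuous_on_tendsto_compose eventually_sequentiallyI)
    then show "(fourier_series a \<circ> X) \<longlonglongrightarrow> fourier_series a x"
      unfolding fourier_series_def o_def
      by (intro integral_dominated_convergence[where w="\<lambda>m. cmod (a m)"] AE_I2 tendsto_intros)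
        (use a in \<open>auto simp: norm_mult\<close>)
  qed
  then show ?thesis by (simp add: continuous_on_def)
qed

lemma periodic_fourier_series: "periodic (fourier_series a)"
  using periodic_emode by (simp add: periodic_def fourier_series_def)

text \<open>Termwise integration of an absolutely convergent series. The coefficient formula,
  Parseval, the convolution formula and the dyadic blocks below are all instances, with different
  choices of \<open>g\<close>.\<close>

lemma torus_integral_fourier_series:
  fixes g :: "real^3 \<Rightarrow> complex"
  assumes a: "integrable lattice a" and g: "integrable torus_measure g"
  shows "(LINT x|torus_measure. fourier_series a x * g x)
      = (LINT m|lattice. a m * (LINT x|torus_measure. emode m x * g x))"
    and "integrable lattice (\<lambda>m. a m * (LINT x|torus_measure. emode m x * g x))"
proof -
  have [measurable]: "g \<in> borel_measurable torus_measure" using g by simp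
  have meas: "(\<lambda>x. a m * (emode m x * g x)) \<in> borel_measurable torus_measure" for m by measurable
  have "(\<integral>\<^sup>+x. (\<integral>\<^sup>+m. ennreal (cmod (a m * (emode m x * g x))) \<partial>lattice) \<partial>torus_measure)
      = (\<integral>\<^sup>+x. (\<integral>\<^sup>+m. ennreal (cmod (a m)) \<partial>lattice) * ennreal (cmod (g x)) \<partial>torus_measure)"
    by (intro nn_integral_cong) (simp add: norm_mult ennreal_mult' nn_integral_multc)
  also have "\<dots> = (\<integral>\<^sup>+m. ennreal (cmod (a m)) \<partial>lattice) * (\<integral>\<^sup>+x. ennreal (cmod (g x)) \<partial>torus_measure)"
    by (intro nn_integral_cmult) simp
  also have "\<dots> < \<infinity>"
    using a g by (simp add: integrable_iff_bounded ennreal_mult_less_top)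
  finally have fin: "(\<integral>\<^sup>+x. (\<integral>\<^sup>+m. ennreal (cmod (a m * (emode m x * g x))) \<partial>lattice) \<partial>torus_measure) < \<infinity>" .
  note S = sums_swap[OF sigma_finite_torus meas fin]
  have *: "(LINT m|lattice. a m * (emode m x * g x)) = fourier_series a x * g x" for x
    unfolding fourier_series_def using a by (simp add: mult.assoc[symmetric])
  have i: "integrable torus_measure (\<lambda>x. emode m x * g x)" for m
    by (rule Bochner_Integration.integrable_bound[OF g]) (auto simp: norm_mult)
  show "integrable lattice (\<lambda>m. a m * (LINT x|torus_measure. emode m x * g x))"
    using S(4) i by simp
  show "(LINT x|torus_measure. fourier_series a x * g x)
      = (LINT m|lattice. a m * (LINT x|torus_measure. emode m x * g x))"
    using S(5) i by (simp add: *)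
qed

lemma integral_single_count_space:
  fixes f :: "'i \<Rightarrow> 'c::{banach,second_countable_topology}"
  shows "(LINT i|count_space UNIV. (if i = k then f i else 0)) = f k"
proof -
  have "{a. (if a = k then f a else 0) \<noteq> 0} \<subseteq> {k}" by auto
  then have "finite {a. (if a = k then f a else 0) \<noteq> 0}" by (rule finite_subset) simp
  moreover have "(\<Sum>a | (if a = k then f a else 0) \<noteq> 0. (if a = k then f a else 0)) = (\<Sum>a\<in>{k}. (if a = k then f a else 0))"
    by (rule sum.mono_neutral_left) auto
  ultimately show ?thesis
    by (subst lebesgue_integral_count_space_finite_support) (simp_all only: UNIV_I simp_thms, simp)
qed

lemma torus_integral_fourier_series_emode:
  assumes a: "integrable lattice a"
  shows "(LINT x|torus_measure. fourier_series a x * emode (- m) x) = of_real ((2 * pi) ^ 3) * a m"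
proof -
  have "(LINT x|torus_measure. fourier_series a x * emode (- m) x)
      = (LINT k|lattice. a k * (LINT x|torus_measure. emode k x * emode (- m) x))"
    by (rule torus_integral_fourier_series[OF a]) (intro integrable_torus_continuous continuous_intros)
  also have "\<dots> = (LINT k|lattice. (if k = m then of_real ((2 * pi) ^ 3) * a k else 0))"
    by (intro Bochner_Integration.integral_cong) (auto simp: emode_add[symmetric] torus_integral_emode)
  also have "\<dots> = of_real ((2 * pi) ^ 3) * a m"
    by (rule integral_single_count_space)
  finally show ?thesis .
qed

section \<open>Trigonometric test functions\<close>

text \<open>A derivative is recorded as a phase shift by pi/2, so that all iterated derivatives keep
  the same shape and smoothness follows by induction.\<close>

lemma dir_deriv_trig:
  fixes b :: "'b::real_normed_vector" and k :: "real^3"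
  shows "dir_deriv v (\<lambda>x. (c * cos (k \<bullet> x + \<alpha>)) *\<^sub>R b)
    = (\<lambda>x. (c * (k \<bullet> v) * cos (k \<bullet> x + (\<alpha> + pi / 2))) *\<^sub>R b)"
    and "(\<lambda>x. (c * cos (k \<bullet> x + \<alpha>)) *\<^sub>R b) differentiable (at x)"
proof -
  have d: "((\<lambda>x. (c * cos (k \<bullet> x + \<alpha>)) *\<^sub>R b) has_derivative
      (\<lambda>v. (c * (k \<bullet> v) * cos (k \<bullet> x + (\<alpha> + pi / 2))) *\<^sub>R b)) (at x)" for x
  proof -
    have "((\<lambda>x. (c * cos (k \<bullet> x + \<alpha>)) *\<^sub>R b) has_derivative
      (\<lambda>v. (c * (- sin (k \<bullet> x + \<alpha>) * (k \<bullet> v))) *\<^sub>R b)) (at x)"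
      by (auto intro!: derivative_eq_intros simp: algebra_simps)
    moreover have "cos (k \<bullet> x + (\<alpha> + pi / 2)) = - sin (k \<bullet> x + \<alpha>)"
      by (simp add: cos_add sin_add)
    ultimately show ?thesis by (simp add: mult_ac)
  qed
  show "dir_deriv v (\<lambda>x. (c * cos (k \<bullet> x + \<alpha>)) *\<^sub>R b)
    = (\<lambda>x. (c * (k \<bullet> v) * cos (k \<bullet> x + (\<alpha> + pi / 2))) *\<^sub>R b)"
    by (rule ext) (simp only: dir_deriv_def frechet_derivative_at[OF d, symmetric])
  show "(\<lambda>x. (c * cos (k \<bullet> x + \<alpha>)) *\<^sub>R b) differentiable (at x)"
    using d by (rule differentiableI)
qed

text \<open>A real substitute for the exponential modes, because the test functions of the equation
  are real. Phase 0 gives the cosine and phase pi/2 minus the sine; the vector \<open>b\<close> lets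
  one family serve scalar and vector tests.\<close>

definition trig_test :: "int^3 \<Rightarrow> real \<Rightarrow> 'b::real_normed_vector \<Rightarrow> real^3 \<Rightarrow> 'b" where
  "trig_test m \<alpha> b x = cos (frequency m \<bullet> x + \<alpha>) *\<^sub>R b"

lemma trig_test_smooth_periodic: "trig_test m \<alpha> b \<in> smooth_periodic"
proof -
  have "\<exists>c \<beta>. foldr dir_deriv vs (trig_test m \<alpha> b) = (\<lambda>x. (c * cos (frequency m \<bullet> x + \<beta>)) *\<^sub>R b)" for vs
  proof (induction vs)
    case Nil
    show ?case by (rule exI[of _ 1], rule exI[of _ \<alpha>]) (simp add: trig_test_def fun_eq_iff)
  next
    case (Cons v vs)
    then obtain c \<beta> where "foldr dir_deriv vs (trig_test m \<alpha> b) = (\<lambda>x. (c * cos (frequency m \<bullet> x + \<beta>)) *\<^sub>R b)"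
      by blast
    then show ?case by (auto simp: dir_deriv_trig)
  qed
  then have "smooth (trig_test m \<alpha> b)"
    unfolding smooth_def using dir_deriv_trig(2) by metis
  moreover have "periodic (trig_test m \<alpha> b)"
    unfolding periodic_def
  proof (intro allI)
    fix x j
    have "frequency m \<bullet> (x + axis j (2 * pi)) + \<alpha> = (frequency m \<bullet> x + \<alpha>) + 2 * pi * of_int (m $ j)"
      by (simp add: inner_add_right axis_eq_scaleR[of j "2 * pi"] inner_axis)
    then show "trig_test m \<alpha> b (x + axis j (2 * pi)) = trig_test m \<alpha> b x"
      unfolding trig_test_def
      by (metis Re_complex_of_real cis.sel(1) cis_mult cis_multiple_2pi mult.right_neutral Ints_of_int)
  qed
  ultimately show ?thesis by (simp add: smooth_periodic_def)
qed

lemma partial_trig_test: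
  "partial j (trig_test m \<alpha> b) = (\<lambda>x. of_int (m $ j) *\<^sub>R trig_test m (\<alpha> + pi / 2) b x)"
  using dir_deriv_trig(1)[of "axis j 1" 1 "frequency m" \<alpha> b]
  by (simp add: trig_test_def[abs_def] inner_axis)

lemma dir_deriv_scaleR:
  assumes "smooth f"
  shows "dir_deriv v (\<lambda>x. c *\<^sub>R f x) = (\<lambda>x. c *\<^sub>R dir_deriv v f x)"
proof (rule ext)
  fix x
  have "f differentiable (at x)" using assms unfolding smooth_def by (metis foldr.simps(1) id_apply)
  then have "((\<lambda>x. c *\<^sub>R f x) has_derivative (\<lambda>h. c *\<^sub>R frechet_derivative f (at x) h)) (at x)"
    by (intro has_derivative_scaleR_right) (simp add: frechet_derivative_works)
  from frechet_derivative_at[OF this, symmetric]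
  show "dir_deriv v (\<lambda>x. c *\<^sub>R f x) x = c *\<^sub>R dir_deriv v f x" by (simp add: dir_deriv_def)
qed

lemma laplacian_trig_test:
  "laplacian (trig_test m \<alpha> b) x = - (norm (frequency m))\<^sup>2 *\<^sub>R trig_test m \<alpha> b x"
proof -
  have "smooth (trig_test m \<beta> b)" for \<beta>
    using trig_test_smooth_periodic[of m \<beta> b] by (simp add: smooth_periodic_def)
  then have "partial j (partial j (trig_test m \<alpha> b)) x
      = (of_int (m $ j) * of_int (m $ j)) *\<^sub>R trig_test m (\<alpha> + pi / 2 + pi / 2) b x" for j
    by (simp add: partial_trig_test dir_deriv_scaleR)
  moreover have "trig_test m (\<alpha> + pi / 2 + pi / 2) b x = - trig_test m \<alpha> b x"
  proof -
    have "frequency m \<bullet> x + (\<alpha> + pi / 2 + pi / 2) = (frequency m \<bullet> x + \<alpha>) + pi" by simp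
    then show ?thesis unfolding trig_test_def by (simp only: cos_periodic_pi scaleR_minus_left)
  qed
  ultimately have "laplacian (trig_test m \<alpha> b) x = - (\<Sum>j\<in>UNIV. of_int (m $ j) * of_int (m $ j)) *\<^sub>R trig_test m \<alpha> b x"
    by (simp add: laplacian_def scaleR_sum_left sum_negf)
  also have "(\<Sum>j\<in>UNIV. of_int (m $ j) * of_int (m $ j)) = (norm (frequency m))\<^sup>2"
    by (simp add: power2_norm_eq_inner inner_vec_def)
  finally show ?thesis .
qed

lemma L2_torus_integrable:
  assumes "f \<in> L2_torus" shows "integrable torus_measure f"
proof (rule Bochner_Integration.integrable_bound)
  show "integrable torus_measure (\<lambda>x. 1 + (f x)\<^sup>2)" using assms by (simp add: L2_torus_def)
  have "\<bar>t\<bar> \<le> 1 + t\<^sup>2" for t :: real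
    using sum_power2_ge_zero[of "\<bar>t\<bar> - 1" "\<bar>t\<bar>"] by (simp add: power2_eq_square algebra_simps)
  then show "AE x in torus_measure. norm (f x) \<le> norm (1 + (f x)\<^sup>2)"
    by (simp add: add_nonneg_nonneg)
qed (use assms in \<open>simp add: L2_torus_def\<close>)

lemma torus_integral_trig:
  assumes f: "integrable torus_measure f"
  shows "(LINT x|torus_measure. f x * cos (frequency m \<bullet> x + \<alpha>)) = (2 * pi) ^ 3 * Re (cis (- \<alpha>) * fourier_coeff f m)"
proof -
  have i: "integrable torus_measure (\<lambda>x. of_real (f x) * emode (- m) x)"
    using integrable_torus_mult[OF f continuous_emode[of UNIV "- m"]] by (simp add: scaleR_conv_of_real)
  have "cis (- \<alpha>) * (of_real ((2 * pi) ^ 3) * fourier_coeff f m)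
     = (LINT x|torus_measure. cis (- \<alpha>) * (of_real (f x) * emode (- m) x))"
    by (simp add: fourier_coeff_eq)
  then have "Re (cis (- \<alpha>) * (of_real ((2 * pi) ^ 3) * fourier_coeff f m))
     = (LINT x|torus_measure. Re (cis (- \<alpha>) * (of_real (f x) * emode (- m) x)))"
    using integral_Re[OF integrable_mult_right[of "cis (- \<alpha>)", OF i]] by simp
  also have "\<dots> = (LINT x|torus_measure. f x * cos (frequency m \<bullet> x + \<alpha>))"
  proof (rule Bochner_Integration.integral_cong[OF refl])
    fix x
    have "cis (- \<alpha>) * emode (- m) x = cis (- \<alpha> + - (frequency m \<bullet> x))"
      by (simp add: emode_def cis_mult)
    then have "Re (cis (- \<alpha>) * emode (- m) x) = cos (frequency m \<bullet> x + \<alpha>)"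
      by (simp only: cis.sel cos_minus minus_add_distrib[symmetric] add.commute)
    moreover have "Re (cis (- \<alpha>) * (of_real (f x) * emode (- m) x)) = f x * Re (cis (- \<alpha>) * emode (- m) x)"
      by (simp add: algebra_simps)
    ultimately show "Re (cis (- \<alpha>) * (of_real (f x) * emode (- m) x)) = f x * cos (frequency m \<bullet> x + \<alpha>)"
      by (simp only:)
  qed
  finally have "Re (cis (- \<alpha>) * (of_real ((2 * pi) ^ 3) * fourier_coeff f m))
     = (LINT x|torus_measure. f x * cos (frequency m \<bullet> x + \<alpha>))" .
  moreover have "Re (cis (- \<alpha>) * (of_real r * z)) = r * Re (cis (- \<alpha>) * z)" for r z
    by (simp add: algebra_simps)
  ultimately show ?thesis by (simp only:)
qed

definition deriv_coeff :: "3 \<Rightarrow> (int^3 \<Rightarrow> complex) \<Rightarrow> int^3 \<Rightarrow> complex" where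
  "deriv_coeff j a m = \<i> * of_int (m $ j) * a m"

text \<open>Only real tests are available; the phases 0 and pi/2 yield the real and the imaginary
  part of the coefficient.\<close>

lemma fourier_coeff_weak_partial:
  assumes f: "integrable torus_measure f" and g: "integrable torus_measure g"
    and w: "is_weak_partial j f g"
  shows "fourier_coeff g m = deriv_coeff j (fourier_coeff f) m"
proof -
  let ?a = "fourier_coeff f m" and ?b = "fourier_coeff g m" and ?k = "of_int (m $ j) :: real"
  define P :: real where "P = (2 * pi) ^ 3"
  have P: "P \<noteq> 0" by (simp add: P_def)
  have eq: "Re (cis (- \<alpha>) * ?b) = - (?k * Re (cis (- (\<alpha> + pi / 2)) * ?a))" for \<alpha>
  proof -
    have "(LINT x|torus_measure. f x * partial j (trig_test m \<alpha> 1) x)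
        = - (LINT x|torus_measure. g x * trig_test m \<alpha> 1 x)"
      using w trig_test_smooth_periodic unfolding is_weak_partial_def by blast
    moreover have "(LINT x|torus_measure. f x * partial j (trig_test m \<alpha> 1) x)
        = ?k * (LINT x|torus_measure. f x * cos (frequency m \<bullet> x + (\<alpha> + pi / 2)))"
      by (subst integral_mult_right_zero[symmetric])
        (simp add: partial_trig_test trig_test_def mult.left_commute cong: Bochner_Integration.integral_cong)
    moreover have "(LINT x|torus_measure. g x * trig_test m \<alpha> 1 x) = (LINT x|torus_measure. g x * cos (frequency m \<bullet> x + \<alpha>))"
      by (simp add: trig_test_def)
    ultimately have "?k * (P * Re (cis (- (\<alpha> + pi / 2)) * ?a)) = - (P * Re (cis (- \<alpha>) * ?b))"
      by (simp only: torus_integral_trig[OF f, folded P_def] torus_integral_trig[OF g, folded P_def])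
    then have "P * (?k * Re (cis (- (\<alpha> + pi / 2)) * ?a)) = P * - Re (cis (- \<alpha>) * ?b)"
      by (simp only: mult.left_commute mult_minus_right)
    then have "?k * Re (cis (- (\<alpha> + pi / 2)) * ?a) = - Re (cis (- \<alpha>) * ?b)"
      by (rule iffD1[OF mult_left_cancel[OF P]])
    then show ?thesis by linarith
  qed
  have "Re ?b = - (?k * Im ?a)" using eq[of 0] by simp
  moreover have "Im ?b = ?k * Re ?a" using eq[of "pi / 2"] by (simp add: cis.ctr)
  ultimately show ?thesis by (simp add: deriv_coeff_def complex_eq_iff)
qed

section \<open>Regular Fourier series\<close>

lemma fourier_coeff_cnj: "fourier_coeff f (- m) = cnj (fourier_coeff f m)"
proof -
  have "cnj (LINT x|torus_measure. of_real (f x) * emode (- m) x) = (LINT x|torus_measure. of_real (f x) * emode m x)"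
    by (subst Bochner_Integration.integral_cnj[symmetric]) (simp add: cnj_emode)
  then show ?thesis by (simp add: fourier_coeff_eq)
qed

lemma fourier_series_real:
  assumes "\<forall>m. a (- m) = cnj (a m)"
  shows "of_real (Re (fourier_series a x)) = fourier_series a x"
proof -
  have "cnj (fourier_series a x) = (LINT m|lattice. a (- m) * emode (- m) x)"
    unfolding fourier_series_def by (subst Bochner_Integration.integral_cnj[symmetric]) (simp add: cnj_emode assms)
  also have "\<dots> = fourier_series a x"
    unfolding fourier_series_def
    by (rule integral_reindex_count_space(1)) (simp add: bij_uminus)
  finally show ?thesis by (simp add: complex_eq_iff)
qed

lemma fourier_coeff_series:
  assumes "integrable lattice a" "\<forall>m. a (- m) = cnj (a m)"
  shows "fourier_coeff (\<lambda>x. Re (fourier_series a x)) m = a m"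
  unfolding fourier_coeff_eq fourier_series_real[OF assms(2)]
    torus_integral_fourier_series_emode[OF assms(1)] by simp
lemma eq_fourier_series_AE:
  assumes f: "integrable torus_measure f" and a: "integrable lattice (fourier_coeff f)"
  shows "AE x in torus_measure. f x = Re (fourier_series (fourier_coeff f) x)"
proof (rule fourier_coeff_unique[OF f])
  show "integrable torus_measure (\<lambda>x. Re (fourier_series (fourier_coeff f) x))"
    by (intro integrable_torus_continuous continuous_intros continuous_fourier_series a)
qed (simp add: fourier_coeff_series[OF a] fourier_coeff_cnj)

lemma smooth_continuous_partial:
  assumes "smooth f"
  shows "continuous_on UNIV f" "continuous_on UNIV (partial j f)"
    and "((\<lambda>s. f (x + s *\<^sub>R axis j 1)) has_vector_derivative partial j f x) (at 0)"
proof -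
  have d0: "f differentiable (at x)" for x
    using assms unfolding smooth_def by (metis foldr.simps(1) id_apply)
  have "foldr dir_deriv [axis j 1] f differentiable (at x)" for x
    using assms unfolding smooth_def by blast
  then have "partial j f differentiable (at x)" for x by simp
  then show "continuous_on UNIV (partial j f)"
    by (meson differentiable_imp_continuous_within continuous_at_imp_continuous_on)
  show "continuous_on UNIV f"
    using d0 by (meson differentiable_imp_continuous_within continuous_at_imp_continuous_on)
  have "(f has_derivative frechet_derivative f (at x)) (at (x + 0 *\<^sub>R axis j 1))"
    using d0 by (simp add: frechet_derivative_works)
  moreover have "((\<lambda>s. x + s *\<^sub>R axis j 1) has_derivative (\<lambda>s. s *\<^sub>R axis j 1)) (at 0)"
    by (auto intro!: derivative_eq_intros)
  ultimately have "((\<lambda>s. f (x + s *\<^sub>R axis j 1)) has_derivative (\<lambda>s. frechet_derivative f (at x) (s *\<^sub>R axis j 1))) (at 0)"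
    by (rule has_derivative_compose[rotated])
  moreover have "frechet_derivative f (at x) (s *\<^sub>R axis j 1) = s *\<^sub>R partial j f x" for s
    using linear_frechet_derivative[OF d0] by (simp add: dir_deriv_def linear_scale)
  ultimately show "((\<lambda>s. f (x + s *\<^sub>R axis j 1)) has_vector_derivative partial j f x) (at 0)"
    by (simp add: has_vector_derivative_def)
qed

text \<open>For a single mode the product with the test function is periodic, so its derivative has
  integral zero. Absolute summability of both coefficient families allows summing these
  identities.\<close>

lemma weak_partial_fourier_series:
  assumes a: "integrable lattice a" and da: "integrable lattice (deriv_coeff j a)"
    and f: "f \<in> borel_measurable torus_measure" "AE x in torus_measure. f x = Re (fourier_series a x)"
  shows "is_weak_partial j f (\<lambda>x. Re (fourier_series (deriv_coeff j a) x))"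
  unfolding is_weak_partial_def
proof
  fix \<psi> :: "real^3 \<Rightarrow> real" assume "\<psi> \<in> smooth_periodic"
  then have sm: "smooth \<psi>" and per: "periodic \<psi>" by (auto simp: smooth_periodic_def)
  note c = smooth_continuous_partial[OF sm]
  have i1: "integrable torus_measure (\<lambda>x. complex_of_real (\<psi> x))"
    and i2: "integrable torus_measure (\<lambda>x. complex_of_real (partial j \<psi> x))"
    by (intro integrable_torus_continuous continuous_intros c)+
  have modes: "(LINT x|torus_measure. emode m x * of_real (partial j \<psi> x))
      = - (\<i> * of_int (m $ j) * (LINT x|torus_measure. emode m x * of_real (\<psi> x)))" for m
  proof -
    have "(LINT x|torus_measure. emode m x * of_real (partial j \<psi> x) + \<i> * of_int (m $ j) * emode m x * of_real (\<psi> x)) = 0"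
    proof (rule torus_integral_derivative_zero[where f="\<lambda>x. emode m x * of_real (\<psi> x)"])
      show "periodic (\<lambda>x. emode m x * of_real (\<psi> x))"
        using per periodic_emode by (simp add: periodic_def)
      show "((\<lambda>s. emode m (x + s *\<^sub>R axis j 1) * complex_of_real (\<psi> (x + s *\<^sub>R axis j 1))) has_vector_derivative
           emode m x * of_real (partial j \<psi> x) + \<i> * of_int (m $ j) * emode m x * of_real (\<psi> x)) (at 0)" for x
        using has_vector_derivative_mult[OF has_vector_derivative_emode bounded_linear.has_vector_derivative[OF bounded_linear_of_real c(3)]]
        by simp
    qed (intro continuous_intros c)+
    moreover have "integrable torus_measure (\<lambda>x. emode m x * of_real (partial j \<psi> x))"
      "integrable torus_measure (\<lambda>x. emode m x * of_real (\<psi> x))"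
      by (intro integrable_torus_continuous continuous_intros c)+
    ultimately show ?thesis by (simp add: mult.assoc add_eq_0_iff)
  qed
  have "(LINT x|torus_measure. fourier_series a x * of_real (partial j \<psi> x))
      = (LINT m|lattice. - (deriv_coeff j a m * (LINT x|torus_measure. emode m x * of_real (\<psi> x))))"
    unfolding torus_integral_fourier_series(1)[OF a i2]
    by (intro Bochner_Integration.integral_cong) (auto simp: modes deriv_coeff_def)
  also have "\<dots> = - (LINT x|torus_measure. fourier_series (deriv_coeff j a) x * of_real (\<psi> x))"
    unfolding torus_integral_fourier_series(1)[OF da i1] by simp
  finally have main: "(LINT x|torus_measure. fourier_series a x * of_real (partial j \<psi> x))
      = - (LINT x|torus_measure. fourier_series (deriv_coeff j a) x * of_real (\<psi> x))" .
  have Re_int: "(LINT x|torus_measure. Re (fourier_series b x) * g x) = Re (LINT x|torus_measure. fourier_series b x * of_real (g x))"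
    if b: "integrable lattice b" and g: "continuous_on UNIV g" for b and g :: "real^3 \<Rightarrow> real"
  proof -
    have "integrable torus_measure (\<lambda>x. fourier_series b x * of_real (g x))"
      by (intro integrable_torus_continuous continuous_intros continuous_fourier_series b g)
    then show ?thesis by (subst integral_Re[symmetric]) simp_all
  qed
  have [measurable]: "f \<in> borel_measurable torus_measure" by fact
  have [measurable]: "partial j \<psi> \<in> borel_measurable torus_measure"
    "(\<lambda>x. Re (fourier_series a x)) \<in> borel_measurable torus_measure"
    by (intro continuous_imp_measurable_torus continuous_intros c continuous_fourier_series a)+
  have "(LINT x|torus_measure. f x * partial j \<psi> x) = (LINT x|torus_measure. Re (fourier_series a x) * partial j \<psi> x)"
    by (rule integral_cong_AE) (use f(2) in auto)
  then show "(LINT x|torus_measure. f x * partial j \<psi> x)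
       = - (LINT x|torus_measure. Re (fourier_series (deriv_coeff j a) x) * \<psi> x)"
    using main by (simp add: Re_int a da c)
qed

lemma fourier_series_L2:
  assumes "integrable lattice a"
  shows "(\<lambda>x. Re (fourier_series a x)) \<in> L2_torus"
  unfolding L2_torus_def
proof (intro CollectI conjI)
  show "periodic (\<lambda>x. Re (fourier_series a x))"
    using periodic_fourier_series[of a] by (simp add: periodic_def)
  show "(\<lambda>x. Re (fourier_series a x)) \<in> borel_measurable torus_measure"
    by (intro continuous_imp_measurable_torus continuous_intros continuous_fourier_series assms)
  show "integrable torus_measure (\<lambda>x. (Re (fourier_series a x))\<^sup>2)"
    by (intro integrable_torus_continuous continuous_intros continuous_fourier_series assms)
qed

text \<open>\<open>weak_partial\<close> is a choice, so some square integrable weak derivative has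
  to be exhibited first; the differentiated series is one. The chosen function then has the same
  coefficients, which determine it almost everywhere.\<close>

lemma weak_partial_props:
  assumes f: "f \<in> L2_torus" and a: "integrable lattice (fourier_coeff f)"
    and da: "integrable lattice (deriv_coeff j (fourier_coeff f))"
  shows "weak_partial j f \<in> L2_torus"
    and "fourier_coeff (weak_partial j f) = deriv_coeff j (fourier_coeff f)"
    and "AE x in torus_measure. weak_partial j f x = Re (fourier_series (deriv_coeff j (fourier_coeff f)) x)"
proof -
  have "\<exists>g. g \<in> L2_torus \<and> is_weak_partial j f g"
    using fourier_series_L2[OF da] weak_partial_fourier_series[OF a da _ eq_fourier_series_AE[OF L2_torus_integrable[OF f] a]] f
    by (auto simp: L2_torus_def)
  then have *: "weak_partial j f \<in> L2_torus \<and> is_weak_partial j f (weak_partial j f)"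
    unfolding weak_partial_def by (rule someI_ex)
  then show w: "weak_partial j f \<in> L2_torus" by simp
  show eq: "fourier_coeff (weak_partial j f) = deriv_coeff j (fourier_coeff f)"
    using fourier_coeff_weak_partial[OF L2_torus_integrable[OF f] L2_torus_integrable[OF w]] * by (intro ext) simp
  show "AE x in torus_measure. weak_partial j f x = Re (fourier_series (deriv_coeff j (fourier_coeff f)) x)"
    using eq_fourier_series_AE[OF L2_torus_integrable[OF w]] da by (simp add: eq)
qed

text \<open>Dominated convergence of the difference quotients in each mode, with |exp(i h k) - 1| <=
  |h k| giving the coefficients of the derivative as majorant.\<close>

lemma has_vector_derivative_fourier_series:
  assumes a: "integrable lattice a" and da: "integrable lattice (deriv_coeff j a)"
  shows "((\<lambda>s. fourier_series a (x + s *\<^sub>R axis j 1)) has_vector_derivative fourier_series (deriv_coeff j a) x) (at 0)"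
proof -
  let ?q = "\<lambda>s. (1 / s) *\<^sub>R (fourier_series a (x + s *\<^sub>R axis j 1) - fourier_series a x)"
  have q: "?q s = (LINT m|lattice. a m * ((1 / s) *\<^sub>R (emode m (x + s *\<^sub>R axis j 1) - emode m x)))" for s
    unfolding fourier_series_def using a
    by (simp add: scaleR_conv_of_real right_diff_distrib mult.left_commute)
  have lim: "(?q \<longlongrightarrow> fourier_series (deriv_coeff j a) x) (at 0)"
    unfolding tendsto_at_iff_sequentially
  proof (intro allI impI)
    fix X :: "nat \<Rightarrow> real" assume X: "\<forall>i. X i \<in> UNIV - {0}" "X \<longlonglongrightarrow> 0"
    have "(\<lambda>n. LINT m|lattice. a m * ((1 / X n) *\<^sub>R (emode m (x + X n *\<^sub>R axis j 1) - emode m x)))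
       \<longlonglongrightarrow> (LINT m|lattice. a m * (\<i> * of_int (m $ j) * emode m x))"
    proof (rule integral_dominated_convergence[where w="\<lambda>m. cmod (deriv_coeff j a m)"])
      have "filterlim X (at 0) sequentially" using X by (intro filterlim_atI) auto
      then have "(\<lambda>n. (1 / X n) *\<^sub>R (emode m (x + X n *\<^sub>R axis j 1) - emode m x)) \<longlonglongrightarrow> \<i> * of_int (m $ j) * emode m x" for m
        by (rule filterlim_compose[OF has_vector_derivative_quotient[OF has_vector_derivative_emode]])
      then show "AE m in lattice. (\<lambda>n. a m * ((1 / X n) *\<^sub>R (emode m (x + X n *\<^sub>R axis j 1) - emode m x)))
          \<longlonglongrightarrow> a m * (\<i> * of_int (m $ j) * emode m x)"
        by (intro AE_I2 tendsto_intros)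
      fix n
      have "cmod (a m * ((1 / X n) *\<^sub>R (emode m (x + X n *\<^sub>R axis j 1) - emode m x))) \<le> cmod (deriv_coeff j a m)" for m
      proof -
        have "X n \<noteq> 0" using X by auto
        have "emode m (x + X n *\<^sub>R axis j 1) - emode m x = (cis (X n * of_int (m $ j)) - 1) * emode m x"
          by (simp add: emode_shift algebra_simps)
        then have "cmod (emode m (x + X n *\<^sub>R axis j 1) - emode m x) = cmod (cis (X n * of_int (m $ j)) - 1)"
          by (simp add: norm_mult)
        also have "\<dots> \<le> \<bar>X n * of_int (m $ j)\<bar>"
          using iexp_approx1[of "X n * of_int (m $ j)" 0] by (simp add: cis_conv_exp)
        finally have "\<bar>1 / X n\<bar> * cmod (emode m (x + X n *\<^sub>R axis j 1) - emode m x) \<le> \<bar>1 / X n\<bar> * \<bar>X n * of_int (m $ j)\<bar>"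
          by (intro mult_left_mono) auto
        also have "\<dots> = \<bar>of_int (m $ j)\<bar>" using \<open>X n \<noteq> 0\<close> by (simp add: abs_mult)
        finally have "(\<bar>1 / X n\<bar> * cmod (emode m (x + X n *\<^sub>R axis j 1) - emode m x)) * cmod (a m) \<le> \<bar>of_int (m $ j)\<bar> * cmod (a m)"
          by (rule mult_right_mono) simp
        moreover have "norm (a m * (r *\<^sub>R z)) = (\<bar>r\<bar> * cmod z) * cmod (a m)" for r z
          by (simp add: norm_mult)
        moreover have "cmod (deriv_coeff j a m) = \<bar>of_int (m $ j)\<bar> * cmod (a m)"
          by (simp add: deriv_coeff_def norm_mult)
        ultimately show ?thesis by (simp only:)
      qed
      then show "AE m in lattice. norm (a m * ((1 / X n) *\<^sub>R (emode m (x + X n *\<^sub>R axis j 1) - emode m x))) \<le> cmod (deriv_coeff j a m)"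
        by (intro AE_I2)
    qed (use da in auto)
    then show "(?q \<circ> X) \<longlonglongrightarrow> fourier_series (deriv_coeff j a) x"
      unfolding o_def q by (simp add: fourier_series_def deriv_coeff_def mult_ac)
  qed
  have "(\<lambda>h. norm (?q h - fourier_series (deriv_coeff j a) x)) \<midarrow>0\<rightarrow> 0"
    by (rule tendsto_norm_zero[OF Lim_null[THEN iffD1, OF lim]])
  moreover have "\<forall>\<^sub>F h in at 0. norm (?q h - fourier_series (deriv_coeff j a) x)
     = norm (fourier_series a (x + h *\<^sub>R axis j 1) - fourier_series a x - h *\<^sub>R fourier_series (deriv_coeff j a) x) / norm h"
  proof (rule eventually_at_filter[THEN iffD2, OF always_eventually], intro allI impI)
    fix h :: real assume "h \<noteq> 0"
    then have "?q h - fourier_series (deriv_coeff j a) x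
      = (1 / h) *\<^sub>R (fourier_series a (x + h *\<^sub>R axis j 1) - fourier_series a x - h *\<^sub>R fourier_series (deriv_coeff j a) x)"
      by (simp add: scaleR_right_diff_distrib)
    then show "norm (?q h - fourier_series (deriv_coeff j a) x)
      = norm (fourier_series a (x + h *\<^sub>R axis j 1) - fourier_series a x - h *\<^sub>R fourier_series (deriv_coeff j a) x) / norm h"
      by (simp del: scaleR_right_diff_distrib)
  qed
  ultimately have "(\<lambda>h. norm (fourier_series a (x + h *\<^sub>R axis j 1) - fourier_series a x - h *\<^sub>R fourier_series (deriv_coeff j a) x) / norm h) \<midarrow>0\<rightarrow> 0"
    by (rule Lim_transform_eventually)
  then show ?thesis
    unfolding has_vector_derivative_def has_derivative_at by (simp add: bounded_linear_scaleR_left)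
qed

text \<open>The series is integrated term by term against its own conjugate, whose coefficients are
  known.\<close>

lemma parseval_fourier_series:
  assumes a: "integrable lattice a"
  shows "(LINT x|torus_measure. (cmod (fourier_series a x))\<^sup>2) = (2 * pi) ^ 3 * (LINT m|lattice. (cmod (a m))\<^sup>2)"
    and "integrable lattice (\<lambda>m. (cmod (a m))\<^sup>2)"
proof -
  have i: "integrable torus_measure (\<lambda>x. cnj (fourier_series a x))"
    by (intro integrable_torus_continuous continuous_intros continuous_fourier_series a)
  have coeff: "(LINT x|torus_measure. emode m x * cnj (fourier_series a x)) = of_real ((2 * pi) ^ 3) * cnj (a m)" for m
  proof -
    have "cnj (LINT x|torus_measure. fourier_series a x * emode (- m) x) = (LINT x|torus_measure. emode m x * cnj (fourier_series a x))"
      by (subst Bochner_Integration.integral_cnj[symmetric]) (simp add: cnj_emode mult.commute)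
    then show ?thesis unfolding torus_integral_fourier_series_emode[OF a] by simp
  qed
  have sq: "a m * (of_real ((2 * pi) ^ 3) * cnj (a m)) = of_real ((2 * pi) ^ 3 * (cmod (a m))\<^sup>2)" for m
    by (simp add: complex_norm_square mult_ac del: of_real_power)
  have "integrable lattice (\<lambda>m. complex_of_real ((2 * pi) ^ 3 * (cmod (a m))\<^sup>2))"
    using torus_integral_fourier_series(2)[OF a i] unfolding coeff sq .
  then have "integrable lattice (\<lambda>m. (2 * pi) ^ 3 * (cmod (a m))\<^sup>2)"
    by (simp only: complex_of_real_integrable_eq)
  then show "integrable lattice (\<lambda>m. (cmod (a m))\<^sup>2)" by simp
  have "(LINT x|torus_measure. fourier_series a x * cnj (fourier_series a x))
     = (LINT m|lattice. complex_of_real ((2 * pi) ^ 3 * (cmod (a m))\<^sup>2))"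
    using torus_integral_fourier_series(1)[OF a i] unfolding coeff sq .
  moreover have "(LINT x|torus_measure. fourier_series a x * cnj (fourier_series a x))
     = of_real (LINT x|torus_measure. (cmod (fourier_series a x))\<^sup>2)"
    by (subst integral_complex_of_real[symmetric]) (simp add: complex_norm_square del: of_real_power)
  ultimately show "(LINT x|torus_measure. (cmod (fourier_series a x))\<^sup>2) = (2 * pi) ^ 3 * (LINT m|lattice. (cmod (a m))\<^sup>2)"
    by (simp only: integral_complex_of_real of_real_eq_iff integral_mult_right_zero)
qed

text \<open>The squared distance from \<open>g\<close> to the trigonometric polynomial with the
  coefficients of \<open>g\<close> on a finite set \<open>S\<close> is nonnegative, and Parseval
  applies to that polynomial. The resulting bound is uniform in \<open>S\<close>.\<close>

lemma bessel:
  assumes g: "g \<in> L2_torus"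
  shows "integrable lattice (\<lambda>m. (cmod (fourier_coeff g m))\<^sup>2)"
    and "(2 * pi) ^ 3 * (LINT m|lattice. (cmod (fourier_coeff g m))\<^sup>2) \<le> (LINT x|torus_measure. (g x)\<^sup>2)"
proof -
  let ?I = "LINT x|torus_measure. (g x)\<^sup>2" and ?N = "fourier_coeff g"
  have g2: "integrable torus_measure (\<lambda>x. (g x)\<^sup>2)" using g by (simp add: L2_torus_def)
  have g1: "integrable torus_measure g" by (rule L2_torus_integrable[OF g])
  have fin: "(2 * pi) ^ 3 * (\<Sum>m\<in>S. (cmod (?N m))\<^sup>2) \<le> ?I" if S: "finite S" for S
  proof -
    define a where "a m = (if m \<in> S then ?N m else 0)" for m
    have supp: "{m. a m \<noteq> 0} \<subseteq> S" by (auto simp: a_def)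
    have "(\<lambda>m. cmod (a m)) summable_on UNIV"
      using S supp by (intro finite_nonzero_values_imp_summable_on) (auto intro: finite_subset)
    then have "integrable lattice (\<lambda>m. cmod (a m))"
      by (simp add: integrable_iff_summable_on_nonneg)
    then have a: "integrable lattice a"
      by (subst (asm) integrable_norm_iff) simp_all
    let ?P = "fourier_series a"
    have cP: "continuous_on UNIV ?P" by (rule continuous_fourier_series[OF a])
    have sums: "(LINT m|lattice. (cmod (a m))\<^sup>2) = (\<Sum>m\<in>S. (cmod (?N m))\<^sup>2)"
    proof -
      have *: "{m. (cmod (a m))\<^sup>2 \<noteq> 0} \<subseteq> S" by (auto simp: a_def)
      then have "finite {m. (cmod (a m))\<^sup>2 \<noteq> 0}" using S by (rule finite_subset)
      then have "(LINT m|lattice. (cmod (a m))\<^sup>2) = (\<Sum>m | (cmod (a m))\<^sup>2 \<noteq> 0. (cmod (a m))\<^sup>2)"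
        by (subst lebesgue_integral_count_space_finite_support) simp_all
      also have "\<dots> = (\<Sum>m\<in>S. (cmod (a m))\<^sup>2)"
        by (rule sum.mono_neutral_left[OF S]) (auto simp: a_def)
      also have "\<dots> = (\<Sum>m\<in>S. (cmod (?N m))\<^sup>2)" by (simp add: a_def)
      finally show ?thesis .
    qed
    have "(LINT x|torus_measure. ?P x * of_real (g x)) = (LINT m|lattice. a m * (of_real ((2 * pi) ^ 3) * cnj (?N m)))"
    proof -
      have "(LINT x|torus_measure. emode m x * of_real (g x)) = of_real ((2 * pi) ^ 3) * cnj (?N m)" for m
        unfolding fourier_coeff_cnj[symmetric] by (simp add: fourier_coeff_eq mult.commute)
      then show ?thesis using torus_integral_fourier_series(1)[OF a, of "\<lambda>x. of_real (g x)"] g1 by simp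
    qed
    also have "\<dots> = (LINT m|lattice. of_real ((2 * pi) ^ 3 * (cmod (a m))\<^sup>2))"
      by (intro Bochner_Integration.integral_cong)
        (auto simp: a_def complex_norm_square mult_ac simp del: of_real_power)
    finally have cross: "(LINT x|torus_measure. ?P x * of_real (g x)) = of_real ((2 * pi) ^ 3 * (\<Sum>m\<in>S. (cmod (?N m))\<^sup>2))"
      by (simp only: integral_complex_of_real integral_mult_right_zero sums)
    have iP: "integrable torus_measure (\<lambda>x. ?P x * of_real (g x))"
      using integrable_torus_mult[OF g1 cP] by (simp add: scaleR_conv_of_real mult.commute)
    have iP2: "integrable torus_measure (\<lambda>x. (cmod (?P x))\<^sup>2)"
      by (intro integrable_torus_continuous continuous_intros cP)
    have "0 \<le> (LINT x|torus_measure. (cmod (of_real (g x) - ?P x))\<^sup>2)" by (rule integral_nonneg_AE) simp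
    also have "\<dots> = (LINT x|torus_measure. (g x)\<^sup>2 - 2 * Re (?P x * of_real (g x)) + (cmod (?P x))\<^sup>2)"
      by (intro Bochner_Integration.integral_cong refl, unfold cmod_power2)
        (simp add: power2_eq_square algebra_simps)
    also have "\<dots> = ?I - 2 * Re (LINT x|torus_measure. ?P x * of_real (g x)) + (LINT x|torus_measure. (cmod (?P x))\<^sup>2)"
    proof -
      have gen: "(LINT x|torus_measure. p x - 2 * q x + r x)
          = (LINT x|torus_measure. p x) - 2 * (LINT x|torus_measure. q x) + (LINT x|torus_measure. r x)"
        if "integrable torus_measure p" "integrable torus_measure q" "integrable torus_measure r"
        for p q r :: "real^3 \<Rightarrow> real"
        using that by simp
      show ?thesis by (rule gen[OF g2 integrable_Re[OF iP] iP2, unfolded integral_Re[OF iP]])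
    qed
    also have "\<dots> = ?I - (2 * pi) ^ 3 * (\<Sum>m\<in>S. (cmod (?N m))\<^sup>2)"
      unfolding cross parseval_fourier_series(1)[OF a] sums by (simp del: of_real_power of_real_mult)
    finally show ?thesis by simp
  qed
  have fin': "(\<Sum>m\<in>S. (cmod (?N m))\<^sup>2) \<le> ?I / (2 * pi) ^ 3" if "finite S" for S
    using fin[OF that] by (simp add: pos_le_divide_eq mult.commute)
  have summ: "(\<lambda>m. (cmod (?N m))\<^sup>2) summable_on UNIV"
    by (rule nonneg_bdd_above_summable_on) (auto intro!: bdd_aboveI2[where M="?I / (2 * pi) ^ 3"] fin')
  then show int: "integrable lattice (\<lambda>m. (cmod (?N m))\<^sup>2)"
    by (simp add: integrable_iff_summable_on_nonneg)
  have "infsum (\<lambda>m. (cmod (?N m))\<^sup>2) UNIV \<le> ?I / (2 * pi) ^ 3"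
    by (rule infsum_le_finite_sums[OF summ]) (use fin' in auto)
  then show "(2 * pi) ^ 3 * (LINT m|lattice. (cmod (?N m))\<^sup>2) \<le> ?I"
    unfolding infsum_eq_lebesgue_integral[OF int] by (simp add: pos_le_divide_eq mult.commute)
qed

section \<open>The Kuramoto-Sivashinsky nonlinearity on fourth order Sobolev functions\<close>

definition mode :: "(real^3 \<Rightarrow> real^3) \<Rightarrow> 3 \<Rightarrow> int^3 \<Rightarrow> complex" where
  "mode u i = fourier_coeff (\<lambda>x. u x $ i)"

definition mode_sq :: "(real^3 \<Rightarrow> real^3) \<Rightarrow> int^3 \<Rightarrow> real" where
  "mode_sq u m = (\<Sum>i\<in>UNIV. (cmod (mode u i m))\<^sup>2)"

text \<open>The squared Sobolev norm on the side of the coefficients. It omits the Parseval factor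
  (2 pi)^3, which reappears whenever energies are compared with integrals over the torus.\<close>

definition energy :: "nat \<Rightarrow> (real^3 \<Rightarrow> real^3) \<Rightarrow> real" where
  "energy s u = (LINT m|lattice. weight m ^ s * mode_sq u m)"

definition nonlin :: "(real^3 \<Rightarrow> real^3) \<Rightarrow> 3 \<Rightarrow> int^3 \<Rightarrow> complex" where
  "nonlin u i = fourier_coeff (\<lambda>x. convection u x $ i)"

text \<open>Fourier symbol of the linear part, minus lam times the Laplacian minus the
  bi-Laplacian.\<close>

definition growth :: "real \<Rightarrow> int^3 \<Rightarrow> real" where
  "growth lam m = lam * (norm (frequency m))\<^sup>2 - (norm (frequency m)) ^ 4"

definition mode_rhs :: "real \<Rightarrow> (real^3 \<Rightarrow> real^3) \<Rightarrow> 3 \<Rightarrow> int^3 \<Rightarrow> complex" where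
  "mode_rhs lam u i m = of_real (growth lam m) * mode u i m - nonlin u i m"

text \<open>The share of frequency \<open>m\<close> in the time derivative of
  \<open>energy s\<close>: d/dt |z|^2 = 2 Re (cnj z * z') with z' given by
  \<open>mode_rhs\<close>.\<close>

definition flux :: "real \<Rightarrow> nat \<Rightarrow> (real^3 \<Rightarrow> real^3) \<Rightarrow> int^3 \<Rightarrow> real" where
  "flux lam s u m = weight m ^ s * (\<Sum>i\<in>UNIV. 2 * Re (cnj (mode u i m) * mode_rhs lam u i m))"

definition weight_const :: real where
  "weight_const = (LINT m|lattice. 1 / (weight m)\<^sup>2)"

lemma sobolev_term_eq: "sobolev_term s u m = weight m ^ s * mode_sq u m"
  by (simp add: sobolev_term_def mode_sq_def mode_def)

lemma mode_sq_nonneg [simp]: "mode_sq u m \<ge> 0"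
  by (simp add: mode_sq_def sum_nonneg)

lemma weight_ge1 [simp]: "weight m \<ge> 1" "weight m > 0"
  by (simp_all add: add_pos_nonneg)

lemma cmod_mode_sq_le: "(cmod (mode u i m))\<^sup>2 \<le> mode_sq u m"
  unfolding mode_sq_def by (rule member_le_sum) auto

lemma sobolev_iff:
  "u \<in> sobolev s \<longleftrightarrow> (\<forall>i. (\<lambda>x. u x $ i) \<in> L2_torus) \<and> integrable lattice (\<lambda>m. weight m ^ s * mode_sq u m)"
  by (subst integrable_iff_summable_on_nonneg) (auto simp: sobolev_def sobolev_term_eq[abs_def])

lemma sobolev_norm_eq: "u \<in> sobolev s \<Longrightarrow> sobolev_norm s u = sqrt (energy s u)"
  unfolding sobolev_iff sobolev_norm_def energy_def
  by (simp add: infsum_eq_lebesgue_integral sobolev_term_eq[abs_def])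

lemma energy_nonneg [simp]: "energy s u \<ge> 0"
  unfolding energy_def by (rule integral_nonneg_AE) simp

lemma integrable_energy_le:
  assumes "u \<in> sobolev t" "s \<le> t"
  shows "integrable lattice (\<lambda>m. weight m ^ s * mode_sq u m)"
proof (rule Bochner_Integration.integrable_bound)
  show "integrable lattice (\<lambda>m. weight m ^ t * mode_sq u m)" using assms by (simp add: sobolev_iff)
  have "weight m ^ s * mode_sq u m \<le> weight m ^ t * mode_sq u m" for m
    using assms(2) by (intro mult_right_mono power_increasing) auto
  then show "AE m in lattice. norm (weight m ^ s * mode_sq u m) \<le> norm (weight m ^ t * mode_sq u m)"
    by (simp add: abs_mult)
qed simp

lemma sobolev_mono: "u \<in> sobolev t \<Longrightarrow> s \<le> t \<Longrightarrow> u \<in> sobolev s"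
  using integrable_energy_le[of u t s] by (simp add: sobolev_iff)

lemma weight_const_nonneg: "weight_const \<ge> 0"
  unfolding weight_const_def by (rule integral_nonneg_AE) simp

text \<open>Cauchy-Schwarz for the splitting weight^k |mode| = (1 / weight) (weight^(k+1) |mode|).
  The case s = 2, k = 1 covers second derivatives of H^4 fields, and s = 0, k = 0 covers H^2 fields
  themselves.\<close>

lemma integrable_mode_sobolev:
  assumes "u \<in> sobolev (s + 2)" "(\<And>m. cmod (b m) \<le> weight m ^ k * cmod (mode u i m))" "2 * k + 2 \<le> s + 2"
  shows "integrable lattice b"
    and "(LINT m|lattice. cmod (b m))\<^sup>2 \<le> weight_const * energy (s + 2) u"
proof -
  let ?g = "\<lambda>m. weight m ^ (k + 1) * cmod (mode u i m)"
  have le: "(?g m)\<^sup>2 \<le> weight m ^ (s + 2) * mode_sq u m" for m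
  proof -
    have "(?g m)\<^sup>2 = weight m ^ (2 * k + 2) * (cmod (mode u i m))\<^sup>2"
    proof -
      have "(k + 1) * 2 = 2 * k + 2" by simp
      then show ?thesis by (simp only: power_mult_distrib power_mult[symmetric])
    qed
    also have "\<dots> \<le> weight m ^ (s + 2) * mode_sq u m"
      using assms(3) by (intro mult_mono power_increasing cmod_mode_sq_le) auto
    finally show ?thesis .
  qed
  have i1: "integrable lattice (\<lambda>m. (1 / weight m)\<^sup>2)"
    using integrable_weight by (simp add: power_one_over)
  have i2: "integrable lattice (\<lambda>m. (?g m)\<^sup>2)"
    by (rule Bochner_Integration.integrable_bound[OF integrable_energy_le[OF assms(1) order_refl]])
      (use le in \<open>auto intro: order_trans[OF _ abs_ge_self]\<close>)
  note CS = Cauchy_Schwarz_integral[OF _ _ i1 i2]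
  have eq: "1 / weight m * ?g m = weight m ^ k * cmod (mode u i m)" for m
  proof -
    have "weight m \<noteq> 0" using weight_ge1(2)[of m] by linarith
    then show ?thesis by simp
  qed
  have i3: "integrable lattice (\<lambda>m. weight m ^ k * cmod (mode u i m))"
    using CS(1) unfolding eq by simp
  show b: "integrable lattice b"
    by (rule Bochner_Integration.integrable_bound[OF i3])
      (use assms(2) in \<open>auto intro: order_trans[OF _ abs_ge_self]\<close>)
  have "(LINT m|lattice. cmod (b m)) \<le> (LINT m|lattice. weight m ^ k * cmod (mode u i m))"
    by (intro integral_mono i3) (use b assms(2) in auto)
  then have "(LINT m|lattice. cmod (b m))\<^sup>2 \<le> (LINT m|lattice. weight m ^ k * cmod (mode u i m))\<^sup>2"
    by (intro power_mono) (auto intro: integral_nonneg_AE)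
  also have "\<dots> \<le> (LINT m|lattice. (1 / weight m)\<^sup>2) * (LINT m|lattice. (?g m)\<^sup>2)"
    using CS(2) unfolding eq by simp
  also have "\<dots> \<le> weight_const * energy (s + 2) u"
  proof (rule mult_mono)
    show "(LINT m|lattice. (1 / weight m)\<^sup>2) \<le> weight_const"
      by (simp add: weight_const_def power_one_over)
    show "(LINT m|lattice. (?g m)\<^sup>2) \<le> energy (s + 2) u"
      unfolding energy_def by (intro integral_mono i2 integrable_energy_le[OF assms(1)] le) simp
  qed (auto simp: weight_const_nonneg intro: integral_nonneg_AE)
  finally show "(LINT m|lattice. cmod (b m))\<^sup>2 \<le> weight_const * energy (s + 2) u" .
qed

lemma norm_frequency_le_weight: "norm (frequency m) \<le> weight m"
  using sum_power2_ge_zero[of "norm (frequency m) - 1" "norm (frequency m)"]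
  by (simp add: power2_eq_square algebra_simps)

lemma abs_frequency_le: "\<bar>of_int (m $ j)\<bar> \<le> weight m"
  using norm_frequency_ge[of m j] norm_frequency_le_weight[of m] by linarith

lemma sum_frequency_sq: "(\<Sum>j\<in>UNIV. (of_int (m $ j))\<^sup>2) = (norm (frequency m))\<^sup>2"
  unfolding power2_norm_eq_inner inner_vec_def by (simp add: power2_eq_square)

lemma integral_abs_bound_AE:
  assumes "AE x in M. \<bar>f x\<bar> \<le> g x" "integrable M g" "f \<in> borel_measurable M"
  shows "\<bar>LINT x|M. f x\<bar> \<le> (LINT x|M. g x :: real)"
proof -
  have f: "integrable M f"
    by (rule Bochner_Integration.integrable_bound[OF assms(2,3)]) (use assms(1) in auto)
  have "\<bar>LINT x|M. f x\<bar> \<le> (LINT x|M. \<bar>f x\<bar>)" by (rule integral_abs_bound)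
  also have "\<dots> \<le> (LINT x|M. g x)" by (rule integral_mono_AE) (use f assms in auto)
  finally show ?thesis .
qed

text \<open>A single time slice, at a time where the solution lies in H^4. Below, \<open>U\<close>
  and \<open>V\<close> are the continuous representatives of the components and of their first
  derivatives, so products and integrations by parts are classical; \<open>u\<close> and its chosen
  weak derivatives agree with them almost everywhere.\<close>

locale h4_state =
  fixes u :: "real^3 \<Rightarrow> real^3"
  assumes H4: "u \<in> sobolev 4"
begin

lemma H2: "u \<in> sobolev 2"
  by (rule sobolev_mono[OF H4]) simp

lemma component_L2: "(\<lambda>x. u x $ i) \<in> L2_torus"
  using H4 by (simp add: sobolev_iff)

lemma int_mode: "integrable lattice (mode u i)"
  by (rule integrable_mode_sobolev(1)[where u=u and s=2 and k=0]) (use H4 in auto)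

lemma mode_l1_bound: "(LINT m|lattice. cmod (mode u i m))\<^sup>2 \<le> weight_const * energy 2 u"
  using integrable_mode_sobolev(2)[where u=u and s=0 and k=0 and b="mode u i" and i=i] H2 by (simp add: numeral_2_eq_2)

lemma int_deriv: "integrable lattice (deriv_coeff j (mode u i))"
  by (rule integrable_mode_sobolev(1)[where u=u and s=2 and k=1])
    (use H4 in \<open>auto simp: deriv_coeff_def norm_mult intro!: mult_right_mono abs_frequency_le\<close>)

lemma int_deriv2: "integrable lattice (deriv_coeff k (deriv_coeff j (mode u i)))"
proof (rule integrable_mode_sobolev(1)[where u=u and s=2 and k=1])
  fix m
  have "\<bar>of_int (m $ k)\<bar> * \<bar>of_int (m $ j)\<bar> \<le> norm (frequency m) * norm (frequency m)"
    by (intro mult_mono norm_frequency_ge) auto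
  also have "\<dots> \<le> weight m" by (simp add: power2_eq_square)
  finally have "\<bar>of_int (m $ k)\<bar> * \<bar>of_int (m $ j)\<bar> * cmod (mode u i m) \<le> weight m * cmod (mode u i m)"
    by (rule mult_right_mono) simp
  then show "cmod (deriv_coeff k (deriv_coeff j (mode u i)) m) \<le> weight m ^ 1 * cmod (mode u i m)"
    by (simp add: deriv_coeff_def norm_mult mult.assoc)
qed (use H4 in auto)

definition U :: "3 \<Rightarrow> real^3 \<Rightarrow> real" where
  "U i x = Re (fourier_series (mode u i) x)"

definition V :: "3 \<Rightarrow> 3 \<Rightarrow> real^3 \<Rightarrow> real" where
  "V j i x = Re (fourier_series (deriv_coeff j (mode u i)) x)"

lemma mode_cnj: "\<forall>m. mode u i (- m) = cnj (mode u i m)"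
  by (simp add: mode_def fourier_coeff_cnj)

lemma deriv_cnj: "\<forall>m. deriv_coeff j (mode u i) (- m) = cnj (deriv_coeff j (mode u i) m)"
  by (simp add: deriv_coeff_def mode_cnj)

lemma of_real_U: "of_real (U i x) = fourier_series (mode u i) x"
  unfolding U_def by (rule fourier_series_real[OF mode_cnj])

lemma of_real_V: "of_real (V j i x) = fourier_series (deriv_coeff j (mode u i)) x"
  unfolding V_def by (rule fourier_series_real[OF deriv_cnj])

lemma cont_U [continuous_intros]: "continuous_on UNIV (U i)"
  unfolding U_def[abs_def] by (intro continuous_intros continuous_fourier_series int_mode)

lemma cont_V [continuous_intros]: "continuous_on UNIV (V j i)"
  unfolding V_def[abs_def] by (intro continuous_intros continuous_fourier_series int_deriv)

lemma periodic_U: "periodic (U i)"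
  using periodic_fourier_series[of "mode u i"] by (simp add: periodic_def U_def)

lemma periodic_V: "periodic (V j i)"
  using periodic_fourier_series[of "deriv_coeff j (mode u i)"] by (simp add: periodic_def V_def)

lemma deriv_U: "((\<lambda>s. U i (x + s *\<^sub>R axis j 1)) has_vector_derivative V j i x) (at 0)"
  unfolding U_def V_def
  by (rule bounded_linear.has_vector_derivative[OF bounded_linear_Re])
    (rule has_vector_derivative_fourier_series[OF int_mode int_deriv])

lemma AE_U: "AE x in torus_measure. u x $ i = U i x"
  using eq_fourier_series_AE[OF L2_torus_integrable[OF component_L2]] int_mode
  by (simp add: U_def mode_def)

lemma weak_partial_component:
  shows "weak_partial j (\<lambda>y. u y $ i) \<in> L2_torus"
    and "fourier_coeff (weak_partial j (\<lambda>y. u y $ i)) = deriv_coeff j (mode u i)"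
    and "AE x in torus_measure. weak_partial j (\<lambda>y. u y $ i) x = V j i x"
  using weak_partial_props[OF component_L2, of i j] int_mode[of i] int_deriv[of j i]
  by (simp_all add: mode_def V_def)

lemma weak_partial_component2:
  shows "weak_partial k (weak_partial j (\<lambda>y. u y $ i)) \<in> L2_torus"
    and "fourier_coeff (weak_partial k (weak_partial j (\<lambda>y. u y $ i))) = deriv_coeff k (deriv_coeff j (mode u i))"
  using weak_partial_props[OF weak_partial_component(1)[of j i], of k] int_deriv int_deriv2
  by (simp_all add: weak_partial_component(2))

definition conv :: "3 \<Rightarrow> real^3 \<Rightarrow> real" where
  "conv i x = (\<Sum>j\<in>UNIV. U j x * V j i x)"

lemma cont_conv [continuous_intros]: "continuous_on UNIV (conv i)"
  unfolding conv_def[abs_def] by (intro continuous_intros)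

lemma convection_measurable: "(\<lambda>x. convection u x $ i) \<in> borel_measurable torus_measure"
proof -
  have [measurable]: "(\<lambda>x. u x $ j) \<in> borel_measurable torus_measure"
    "weak_partial j (\<lambda>y. u y $ i) \<in> borel_measurable torus_measure" for j
    using component_L2[of j] weak_partial_component(1)[of j i] by (auto simp: L2_torus_def)
  show ?thesis unfolding convection_def by simp
qed

lemma AE_convection: "AE x in torus_measure. convection u x $ i = conv i x"
proof -
  have "AE x in torus_measure. \<forall>j\<in>UNIV. u x $ j = U j x \<and> weak_partial j (\<lambda>y. u y $ i) x = V j i x"
    by (rule AE_finite_allI) (auto intro: AE_U weak_partial_component(3) AE_conjI)
  then show ?thesis by eventually_elim (simp add: convection_def conv_def)
qed

lemma convection_integral:
  assumes "continuous_on UNIV (g :: _ \<Rightarrow> 'b::{banach,second_countable_topology})"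
  shows "(LINT x|torus_measure. (convection u x $ i) *\<^sub>R g x) = (LINT x|torus_measure. conv i x *\<^sub>R g x)"
proof -
  note [measurable] = convection_measurable continuous_imp_measurable_torus[OF assms]
    continuous_imp_measurable_torus[OF cont_conv]
  show ?thesis by (rule integral_cong_AE) (use AE_convection[of i] in auto)
qed

lemma convection_integrable: "integrable torus_measure (\<lambda>x. convection u x $ i)"
  by (subst integrable_cong_AE[OF convection_measurable continuous_imp_measurable_torus[OF cont_conv] AE_convection])
    (intro integrable_torus_continuous continuous_intros)

lemma nonlin_conv: "nonlin u i = fourier_coeff (conv i)"
  unfolding nonlin_def fourier_coeff_eq
  using convection_integral[OF continuous_emode] by (simp add: fun_eq_iff scaleR_conv_of_real)

lemma conv_L2: "conv i \<in> L2_torus"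
  unfolding L2_torus_def
  using periodic_U periodic_V
  by (auto simp: periodic_def conv_def intro!: continuous_imp_measurable_torus integrable_torus_continuous continuous_intros)

text \<open>Convolution over the lattice. Its purpose is measurability in time: it expresses the
  nonlinearity by the modes alone, whereas \<open>convection\<close> involves weak derivatives
  chosen separately at every time.\<close>

lemma nonlin_formula:
  "nonlin u i m = (\<Sum>j\<in>UNIV. LINT k|lattice. deriv_coeff j (mode u i) k * mode u j (m - k))"
proof -
  have int: "integrable torus_measure (\<lambda>x. of_real (U j x * V j i x) * emode (- m) x)" for j
    by (intro integrable_torus_continuous continuous_intros)
  have c: "(LINT x|torus_measure. of_real (U j x * V j i x) * emode (- m) x)
     = of_real ((2 * pi) ^ 3) * (LINT k|lattice. deriv_coeff j (mode u i) k * mode u j (m - k))" for j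
  proof -
    have "(LINT x|torus_measure. of_real (U j x * V j i x) * emode (- m) x)
      = (LINT x|torus_measure. fourier_series (deriv_coeff j (mode u i)) x * (of_real (U j x) * emode (- m) x))"
      by (simp add: of_real_V[symmetric] mult_ac)
    also have "\<dots> = (LINT k|lattice. deriv_coeff j (mode u i) k * (LINT x|torus_measure. emode k x * (of_real (U j x) * emode (- m) x)))"
      by (rule torus_integral_fourier_series[OF int_deriv]) (intro integrable_torus_continuous continuous_intros)
    also have "\<dots> = (LINT k|lattice. deriv_coeff j (mode u i) k * (of_real ((2 * pi) ^ 3) * mode u j (m - k)))"
    proof (intro Bochner_Integration.integral_cong refl arg_cong2[where f="(*)"])
      fix k
      have "emode k x * (of_real (U j x) * emode (- m) x) = fourier_series (mode u j) x * emode (- (m - k)) x" for x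
      proof -
        have "emode (- (m - k)) x = emode k x * emode (- m) x" by (simp add: emode_add[symmetric])
        then show ?thesis by (simp only: of_real_U mult_ac)
      qed
      then show "(LINT x|torus_measure. emode k x * (of_real (U j x) * emode (- m) x)) = of_real ((2 * pi) ^ 3) * mode u j (m - k)"
        by (simp only: torus_integral_fourier_series_emode[OF int_mode])
    qed
    also have "\<dots> = of_real ((2 * pi) ^ 3) * (LINT k|lattice. deriv_coeff j (mode u i) k * mode u j (m - k))"
      unfolding integral_mult_right_zero[symmetric]
      by (rule Bochner_Integration.integral_cong[OF refl]) (simp only: mult.left_commute)
    finally show ?thesis .
  qed
  have "nonlin u i m = (\<Sum>j\<in>UNIV. LINT x|torus_measure. of_real (U j x * V j i x) * emode (- m) x) / of_real ((2 * pi) ^ 3)"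
    unfolding nonlin_conv fourier_coeff_eq conv_def using int
    by (simp add: sum_distrib_right)
  then show ?thesis by (simp only: c sum_distrib_left[symmetric]) simp
qed

text \<open>The Sobolev embedding of H^2 into bounded functions, through the sum of the moduli of
  the coefficients.\<close>

lemma U_bound: "(U i x)\<^sup>2 \<le> weight_const * energy 2 u"
proof -
  have "\<bar>U i x\<bar> \<le> (LINT m|lattice. cmod (mode u i m))"
    unfolding U_def using abs_Re_le_cmod norm_fourier_series_le by (rule order_trans)
  then have "(U i x)\<^sup>2 \<le> (LINT m|lattice. cmod (mode u i m))\<^sup>2"
    by (metis abs_ge_zero power2_abs power_mono)
  then show ?thesis using mode_l1_bound[of i] by linarith
qed

lemma int_mode_sq: "integrable lattice (\<lambda>m. weight m ^ s * mode_sq u m)" if "s \<le> 4"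
  by (rule integrable_energy_le[OF H4 that])

lemma U_sq: "(LINT x|torus_measure. (U i x)\<^sup>2) = (2 * pi) ^ 3 * (LINT m|lattice. (cmod (mode u i m))\<^sup>2)"
    "integrable lattice (\<lambda>m. (cmod (mode u i m))\<^sup>2)"
proof -
  have "(cmod (fourier_series (mode u i) x))\<^sup>2 = (U i x)\<^sup>2" for x
    unfolding of_real_U[symmetric] by simp
  then show "(LINT x|torus_measure. (U i x)\<^sup>2) = (2 * pi) ^ 3 * (LINT m|lattice. (cmod (mode u i m))\<^sup>2)"
    "integrable lattice (\<lambda>m. (cmod (mode u i m))\<^sup>2)"
    using parseval_fourier_series[OF int_mode, of i] by simp_all
qed

lemma V_sq: "(LINT x|torus_measure. (V j i x)\<^sup>2) = (2 * pi) ^ 3 * (LINT m|lattice. (of_int (m $ j))\<^sup>2 * (cmod (mode u i m))\<^sup>2)"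
    "integrable lattice (\<lambda>m. (of_int (m $ j))\<^sup>2 * (cmod (mode u i m))\<^sup>2)"
proof -
  have "(cmod (fourier_series (deriv_coeff j (mode u i)) x))\<^sup>2 = (V j i x)\<^sup>2" for x
    unfolding of_real_V[symmetric] by simp
  moreover have "(cmod (deriv_coeff j (mode u i) m))\<^sup>2 = (of_int (m $ j))\<^sup>2 * (cmod (mode u i m))\<^sup>2" for m
    by (simp add: deriv_coeff_def norm_mult power_mult_distrib)
  ultimately show "(LINT x|torus_measure. (V j i x)\<^sup>2) = (2 * pi) ^ 3 * (LINT m|lattice. (of_int (m $ j))\<^sup>2 * (cmod (mode u i m))\<^sup>2)"
    "integrable lattice (\<lambda>m. (of_int (m $ j))\<^sup>2 * (cmod (mode u i m))\<^sup>2)"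
    using parseval_fourier_series[OF int_deriv, of j i] by simp_all
qed

lemma sum_U_sq: "(\<Sum>i\<in>UNIV. LINT x|torus_measure. (U i x)\<^sup>2) = (2 * pi) ^ 3 * energy 0 u"
  unfolding U_sq(1) energy_def mode_sq_def by (simp add: U_sq(2) sum_distrib_left)

lemma sum_V_sq: "(\<Sum>i\<in>UNIV. \<Sum>j\<in>UNIV. LINT x|torus_measure. (V j i x)\<^sup>2) \<le> (2 * pi) ^ 3 * energy 2 u"
proof -
  have "(\<Sum>i\<in>UNIV. \<Sum>j\<in>UNIV. LINT x|torus_measure. (V j i x)\<^sup>2)
      = (2 * pi) ^ 3 * (LINT m|lattice. (\<Sum>i\<in>UNIV. \<Sum>j\<in>UNIV. (of_int (m $ j))\<^sup>2 * (cmod (mode u i m))\<^sup>2))"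
    unfolding V_sq(1) by (simp add: V_sq(2) sum_distrib_left)
  also have "\<dots> = (2 * pi) ^ 3 * (LINT m|lattice. (norm (frequency m))\<^sup>2 * mode_sq u m)"
    by (simp add: sum_distrib_right[symmetric] sum_frequency_sq mode_sq_def sum_distrib_left[symmetric])
  also have "(LINT m|lattice. (norm (frequency m))\<^sup>2 * mode_sq u m) \<le> energy 2 u"
    unfolding energy_def
  proof (rule integral_mono')
    show "integrable lattice (\<lambda>m. weight m ^ 2 * mode_sq u m)" by (rule int_mode_sq) simp
    fix m
    have "(norm (frequency m))\<^sup>2 \<le> weight m ^ 1" by simp
    also have "\<dots> \<le> weight m ^ 2" by (rule power_increasing) auto
    finally show "(norm (frequency m))\<^sup>2 * mode_sq u m \<le> weight m ^ 2 * mode_sq u m"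
      by (rule mult_right_mono) simp
  qed simp
  finally show ?thesis by simp
qed

text \<open>The velocity is bounded uniformly and the gradient in L^2, both by
  \<open>energy 2\<close>, so their product is bounded in L^2. The 3 counts the summands of the
  convection term, and Bessel passes to the coefficients.\<close>

lemma nonlin_sq:
  shows "integrable lattice (\<lambda>m. \<Sum>i\<in>UNIV. (cmod (nonlin u i m))\<^sup>2)"
    and "(LINT m|lattice. (\<Sum>i\<in>UNIV. (cmod (nonlin u i m))\<^sup>2)) \<le> 3 * weight_const * (energy 2 u)\<^sup>2"
proof -
  have i: "integrable lattice (\<lambda>m. (cmod (nonlin u i m))\<^sup>2)" for i
    unfolding nonlin_conv by (rule bessel(1)[OF conv_L2])
  then show "integrable lattice (\<lambda>m. \<Sum>i\<in>UNIV. (cmod (nonlin u i m))\<^sup>2)" by simp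
  have V2: "integrable torus_measure (\<lambda>x. (V j i x)\<^sup>2)" for j i
    by (intro integrable_torus_continuous continuous_intros)
  have "(LINT x|torus_measure. (conv i x)\<^sup>2) \<le> 3 * (weight_const * energy 2 u) * (\<Sum>j\<in>UNIV. LINT x|torus_measure. (V j i x)\<^sup>2)" for i
  proof -
    have "(conv i x)\<^sup>2 \<le> 3 * (weight_const * energy 2 u) * (\<Sum>j\<in>UNIV. (V j i x)\<^sup>2)" for x
    proof -
      have "(conv i x)\<^sup>2 \<le> (\<Sum>j\<in>UNIV. (U j x * V j i x)\<^sup>2) * real (card (UNIV :: 3 set))"
        unfolding conv_def by (rule sum_squared_le_sum_of_squares) 
      also have "\<dots> = 3 * (\<Sum>j\<in>UNIV. (U j x)\<^sup>2 * (V j i x)\<^sup>2)" by (simp add: power_mult_distrib)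
      also have "\<dots> \<le> 3 * (\<Sum>j\<in>UNIV. (weight_const * energy 2 u) * (V j i x)\<^sup>2)"
        by (intro mult_left_mono sum_mono mult_right_mono U_bound) auto
      finally show ?thesis by (simp add: sum_distrib_left mult.assoc)
    qed
    then have "(LINT x|torus_measure. (conv i x)\<^sup>2) \<le> (LINT x|torus_measure. 3 * (weight_const * energy 2 u) * (\<Sum>j\<in>UNIV. (V j i x)\<^sup>2))"
      by (intro integral_mono integrable_torus_continuous continuous_intros) auto
    then show ?thesis using V2 by simp
  qed
  then have "(2 * pi) ^ 3 * (LINT m|lattice. (cmod (nonlin u i m))\<^sup>2)
      \<le> 3 * (weight_const * energy 2 u) * (\<Sum>j\<in>UNIV. LINT x|torus_measure. (V j i x)\<^sup>2)" for i
    using bessel(2)[OF conv_L2, of i] unfolding nonlin_conv by (rule order_trans[rotated])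
  then have "(\<Sum>i\<in>UNIV. (2 * pi) ^ 3 * (LINT m|lattice. (cmod (nonlin u i m))\<^sup>2))
      \<le> (\<Sum>i\<in>UNIV. 3 * (weight_const * energy 2 u) * (\<Sum>j\<in>UNIV. LINT x|torus_measure. (V j i x)\<^sup>2))"
    by (rule sum_mono)
  also have "\<dots> = 3 * (weight_const * energy 2 u) * (\<Sum>i\<in>UNIV. \<Sum>j\<in>UNIV. LINT x|torus_measure. (V j i x)\<^sup>2)"
    by (simp only: sum_distrib_left)
  also have "\<dots> \<le> 3 * (weight_const * energy 2 u) * ((2 * pi) ^ 3 * energy 2 u)"
    by (intro mult_left_mono sum_V_sq) (simp add: weight_const_nonneg)
  also have "\<dots> = (2 * pi) ^ 3 * (3 * weight_const * (energy 2 u)\<^sup>2)"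
    by (simp add: power2_eq_square)
  finally have "(2 * pi) ^ 3 * (LINT m|lattice. (\<Sum>i\<in>UNIV. (cmod (nonlin u i m))\<^sup>2)) \<le> (2 * pi) ^ 3 * (3 * weight_const * (energy 2 u)\<^sup>2)"
    using i by (simp add: sum_distrib_left)
  then show "(LINT m|lattice. (\<Sum>i\<in>UNIV. (cmod (nonlin u i m))\<^sup>2)) \<le> 3 * weight_const * (energy 2 u)\<^sup>2"
    by (rule mult_left_le_imp_le) simp
qed

lemma torus_inner_convection_trig:
  "torus_inner (convection u) (trig_test m \<alpha> (axis i 1)) = (2 * pi) ^ 3 * Re (cis (- \<alpha>) * nonlin u i m)"
  using torus_integral_trig[OF convection_integrable[of i], of m \<alpha>]
  by (simp add: torus_inner_def trig_test_def inner_axis mult.commute nonlin_def)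

lemma grad_inner_trig:
  "grad_inner u (trig_test m \<alpha> (axis i 1)) = (norm (frequency m))\<^sup>2 * ((2 * pi) ^ 3 * Re (cis (- \<alpha>) * mode u i m))"
proof -
  define P :: real where "P = (2 * pi) ^ 3"
  have c: "(axis i 1 :: real^3) $ i' = (if i' = i then 1 else 0)" for i'
    by (simp add: axis_def)
  have 1: "(\<Sum>i'\<in>UNIV. \<Sum>j\<in>UNIV. weak_partial j (\<lambda>y. u y $ i') x * (partial j (trig_test m \<alpha> (axis i 1)) x $ i'))
    = (\<Sum>j\<in>UNIV. of_int (m $ j) * (weak_partial j (\<lambda>y. u y $ i) x * cos (frequency m \<bullet> x + (\<alpha> + pi / 2))))" for x
  proof -
    have "(\<Sum>j\<in>UNIV. weak_partial j (\<lambda>y. u y $ i') x * (partial j (trig_test m \<alpha> (axis i 1)) x $ i'))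
      = (if i' = i then (\<Sum>j\<in>UNIV. of_int (m $ j) * (weak_partial j (\<lambda>y. u y $ i) x * cos (frequency m \<bullet> x + (\<alpha> + pi / 2)))) else 0)" for i'
      by (simp add: partial_trig_test trig_test_def c mult_ac)
    then show ?thesis by simp
  qed
  have int: "integrable torus_measure (\<lambda>x. weak_partial j (\<lambda>y. u y $ i) x * cos (frequency m \<bullet> x + (\<alpha> + pi / 2)))" for j
    using integrable_torus_mult[OF L2_torus_integrable[OF weak_partial_component(1)[of j i]], of "\<lambda>x. cos (frequency m \<bullet> x + (\<alpha> + pi / 2))"]
    by (simp add: continuous_intros)
  have "grad_inner u (trig_test m \<alpha> (axis i 1))
     = (\<Sum>j\<in>UNIV. of_int (m $ j) * (LINT x|torus_measure. weak_partial j (\<lambda>y. u y $ i) x * cos (frequency m \<bullet> x + (\<alpha> + pi / 2))))"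
    unfolding grad_inner_def 1 using int by simp
  also have "\<dots> = (\<Sum>j\<in>UNIV. (of_int (m $ j))\<^sup>2 * (P * Re (cis (- \<alpha>) * mode u i m)))"
  proof (rule sum.cong[OF refl])
    fix j :: 3
    \<comment> \<open>The extra phase pi/2 of the differentiated test function cancels the factor i
      of the differentiated field.\<close>
    have "cis (- (\<alpha> + pi / 2)) * deriv_coeff j (mode u i) m = of_int (m $ j) * (cis (- \<alpha>) * mode u i m)"
    proof -
      have "cis (- (\<alpha> + pi / 2)) = cis (- \<alpha>) * cis (- (pi / 2))"
        by (simp only: cis_mult minus_add_distrib)
      moreover have "cis (- (pi / 2)) = - \<i>" by (simp add: complex_eq_iff)
      ultimately have "cis (- (\<alpha> + pi / 2)) = cis (- \<alpha>) * (- \<i>)" by (simp only:)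
      then have "cis (- (\<alpha> + pi / 2)) * deriv_coeff j (mode u i) m = (cis (- \<alpha>) * (- \<i>)) * deriv_coeff j (mode u i) m"
        by (rule arg_cong)
      also have "\<dots> = of_int (m $ j) * (cis (- \<alpha>) * mode u i m)"
      proof -
        have "(c * (- \<i>)) * (\<i> * k * z) = k * (c * z)" for c k z
          by (simp add: complex_eq_iff algebra_simps)
        then show ?thesis by (simp only: deriv_coeff_def)
      qed
      finally show ?thesis .
    qed
    then have "Re (cis (- (\<alpha> + pi / 2)) * deriv_coeff j (mode u i) m) = of_int (m $ j) * Re (cis (- \<alpha>) * mode u i m)"
      by (simp only:) simp
    then have "(LINT x|torus_measure. weak_partial j (\<lambda>y. u y $ i) x * cos (frequency m \<bullet> x + (\<alpha> + pi / 2)))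
        = P * (of_int (m $ j) * Re (cis (- \<alpha>) * mode u i m))"
      unfolding torus_integral_trig[OF L2_torus_integrable[OF weak_partial_component(1)], folded P_def] weak_partial_component(2) by (simp only:)
    then show "of_int (m $ j) * (LINT x|torus_measure. weak_partial j (\<lambda>y. u y $ i) x * cos (frequency m \<bullet> x + (\<alpha> + pi / 2)))
       = (of_int (m $ j))\<^sup>2 * (P * Re (cis (- \<alpha>) * mode u i m))"
      by (simp only: power2_eq_square mult_ac)
  qed
  finally show ?thesis by (simp only: sum_distrib_right[symmetric] sum_frequency_sq P_def)
qed

lemma laplacian_inner_trig:
  "torus_inner (weak_laplacian u) (laplacian (trig_test m \<alpha> (axis i 1)))
     = (norm (frequency m)) ^ 4 * ((2 * pi) ^ 3 * Re (cis (- \<alpha>) * mode u i m))"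
proof -
  define P :: real where "P = (2 * pi) ^ 3"
  let ?w = "\<lambda>j. weak_partial j (weak_partial j (\<lambda>y. u y $ i))"
  have 1: "weak_laplacian u x \<bullet> laplacian (trig_test m \<alpha> (axis i 1)) x
     = - (norm (frequency m))\<^sup>2 * (\<Sum>j\<in>UNIV. ?w j x * cos (frequency m \<bullet> x + \<alpha>))" for x
    by (simp add: laplacian_trig_test trig_test_def inner_axis weak_laplacian_def sum_distrib_right sum_distrib_left mult_ac sum_negf)
  have int: "integrable torus_measure (\<lambda>x. ?w j x * cos (frequency m \<bullet> x + \<alpha>))" for j
    using integrable_torus_mult[OF L2_torus_integrable[OF weak_partial_component2(1)[of j j i]], of "\<lambda>x. cos (frequency m \<bullet> x + \<alpha>)"]
    by (simp add: continuous_intros)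
  have 2: "(LINT x|torus_measure. ?w j x * cos (frequency m \<bullet> x + \<alpha>)) = - ((of_int (m $ j))\<^sup>2 * (P * Re (cis (- \<alpha>) * mode u i m)))" for j
  proof -
    have "deriv_coeff j (deriv_coeff j (mode u i)) m = of_real (- ((of_int (m $ j))\<^sup>2)) * mode u i m"
      by (simp add: deriv_coeff_def power2_eq_square complex_eq_iff)
    moreover have "Re (cis (- \<alpha>) * (of_real r * z)) = r * Re (cis (- \<alpha>) * z)" for r z
      by (simp add: algebra_simps)
    ultimately have "Re (cis (- \<alpha>) * deriv_coeff j (deriv_coeff j (mode u i)) m) = - ((of_int (m $ j))\<^sup>2) * Re (cis (- \<alpha>) * mode u i m)"
      by (simp only:)
    then show ?thesis
      unfolding torus_integral_trig[OF L2_torus_integrable[OF weak_partial_component2(1)], folded P_def] weak_partial_component2(2) by simp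
  qed
  have "torus_inner (weak_laplacian u) (laplacian (trig_test m \<alpha> (axis i 1)))
     = - (norm (frequency m))\<^sup>2 * (\<Sum>j\<in>UNIV. LINT x|torus_measure. ?w j x * cos (frequency m \<bullet> x + \<alpha>))"
    unfolding torus_inner_def 1 using int by simp
  also have "\<dots> = (norm (frequency m))\<^sup>2 * ((norm (frequency m))\<^sup>2 * (P * Re (cis (- \<alpha>) * mode u i m)))"
    unfolding 2 by (simp only: sum_negf sum_distrib_right[symmetric] sum_frequency_sq mult_minus_left mult_minus_right minus_minus)
  also have "\<dots> = (norm (frequency m)) ^ 4 * (P * Re (cis (- \<alpha>) * mode u i m))"
    by (simp only: mult.assoc[symmetric] power2_eq_square power4_eq_xxxx)
  finally show ?thesis by (simp only: P_def)
qed

text \<open>Tested with a trigonometric field, the weak formulation becomes one real component of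
  the differential equation for a single mode, the phase selecting the component.\<close>

lemma rhs_trig:
  fixes lam :: real
  defines "\<psi> \<equiv> \<lambda>m \<alpha> i. trig_test m \<alpha> (axis i (1::real))"
  shows "lam * grad_inner u (\<psi> m \<alpha> i) - torus_inner (convection u) (\<psi> m \<alpha> i)
      - torus_inner (weak_laplacian u) (laplacian (\<psi> m \<alpha> i))
    = (2 * pi) ^ 3 * Re (cis (- \<alpha>) * mode_rhs lam u i m)"
proof -
  have "Re (cis (- \<alpha>) * mode_rhs lam u i m) = growth lam m * Re (cis (- \<alpha>) * mode u i m) - Re (cis (- \<alpha>) * nonlin u i m)"
    by (simp add: mode_rhs_def algebra_simps)
  then show ?thesis
    unfolding \<psi>_def grad_inner_trig torus_inner_convection_trig laplacian_inner_trig growth_def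
    by (simp only: right_diff_distrib left_diff_distrib mult_ac)
qed

end

lemma weight_nonzero [simp]: "weight m \<noteq> 0"
  using weight_ge1(2)[of m] by linarith

section \<open>Energy inequalities\<close>

lemma abs_growth_le: "\<bar>growth lam m\<bar> \<le> (\<bar>lam\<bar> + 1) * weight m ^ 2"
proof -
  let ?n = "(norm (frequency m))\<^sup>2"
  have n: "?n \<ge> 0" by simp
  have "(norm (frequency m)) ^ 4 = ?n\<^sup>2" by simp
  then have "\<bar>growth lam m\<bar> \<le> \<bar>lam\<bar> * ?n + ?n\<^sup>2"
    unfolding growth_def by (metis abs_mult abs_of_nonneg abs_triangle_ineq4 n zero_le_power2)
  also have "\<dots> \<le> \<bar>lam\<bar> * weight m ^ 2 + 1 * weight m ^ 2"
  proof (rule add_mono)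
    have "?n \<le> weight m ^ 1" by simp
    also have "\<dots> \<le> weight m ^ 2" by (rule power_increasing) auto
    finally show "\<bar>lam\<bar> * ?n \<le> \<bar>lam\<bar> * weight m ^ 2" by (rule mult_left_mono) simp
    show "?n\<^sup>2 \<le> 1 * weight m ^ 2" unfolding mult_1 by (rule power_mono) auto
  qed
  finally show ?thesis by (simp add: distrib_right)
qed

text \<open>With n the squared norm of the frequency, the two sides of the next inequality differ by
  (n - (1 + lam))^2, which dictates this constant. The subtracted weight^2 is the dissipation, which
  raises the order of an energy by two.\<close>

definition growth_const :: "real \<Rightarrow> real" where
  "growth_const lam = 1 + (1 + lam)\<^sup>2"

lemma growth_le: "2 * growth lam m \<le> growth_const lam - weight m ^ 2"
proof -
  let ?n = "(norm (frequency m))\<^sup>2"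
  have "(norm (frequency m)) ^ 4 = ?n * ?n" by (simp add: power2_eq_square power4_eq_xxxx mult.assoc)
  moreover have "0 \<le> (?n - (1 + lam))\<^sup>2" by simp
  ultimately show ?thesis
    by (simp add: growth_def growth_const_def power2_eq_square algebra_simps)
qed

lemma growth_const_pos: "growth_const lam > 0"
  by (simp add: growth_const_def add_pos_nonneg)

lemma AM_GM_weighted: "2 * \<bar>a * b\<bar> \<le> e * a\<^sup>2 + b\<^sup>2 / e" if "e > 0" for a b e :: real
proof -
  have "0 \<le> (e * \<bar>a\<bar> - \<bar>b\<bar>)\<^sup>2 / e" using that by simp
  also have "\<dots> = e * a\<^sup>2 - 2 * \<bar>a * b\<bar> + b\<^sup>2 / e"
    using that by (simp add: power2_eq_square field_simps abs_mult)
  finally show ?thesis by simp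
qed

lemma Re_cnj_mult_le: "\<bar>2 * Re (cnj z * w)\<bar> \<le> e * (cmod z)\<^sup>2 + (cmod w)\<^sup>2 / e" if "e > 0"
proof -
  have "\<bar>Re (cnj z * w)\<bar> \<le> cmod (cnj z * w)" by (rule abs_Re_le_cmod)
  also have "\<dots> = \<bar>cmod z * cmod w\<bar>" by (simp add: norm_mult)
  finally show ?thesis using AM_GM_weighted[OF that, of "cmod z" "cmod w"] by simp
qed

lemma flux_eq:
  "flux lam s u m = weight m ^ s * (2 * growth lam m) * mode_sq u m
     - weight m ^ s * (\<Sum>i\<in>UNIV. 2 * Re (cnj (mode u i m) * nonlin u i m))"
proof -
  have "2 * Re (cnj (mode u i m) * mode_rhs lam u i m)
      = (2 * growth lam m) * (cmod (mode u i m))\<^sup>2 - 2 * Re (cnj (mode u i m) * nonlin u i m)" for i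
    unfolding mode_rhs_def cmod_power2 by (simp add: power2_eq_square algebra_simps)
  then show ?thesis
    by (simp add: flux_def mode_sq_def sum_subtractf sum_distrib_left right_diff_distrib mult.assoc)
qed

text \<open>The bookkeeping of the nine trilinear integrals: \<open>q\<close> stands for the L^2
  terms and \<open>r\<close> for the gradient terms. The factor 2 is due to \<open>r33\<close>,
  which enters through both \<open>t31\<close> and \<open>t32\<close>; the coefficient 5 is
  generous, the exact counts being 3, 3 and 4. As the \<open>t\<close> are arbitrary reals, the
  lemma serves for both signs.\<close>

lemma trilinear_sum_bound:
  fixes q1 q2 q3 :: real
  assumes "t11 \<le> q1 + r11" "t12 \<le> q2 + r12" "t13 \<le> q3 + r13"
    "t21 \<le> q1 + r21" "t22 \<le> q2 + r22" "t23 \<le> q3 + r23"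
    "t31 \<le> q3 + r31 + q1 + r33" "t32 \<le> q3 + r32 + q2 + r33"
    "0 \<le> q1" "0 \<le> q2" "0 \<le> q3" "0 \<le> r11" "0 \<le> r12" "0 \<le> r13"
    "0 \<le> r21" "0 \<le> r22" "0 \<le> r23" "0 \<le> r31" "0 \<le> r32" "0 \<le> r33" "t33 = 0"
  shows "t11 + t21 + t31 + (t12 + t22 + t32) + (t13 + t23 + t33)
    \<le> 5 * q1 + 5 * q2 + 5 * q3 + 2 * (r11 + r21 + r31 + (r12 + r22 + r32) + (r13 + r23 + r33))"
proof -
  have "t11 + t21 + t31 \<le> 3 * q1 + q3 + (r11 + r21 + r31) + r33" using assms by simp
  moreover have "t12 + t22 + t32 \<le> 3 * q2 + q3 + (r12 + r22 + r32) + r33" using assms by simp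
  moreover have "t13 + t23 + t33 \<le> 2 * q3 + (r13 + r23)" using assms by simp
  moreover have "0 \<le> r11 + r21 + r31" "0 \<le> r12 + r22 + r32" "0 \<le> r13 + r23" using assms by simp_all
  ultimately show ?thesis using assms(9-11,20) by simp
qed

context h4_state
begin

text \<open>Young's inequality with parameter weight^s puts weight^(2 s) on the modes, and H^4
  affords this for s <= 2. The bound is for the absolute value because it has to justify exchanging
  the sum with the time integral.\<close>

lemma flux_bound:
  assumes "s \<le> 2"
  shows "\<bar>flux lam s u m\<bar> \<le> (2 * \<bar>lam\<bar> + 3) * (weight m ^ 4 * mode_sq u m) + (\<Sum>i\<in>UNIV. (cmod (nonlin u i m))\<^sup>2)"
proof -
  let ?w = "weight m"
  have w: "?w ^ s \<le> ?w ^ 2" "(?w ^ s)\<^sup>2 \<le> ?w ^ 4"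
    using assms power_increasing[of s 2 ?w] power_increasing[of "s * 2" 4 ?w]
    by (auto simp: power_mult[symmetric])
  have 1: "\<bar>?w ^ s * (2 * growth lam m) * mode_sq u m\<bar> \<le> (2 * \<bar>lam\<bar> + 2) * (?w ^ 4 * mode_sq u m)"
  proof -
    have "\<bar>?w ^ s * (2 * growth lam m)\<bar> \<le> ?w ^ 2 * (2 * ((\<bar>lam\<bar> + 1) * ?w ^ 2))"
      unfolding abs_mult using w abs_growth_le[of lam m] by (intro mult_mono) auto
    also have "\<dots> = (2 * \<bar>lam\<bar> + 2) * ?w ^ 4" by (simp add: power2_eq_square power4_eq_xxxx algebra_simps)
    finally have "\<bar>?w ^ s * (2 * growth lam m)\<bar> * mode_sq u m \<le> (2 * \<bar>lam\<bar> + 2) * ?w ^ 4 * mode_sq u m"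
      by (rule mult_right_mono) simp
    then show ?thesis by (simp add: abs_mult mult.assoc)
  qed
  have "\<bar>?w ^ s * (2 * Re (cnj (mode u i m) * nonlin u i m))\<bar> \<le> ?w ^ 4 * (cmod (mode u i m))\<^sup>2 + (cmod (nonlin u i m))\<^sup>2" for i
  proof -
    have ws: "?w ^ s > 0" by simp
    have "\<bar>?w ^ s * (2 * Re (cnj (mode u i m) * nonlin u i m))\<bar> = ?w ^ s * \<bar>2 * Re (cnj (mode u i m) * nonlin u i m)\<bar>"
      by (simp add: abs_mult)
    also have "\<dots> \<le> ?w ^ s * (?w ^ s * (cmod (mode u i m))\<^sup>2 + (cmod (nonlin u i m))\<^sup>2 / ?w ^ s)"
      by (intro mult_left_mono Re_cnj_mult_le ws) simp
    also have "\<dots> = (?w ^ s)\<^sup>2 * (cmod (mode u i m))\<^sup>2 + (cmod (nonlin u i m))\<^sup>2"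
    proof -
      have "p * (p * a + b / p) = p\<^sup>2 * a + b" if "p > 0" for p a b :: real
        using that by (simp add: field_simps power2_eq_square)
      from this[OF ws] show ?thesis .
    qed
    also have "\<dots> \<le> ?w ^ 4 * (cmod (mode u i m))\<^sup>2 + (cmod (nonlin u i m))\<^sup>2"
      using w by (intro add_mono mult_right_mono) auto
    finally show ?thesis .
  qed
  then have "(\<Sum>i\<in>UNIV. \<bar>?w ^ s * (2 * Re (cnj (mode u i m) * nonlin u i m))\<bar>)
      \<le> (\<Sum>i\<in>UNIV. ?w ^ 4 * (cmod (mode u i m))\<^sup>2 + (cmod (nonlin u i m))\<^sup>2)"
    by (rule sum_mono)
  also have "\<dots> = ?w ^ 4 * mode_sq u m + (\<Sum>i\<in>UNIV. (cmod (nonlin u i m))\<^sup>2)"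
    by (simp add: sum.distrib mode_sq_def sum_distrib_left)
  finally have 2: "\<bar>?w ^ s * (\<Sum>i\<in>UNIV. 2 * Re (cnj (mode u i m) * nonlin u i m))\<bar>
      \<le> ?w ^ 4 * mode_sq u m + (\<Sum>i\<in>UNIV. (cmod (nonlin u i m))\<^sup>2)"
    unfolding sum_distrib_left by (rule order_trans[OF sum_abs])
  show ?thesis
    unfolding flux_eq using 1 2 by (simp add: algebra_simps)
qed

lemma flux_integrable: "s \<le> 2 \<Longrightarrow> integrable lattice (flux lam s u)"
proof (rule Bochner_Integration.integrable_bound[where
        f="\<lambda>m. (2 * \<bar>lam\<bar> + 3) * (weight m ^ 4 * mode_sq u m) + (\<Sum>i\<in>UNIV. (cmod (nonlin u i m))\<^sup>2)"])
  assume s: "s \<le> 2"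
  show "AE m in lattice. norm (flux lam s u m)
      \<le> norm ((2 * \<bar>lam\<bar> + 3) * (weight m ^ 4 * mode_sq u m) + (\<Sum>i\<in>UNIV. (cmod (nonlin u i m))\<^sup>2))"
    unfolding real_norm_def by (intro AE_I2 order_trans[OF flux_bound[OF s] abs_ge_self])
qed (use int_mode_sq[of 4] nonlin_sq(1) in auto)

lemma flux_l1_bound:
  assumes "s \<le> 2"
  shows "(LINT m|lattice. \<bar>flux lam s u m\<bar>) \<le> (2 * \<bar>lam\<bar> + 3) * energy 4 u + 3 * weight_const * (energy 2 u)\<^sup>2"
proof -
  have "(LINT m|lattice. \<bar>flux lam s u m\<bar>)
     \<le> (LINT m|lattice. (2 * \<bar>lam\<bar> + 3) * (weight m ^ 4 * mode_sq u m) + (\<Sum>i\<in>UNIV. (cmod (nonlin u i m))\<^sup>2))"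
    by (intro integral_mono Bochner_Integration.integrable_add integrable_mult_right nonlin_sq(1) int_mode_sq flux_bound[OF assms]
        integrable_abs flux_integrable assms) simp
  also have "\<dots> = (2 * \<bar>lam\<bar> + 3) * energy 4 u + (LINT m|lattice. (\<Sum>i\<in>UNIV. (cmod (nonlin u i m))\<^sup>2))"
    unfolding energy_def using nonlin_sq(1) int_mode_sq[of 4] by simp
  finally show ?thesis using nonlin_sq(2) by simp
qed

text \<open>Half of the dissipation pays for the modes in the cross term. The nonlinearity then
  carries the factor 2, so that the 3 of \<open>nonlin_sq\<close> becomes 6. The quadratic term in
  \<open>energy 2\<close> is written as a kernel times \<open>energy 2\<close>, ready for
  Gronwall.\<close>

lemma flux2_le:
  "(LINT m|lattice. flux lam 2 u m) + energy 4 u / 2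
     \<le> (growth_const lam + 6 * weight_const) * (1 + energy 2 u) * energy 2 u"
proof -
  let ?N = "\<lambda>m. \<Sum>i\<in>UNIV. (cmod (nonlin u i m))\<^sup>2"
  have pw: "flux lam 2 u m \<le> growth_const lam * (weight m ^ 2 * mode_sq u m) - (1/2) * (weight m ^ 4 * mode_sq u m) + 2 * ?N m" for m
  proof -
    let ?w = "weight m"
    have 1: "?w ^ 2 * (2 * growth lam m) * mode_sq u m \<le> growth_const lam * (?w ^ 2 * mode_sq u m) - ?w ^ 4 * mode_sq u m"
    proof -
      have "?w ^ 2 * (2 * growth lam m) * mode_sq u m \<le> ?w ^ 2 * (growth_const lam - ?w ^ 2) * mode_sq u m"
        by (intro mult_right_mono mult_left_mono growth_le) auto
      also have "\<dots> = growth_const lam * (?w ^ 2 * mode_sq u m) - ?w ^ 4 * mode_sq u m"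
        by (simp add: power2_eq_square power4_eq_xxxx algebra_simps)
      finally show ?thesis .
    qed
    have "\<bar>?w ^ 2 * (2 * Re (cnj (mode u i m) * nonlin u i m))\<bar> \<le> (1/2) * (?w ^ 4 * (cmod (mode u i m))\<^sup>2) + 2 * (cmod (nonlin u i m))\<^sup>2" for i
    proof -
      \<comment> \<open>Parameter weight^2 / 2 in Young's inequality: the modes receive one half of
        weight^4, the nonlinearity a factor 2.\<close>
      have ws: "?w ^ 2 / 2 > 0" by (simp del: power2_eq_square)
      have "\<bar>?w ^ 2 * (2 * Re (cnj (mode u i m) * nonlin u i m))\<bar> = ?w ^ 2 * \<bar>2 * Re (cnj (mode u i m) * nonlin u i m)\<bar>"
        by (simp add: abs_mult)
      also have "\<dots> \<le> ?w ^ 2 * (?w ^ 2 / 2 * (cmod (mode u i m))\<^sup>2 + (cmod (nonlin u i m))\<^sup>2 / (?w ^ 2 / 2))"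
        by (intro mult_left_mono Re_cnj_mult_le ws) simp
      also have "\<dots> = (1/2) * (?w ^ 4 * (cmod (mode u i m))\<^sup>2) + 2 * (cmod (nonlin u i m))\<^sup>2"
      proof -
        have w4: "?w ^ 4 = ?w ^ 2 * ?w ^ 2" by (simp add: power_add[symmetric])
        have "p * (p / 2 * a + b / (p / 2)) = (1/2) * ((p * p) * a) + 2 * b" if "p / 2 > 0" for p a b :: real
          using that by (simp add: field_simps)
        note this[OF ws]
        then have "?w ^ 2 * (?w ^ 2 / 2 * (cmod (mode u i m))\<^sup>2 + (cmod (nonlin u i m))\<^sup>2 / (?w ^ 2 / 2))
           = (1/2) * ((?w ^ 2 * ?w ^ 2) * (cmod (mode u i m))\<^sup>2) + 2 * (cmod (nonlin u i m))\<^sup>2" .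
        then show ?thesis unfolding w4 .
      qed
      finally show ?thesis .
    qed
    then have "(\<Sum>i\<in>UNIV. \<bar>?w ^ 2 * (2 * Re (cnj (mode u i m) * nonlin u i m))\<bar>)
        \<le> (\<Sum>i\<in>UNIV. (1/2) * (?w ^ 4 * (cmod (mode u i m))\<^sup>2) + 2 * (cmod (nonlin u i m))\<^sup>2)"
      by (rule sum_mono)
    also have "\<dots> = (1/2) * (?w ^ 4 * mode_sq u m) + 2 * ?N m"
      by (simp add: sum.distrib mode_sq_def sum_distrib_left)
    finally have 2: "\<bar>?w ^ 2 * (\<Sum>i\<in>UNIV. 2 * Re (cnj (mode u i m) * nonlin u i m))\<bar> \<le> (1/2) * (?w ^ 4 * mode_sq u m) + 2 * ?N m"
      unfolding sum_distrib_left[of "?w ^ 2" "\<lambda>i. 2 * Re (cnj (mode u i m) * nonlin u i m)"]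
      by (rule order_trans[OF sum_abs])
    show ?thesis unfolding flux_eq using 1 2 by simp
  qed
  note i2 = int_mode_sq[of 2, simplified] and i4 = int_mode_sq[of 4, simplified]
  have "(LINT m|lattice. flux lam 2 u m)
     \<le> (LINT m|lattice. growth_const lam * (weight m ^ 2 * mode_sq u m) - (1/2) * (weight m ^ 4 * mode_sq u m) + 2 * ?N m)"
    by (intro integral_mono pw Bochner_Integration.integrable_add Bochner_Integration.integrable_diff
        integrable_mult_right nonlin_sq(1) int_mode_sq flux_integrable) auto
  also have "\<dots> = growth_const lam * energy 2 u - (1/2) * energy 4 u + 2 * (LINT m|lattice. ?N m)"
    unfolding energy_def using nonlin_sq(1) i2 i4 by simp
  also have "\<dots> \<le> growth_const lam * energy 2 u - (1/2) * energy 4 u + 2 * (3 * weight_const * (energy 2 u)\<^sup>2)"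
    using nonlin_sq(2) by simp
  finally have "(LINT m|lattice. flux lam 2 u m) + energy 4 u / 2 \<le> growth_const lam * energy 2 u + 6 * weight_const * (energy 2 u)\<^sup>2"
    by simp
  also have "\<dots> \<le> (growth_const lam + 6 * weight_const) * (1 + energy 2 u) * energy 2 u"
  proof -
    have "0 \<le> growth_const lam * (energy 2 u * energy 2 u)" "0 \<le> weight_const * energy 2 u"
      using growth_const_pos[of lam] weight_const_nonneg by (auto intro!: mult_nonneg_nonneg)
    then show ?thesis by (simp add: power2_eq_square algebra_simps)
  qed
  finally show ?thesis .
qed

section \<open>The trilinear form and the L^2 balance\<close>

lemma integrable_torus_continuous_real [simp]: "continuous_on UNIV f \<Longrightarrow> integrable torus_measure f"
  for f :: "real^3 \<Rightarrow> real"
  by (rule integrable_torus_continuous)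

lemma integral_by_parts_modes: "(LINT x|torus_measure. V j i x * U k x) = - (LINT x|torus_measure. U i x * V j k x)"
proof -
  have "(LINT x|torus_measure. U i x * V j k x + V j i x * U k x) = 0"
  proof (rule torus_integral_derivative_zero[where f="\<lambda>x. U i x * U k x"])
    show "periodic (\<lambda>x. U i x * U k x)" using periodic_U by (simp add: periodic_def)
    show "((\<lambda>s. U i (x + s *\<^sub>R axis j 1) * U k (x + s *\<^sub>R axis j 1)) has_vector_derivative
         U i x * V j k x + V j i x * U k x) (at 0)" for x
      using has_vector_derivative_mult[OF deriv_U[where i=i and x=x and j=j] deriv_U[where i=k and x=x and j=j]] by simp
  qed (intro continuous_intros)+
  then show ?thesis by (simp add: continuous_intros)
qed

lemma int_V_zero: "(LINT x|torus_measure. V j i x) = 0"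
  by (rule torus_integral_derivative_zero[where f="U i" and j=j]) (intro continuous_intros periodic_U deriv_U)+

text \<open>The integrand is one third of the derivative of the cube of \<open>U i\<close>.\<close>

lemma int_UUV_zero: "(LINT x|torus_measure. U i x * V j i x * U i x) = 0"
proof -
  have "(LINT x|torus_measure. (U i x * U i x) * V j i x + (U i x * V j i x + V j i x * U i x) * U i x) = 0"
  proof (rule torus_integral_derivative_zero[where f="\<lambda>x. (U i x * U i x) * U i x"])
    show "periodic (\<lambda>x. (U i x * U i x) * U i x)" using periodic_U by (simp add: periodic_def)
    note D = deriv_U[where i=i and j=j]
    show "((\<lambda>s. (U i (x + s *\<^sub>R axis j 1) * U i (x + s *\<^sub>R axis j 1)) * U i (x + s *\<^sub>R axis j 1)) has_vector_derivative
         (U i x * U i x) * V j i x + (U i x * V j i x + V j i x * U i x) * U i x) (at 0)" for x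
      using has_vector_derivative_mult[OF has_vector_derivative_mult[OF D D] D, of x x x] by simp
  qed (intro continuous_intros)+
  also have "(\<lambda>x. (U i x * U i x) * V j i x + (U i x * V j i x + V j i x * U i x) * U i x)
     = (\<lambda>x. 3 * (U i x * V j i x * U i x))"
    by (simp add: fun_eq_iff algebra_simps)
  finally show ?thesis by simp
qed

text \<open>AM-GM with parameter 4. The resulting 1/8 on the gradient is doubled by
  \<open>trilinear_sum_bound\<close> and again by the 2 in d/dt |z|^2, so exactly half of the
  dissipation survives.\<close>

lemma trilinear_bound:
  assumes p: "AE x in torus_measure. \<bar>p x\<bar> \<le> A" and [continuous_intros]: "continuous_on UNIV p" "continuous_on UNIV q" "continuous_on UNIV r"
  shows "\<bar>LINT x|torus_measure. p x * q x * r x\<bar>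
      \<le> 2 * A\<^sup>2 * (LINT x|torus_measure. (q x)\<^sup>2) + (1/8) * (LINT x|torus_measure. (r x :: real)\<^sup>2)"
proof -
  have "\<bar>LINT x|torus_measure. p x * q x * r x\<bar> \<le> (LINT x|torus_measure. 2 * A\<^sup>2 * (q x)\<^sup>2 + (1/8) * (r x)\<^sup>2)"
  proof (rule integral_abs_bound_AE)
    show "AE x in torus_measure. \<bar>p x * q x * r x\<bar> \<le> 2 * A\<^sup>2 * (q x)\<^sup>2 + (1/8) * (r x)\<^sup>2"
      using p
    proof eventually_elim
      case (elim x)
      have "\<bar>p x * q x * r x\<bar> \<le> A * \<bar>q x * r x\<bar>"
        using elim by (simp add: abs_mult mult.assoc mult_right_mono)
      also have "\<dots> \<le> \<bar>(A * q x) * r x\<bar>"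
        using elim by (simp add: abs_mult mult.assoc)
      also have "\<dots> \<le> 2 * (A * q x)\<^sup>2 + (1/8) * (r x)\<^sup>2"
        using AM_GM_weighted[of 4 "A * q x" "r x"] by simp
      finally show ?case by (simp add: power_mult_distrib mult.assoc)
    qed
  qed (intro integrable_torus_continuous continuous_imp_measurable_torus continuous_intros)+
  then show ?thesis by (simp add: continuous_intros)
qed

text \<open>Only fluctuations of the components 1 and 2 are bounded, so component 3 must never be
  estimated pointwise. In each product a factor with index 1 or 2 takes the role of the bounded one,
  and its mean, for which no bound by \<open>A\<close> is given, has to be removed.\<close>

lemma flux0_le:
  assumes A: "\<And>i. i \<in> {1, 2} \<Longrightarrow> AE x in torus_measure. \<bar>U i x - Re (mode u i 0)\<bar> \<le> A"
  shows "(LINT m|lattice. flux lam 0 u m) + energy 2 u / 2 \<le> (growth_const lam + 20 * A\<^sup>2) * energy 0 u"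
proof -
  define \<mu> where "\<mu> i = Re (mode u i 0)" for i
  define P :: real where "P = (2 * pi) ^ 3"
  have P: "P > 0" by (simp add: P_def)
  let ?T = "\<lambda>j i. LINT x|torus_measure. U j x * V j i x * U i x"
  let ?Q = "\<lambda>i. LINT x|torus_measure. (U i x)\<^sup>2"
  let ?R = "\<lambda>j i. LINT x|torus_measure. (V j i x)\<^sup>2"
  have A': "AE x in torus_measure. \<bar>U i x - \<mu> i\<bar> \<le> A" if "i = 1 \<or> i = 2" for i
    using A[of i] that by (auto simp: \<mu>_def)
  have cA [continuous_intros]: "continuous_on UNIV (\<lambda>x. U i x - \<mu> i)" for i by (intro continuous_intros)
  \<comment> \<open>The mean of \<open>U j\<close> multiplies the integral of
    \<open>V j i x * U i x\<close>, half of a total derivative, and so drops out.\<close>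
  have T1: "\<bar>?T j i\<bar> \<le> 2 * A\<^sup>2 * ?Q i + (1/8) * ?R j i" if j: "j = 1 \<or> j = 2" for i j
  proof -
    have z: "(LINT x|torus_measure. V j i x * U i x) = 0"
      using integral_by_parts_modes[of j i i] by (simp add: mult.commute)
    have "?T j i = (LINT x|torus_measure. (U j x - \<mu> j) * U i x * V j i x + \<mu> j * (V j i x * U i x))"
      by (intro Bochner_Integration.integral_cong) (auto simp: algebra_simps)
    also have "\<dots> = (LINT x|torus_measure. (U j x - \<mu> j) * U i x * V j i x)"
      using z by (simp add: continuous_intros)
    finally show ?thesis
      using trilinear_bound[OF A'[OF j] cA cont_U cont_V, of i j i] by simp
  qed
  \<comment> \<open>The zero mode is one term of the Parseval sum. This lets the constant function
    \<open>\<mu> i\<close> act as an L^2 factor in the next estimate.\<close>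
  have mu2: "\<mu> i ^ 2 * P \<le> ?Q i" for i
  proof -
    have "(\<mu> i)\<^sup>2 \<le> (cmod (mode u i 0))\<^sup>2"
      unfolding \<mu>_def using abs_Re_le_cmod by (metis abs_ge_zero power2_abs power_mono)
    also have "\<dots> \<le> (LINT m|lattice. (cmod (mode u i m))\<^sup>2)"
      by (rule le_integral_count_space[OF U_sq(2)]) simp
    finally have "(\<mu> i)\<^sup>2 * P \<le> (LINT m|lattice. (cmod (mode u i m))\<^sup>2) * P"
      using P by (intro mult_right_mono) auto
    then show ?thesis unfolding U_sq(1) P_def[symmetric] by (simp add: mult.commute)
  qed
  \<comment> \<open>Here \<open>U i\<close> is the bounded factor. Its mean leaves a bilinear
    integral, which is integrated by parts onto \<open>V 3 3\<close>; since \<open>V 3 3\<close> has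
    integral zero, the mean may be subtracted once more and a fluctuation reappears.\<close>
  have T2: "\<bar>?T 3 i\<bar> \<le> 2 * A\<^sup>2 * ?Q 3 + (1/8) * ?R 3 i + 2 * A\<^sup>2 * ?Q i + (1/8) * ?R 3 3" if i: "i = 1 \<or> i = 2" for i
  proof -
    have e1: "?T 3 i = (LINT x|torus_measure. (U i x - \<mu> i) * U 3 x * V 3 i x) + \<mu> i * (LINT x|torus_measure. U 3 x * V 3 i x)"
    proof -
      have "?T 3 i = (LINT x|torus_measure. (U i x - \<mu> i) * U 3 x * V 3 i x + \<mu> i * (U 3 x * V 3 i x))"
        by (intro Bochner_Integration.integral_cong) (auto simp: algebra_simps)
      then show ?thesis by (simp add: continuous_intros)
    qed
    have e2: "\<mu> i * (LINT x|torus_measure. U 3 x * V 3 i x) = - (LINT x|torus_measure. (U i x - \<mu> i) * \<mu> i * V 3 3 x)"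
    proof -
      have "(LINT x|torus_measure. (U i x - \<mu> i) * \<mu> i * V 3 3 x)
         = (LINT x|torus_measure. \<mu> i * (V 3 3 x * U i x) - (\<mu> i * \<mu> i) * V 3 3 x)"
        by (intro Bochner_Integration.integral_cong) (auto simp: algebra_simps)
      also have "\<dots> = \<mu> i * (LINT x|torus_measure. V 3 3 x * U i x)"
        using int_V_zero[of 3 3] by (simp add: continuous_intros)
      finally show ?thesis using integral_by_parts_modes[of 3 3 i] by simp
    qed
    have b1: "\<bar>LINT x|torus_measure. (U i x - \<mu> i) * U 3 x * V 3 i x\<bar> \<le> 2 * A\<^sup>2 * ?Q 3 + (1/8) * ?R 3 i"
      by (rule trilinear_bound[OF A'[OF i] cA cont_U cont_V])
    have "\<bar>LINT x|torus_measure. (U i x - \<mu> i) * \<mu> i * V 3 3 x\<bar>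
        \<le> 2 * A\<^sup>2 * (LINT x|torus_measure. (\<mu> i)\<^sup>2) + (1/8) * ?R 3 3"
      by (rule trilinear_bound[OF A'[OF i] cA _ cont_V]) simp
    also have "(LINT x|torus_measure. (\<mu> i)\<^sup>2) = (\<mu> i)\<^sup>2 * P"
      by (simp add: measure_torus P_def)
    also have "2 * A\<^sup>2 * ((\<mu> i)\<^sup>2 * P) + (1/8) * ?R 3 3 \<le> 2 * A\<^sup>2 * ?Q i + (1/8) * ?R 3 3"
      by (intro add_right_mono mult_left_mono mu2) simp
    finally show ?thesis using b1 unfolding e1 e2 by linarith
  qed
  have T3: "?T 3 3 = 0" by (rule int_UUV_zero)
  have QR: "?Q i \<ge> 0" "?R j i \<ge> 0" for i j by (auto intro!: integral_nonneg_AE)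
  define S0 S1 where "S0 = (\<Sum>i\<in>UNIV. ?Q i)" and "S1 = (\<Sum>i\<in>UNIV. \<Sum>j\<in>UNIV. ?R j i)"
  define X where "X = (\<Sum>i\<in>UNIV. \<Sum>j\<in>UNIV. ?T j i)"
  \<comment> \<open>5 * 2 A^2 = 10 A^2 and 2 * (1/8) = 1/4. The factor 2 in front of the cross term
    later turns these into the 20 A^2 and the 1/2 of the statement.\<close>
  have Xle: "\<bar>X\<bar> \<le> 10 * A\<^sup>2 * S0 + (1/4) * S1"
  proof -
    define q where "q i = 2 * A\<^sup>2 * ?Q i" for i
    define r where "r j i = (1/8) * ?R j i" for j i
    define t where "t j i = ?T j i" for j i
    have t1: "t j i \<le> q i + r j i" "- t j i \<le> q i + r j i" if "j = 1 \<or> j = 2" for i j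
      using T1[OF that, of i] unfolding t_def q_def r_def by linarith+
    have t2: "t 3 i \<le> q 3 + r 3 i + q i + r 3 3" "- t 3 i \<le> q 3 + r 3 i + q i + r 3 3" if "i = 1 \<or> i = 2" for i
      using T2[OF that] unfolding t_def q_def r_def by linarith+
    have t3: "t 3 3 = 0" using T3 unfolding t_def .
    have q0: "0 \<le> q i" for i using QR(1) by (simp add: q_def)
    have r0: "0 \<le> r j i" for j i using QR(2) by (simp add: r_def)
    have S1: "(1/4) * S1 = 2 * (\<Sum>i\<in>UNIV. \<Sum>j\<in>UNIV. r j i)"
      by (simp add: S1_def r_def sum_distrib_left)
    have Xt: "X = (\<Sum>i\<in>UNIV. \<Sum>j\<in>UNIV. t j i)" by (simp add: X_def t_def)
    note one = disjI1[OF refl] and two = disjI2[OF refl]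
    have t3m: "- t 3 3 = 0" using t3 by simp
    have "\<bar>X\<bar> \<le> 5 * q 1 + 5 * q 2 + 5 * q 3 + (1/4) * S1"
    proof (rule abs_leI)
      show "X \<le> 5 * q 1 + 5 * q 2 + 5 * q 3 + (1/4) * S1"
        unfolding S1 Xt sum_3
        by (rule trilinear_sum_bound) (rule t1(1)[OF one] t1(1)[OF two] t2(1)[OF one] t2(1)[OF two] q0 r0 t3)+
      show "- X \<le> 5 * q 1 + 5 * q 2 + 5 * q 3 + (1/4) * S1"
        unfolding S1 Xt sum_3
        unfolding minus_add_distrib
        by (rule trilinear_sum_bound) (rule t1(2)[OF one] t1(2)[OF two] t2(2)[OF one] t2(2)[OF two] q0 r0 t3m)+
    qed
    then show ?thesis by (simp add: S0_def sum_3 q_def algebra_simps)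
  qed
  have conv_X: "(\<Sum>i\<in>UNIV. LINT x|torus_measure. conv i x * U i x) = X"
  proof -
    have "(LINT x|torus_measure. conv i x * U i x) = (\<Sum>j\<in>UNIV. ?T j i)" for i
      unfolding conv_def by (simp add: sum_distrib_right continuous_intros)
    then show ?thesis by (simp add: X_def)
  qed
  \<comment> \<open>The polarised Parseval identity between the velocity and the convection term; it
    converts the lattice sum into the trilinear integrals.\<close>
  have cross_i: "integrable lattice (\<lambda>m. Re (cnj (mode u i m) * nonlin u i m))"
    and cross: "P * (LINT m|lattice. Re (cnj (mode u i m) * nonlin u i m)) = (LINT x|torus_measure. conv i x * U i x)" for i
  proof -
    have c: "integrable torus_measure (\<lambda>x. complex_of_real (conv i x))"
      by (intro integrable_torus_continuous continuous_intros)
    have m: "(LINT x|torus_measure. emode m x * of_real (conv i x)) = of_real P * cnj (nonlin u i m)" for m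
      unfolding nonlin_conv fourier_coeff_cnj[symmetric] by (simp add: fourier_coeff_eq mult.commute P_def)
    note F = torus_integral_fourier_series[OF int_mode[of i] c, unfolded m]
    have eq: "Re (z * (of_real P * cnj w)) = P * Re (cnj z * w)" for z w
      by (simp add: algebra_simps)
    have "integrable lattice (\<lambda>m. P * Re (cnj (mode u i m) * nonlin u i m))"
      using integrable_Re[OF F(2)] unfolding eq .
    then show "integrable lattice (\<lambda>m. Re (cnj (mode u i m) * nonlin u i m))"
      using P by simp
    have "Re (LINT x|torus_measure. fourier_series (mode u i) x * of_real (conv i x))
        = (LINT m|lattice. P * Re (cnj (mode u i m) * nonlin u i m))"
      unfolding F(1) integral_Re[OF F(2), symmetric] eq ..
    also have "(LINT x|torus_measure. fourier_series (mode u i) x * of_real (conv i x))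
       = of_real (LINT x|torus_measure. conv i x * U i x)"
      unfolding integral_complex_of_real[symmetric] by (simp add: of_real_U mult.commute)
    finally show "P * (LINT m|lattice. Re (cnj (mode u i m) * nonlin u i m)) = (LINT x|torus_measure. conv i x * U i x)"
      by simp
  qed
  have S0: "S0 = P * energy 0 u" using sum_U_sq by (simp add: S0_def P_def)
  have S1: "S1 \<le> P * energy 2 u" using sum_V_sq by (simp only: S1_def P_def)
  have pw: "flux lam 0 u m \<le> growth_const lam * (weight m ^ 0 * mode_sq u m) - weight m ^ 2 * mode_sq u m
       - 2 * (\<Sum>i\<in>UNIV. Re (cnj (mode u i m) * nonlin u i m))" for m
  proof -
    have "2 * growth lam m * mode_sq u m \<le> (growth_const lam - weight m ^ 2) * mode_sq u m"
      by (intro mult_right_mono growth_le) auto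
    then show ?thesis unfolding flux_eq by (simp only: left_diff_distrib power_0 mult_1 sum_distrib_left[symmetric])
  qed
  have i0: "integrable lattice (\<lambda>m. weight m ^ 0 * mode_sq u m)" and i2: "integrable lattice (\<lambda>m. weight m ^ 2 * mode_sq u m)"
    by (rule int_mode_sq, simp)+
  have "(LINT m|lattice. flux lam 0 u m) \<le> (LINT m|lattice. growth_const lam * (weight m ^ 0 * mode_sq u m) - weight m ^ 2 * mode_sq u m
       - 2 * (\<Sum>i\<in>UNIV. Re (cnj (mode u i m) * nonlin u i m)))"
    by (intro integral_mono pw Bochner_Integration.integrable_diff integrable_mult_right i0 i2
        Bochner_Integration.integrable_sum cross_i flux_integrable) auto
  also have "\<dots> = growth_const lam * energy 0 u - energy 2 u - 2 * (\<Sum>i\<in>UNIV. LINT m|lattice. Re (cnj (mode u i m) * nonlin u i m))"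
    unfolding energy_def using i0 i2 cross_i by (simp del: power_0 times_complex.sel)
  also have "(\<Sum>i\<in>UNIV. LINT m|lattice. Re (cnj (mode u i m) * nonlin u i m)) = X / P"
    unfolding conv_X[symmetric] cross[symmetric] using P by (simp add: sum_distrib_left[symmetric] del: times_complex.sel)
  finally have "(LINT m|lattice. flux lam 0 u m) \<le> growth_const lam * energy 0 u - energy 2 u + 2 * (\<bar>X\<bar> / P)"
    using P abs_ge_minus_self[of "X / P"] by simp
  also have "\<bar>X\<bar> / P \<le> 10 * A\<^sup>2 * energy 0 u + (1/4) * energy 2 u"
  proof -
    have "\<bar>X\<bar> \<le> (10 * A\<^sup>2 * energy 0 u + (1/4) * energy 2 u) * P"
      using Xle S1 unfolding S0 by (simp add: algebra_simps)
    then show ?thesis using P by (simp add: pos_divide_le_eq)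
  qed
  finally show ?thesis by (simp add: algebra_simps)
qed

end

section \<open>The Besov bound\<close>

definition dyadic_coeff :: "(real^3 \<Rightarrow> real) \<Rightarrow> int \<Rightarrow> int^3 \<Rightarrow> real" where
  "dyadic_coeff \<phi> j m = \<phi> ((2 powi (- j)) *\<^sub>R frequency m)"

text \<open>The decay that a unit bound in the space of order 1/2 gives the blocks; it is cut off at
  negative \<open>j\<close>, where the blocks on the torus vanish.\<close>

definition besov_decay :: "int \<Rightarrow> real" where
  "besov_decay j = (if j \<ge> 0 then 2 powr (- (1/2) * of_int j) else 0)"

text \<open>The sum of a geometric series. The division by (2 pi)^3 undoes the factor in
  \<open>dyadic_block_eq\<close>, which stems from convolving with an unnormalised kernel.\<close>

definition besov_const :: real where
  "besov_const = (LINT j|count_space UNIV. besov_decay j) / (2 * pi) ^ 3"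

lemma integrable_besov_decay: "integrable (count_space UNIV) besov_decay"
proof -
  have "summable (\<lambda>n. (2 powr (- (1/2))) ^ n :: real)"
    by (rule summable_geometric) (simp add: powr_minus powr_half_sqrt field_simps)
  moreover have "besov_decay (int n) = (2 powr (- (1/2))) ^ n" for n
    by (simp add: besov_decay_def powr_realpow[symmetric] powr_powr)
  ultimately have "Infinite_Set_Sum.abs_summable_on (\<lambda>n. besov_decay (int n)) UNIV"
    by (simp add: abs_summable_on_nat_iff')
  then have "Infinite_Set_Sum.abs_summable_on besov_decay (range int)"
    by (rule abs_summable_on_reindex)
  then have "Infinite_Set_Sum.abs_summable_on besov_decay UNIV"
  proof (rule abs_summable_on_cong_neutral[THEN iffD1, rotated -1])
    fix j assume "j \<in> UNIV - range int"
    then have "j < 0" by (metis Diff_iff UNIV_I nonneg_int_cases not_less range_eqI)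
    then show "besov_decay j = 0" by (simp add: besov_decay_def)
  qed auto
  then show ?thesis by (simp add: Infinite_Set_Sum.abs_summable_on_def)
qed

lemma besov_const_nonneg: "besov_const \<ge> 0"
  unfolding besov_const_def by (intro divide_nonneg_nonneg integral_nonneg_AE) (auto simp: besov_decay_def)

lemma norm_frequency_ge1: "m \<noteq> 0 \<Longrightarrow> norm (frequency m) \<ge> 1"
proof -
  assume "m \<noteq> 0"
  then obtain i where "m $ i \<noteq> 0" by (auto simp: vec_eq_iff)
  then have "(1::real) \<le> \<bar>of_int (m $ i)\<bar>" by linarith
  then show ?thesis using norm_frequency_ge[of m i] by linarith
qed

lemma dyadic_coeff_support:
  assumes \<phi>: "dyadic_cutoff \<phi>" and nz: "dyadic_coeff \<phi> j m \<noteq> 0"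
  shows "1/2 < 2 powi (- j) * norm (frequency m)" "2 powi (- j) * norm (frequency m) < 2"
proof -
  have "(2 powi (- j)) *\<^sub>R frequency m \<in> closure {\<xi>. \<phi> \<xi> \<noteq> 0}"
    by (rule subsetD[OF closure_subset]) (use nz in \<open>simp add: dyadic_coeff_def\<close>)
  then have "1/2 < norm ((2 powi (- j)) *\<^sub>R frequency m)" "norm ((2 powi (- j)) *\<^sub>R frequency m) < 2"
    using \<phi> by (auto simp: dyadic_cutoff_def)
  then show "1/2 < 2 powi (- j) * norm (frequency m)" "2 powi (- j) * norm (frequency m) < 2" by simp_all
qed

lemma dyadic_coeff_range:
  "dyadic_cutoff \<phi> \<Longrightarrow> 0 \<le> dyadic_coeff \<phi> j m" "dyadic_cutoff \<phi> \<Longrightarrow> dyadic_coeff \<phi> j m \<le> 1"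
  by (simp_all add: dyadic_cutoff_def dyadic_coeff_def)

text \<open>Nonzero frequencies have norm at least 1, so for j < 0 the scaled frequency has norm at
  least 2, outside the support of the cutoff.\<close>

lemma dyadic_coeff_zero:
  assumes \<phi>: "dyadic_cutoff \<phi>"
  shows "dyadic_coeff \<phi> j 0 = 0" and "j < 0 \<Longrightarrow> dyadic_coeff \<phi> j m = 0"
proof -
  show z: "dyadic_coeff \<phi> j 0 = 0"
    using dyadic_coeff_support(1)[OF \<phi>, of j 0] by fastforce
  assume j: "j < 0"
  show "dyadic_coeff \<phi> j m = 0"
  proof (rule ccontr)
    assume nz: "dyadic_coeff \<phi> j m \<noteq> 0"
    then have "m \<noteq> 0" using z by metis
    have "(2::real) powi 1 \<le> 2 powi (- j)" using j by (intro power_int_increasing) auto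
    then have "2 * 1 \<le> 2 powi (- j) * norm (frequency m)"
      using norm_frequency_ge1[OF \<open>m \<noteq> 0\<close>] by (intro mult_mono) auto
    then show False using dyadic_coeff_support(2)[OF \<phi> nz] by simp
  qed
qed

text \<open>On the support the weight is at most \<open>B\<close>, so the summable function (B /
  weight)^2 is at least 1 there and dominates the coefficients.\<close>

lemma integrable_dyadic_coeff:
  assumes \<phi>: "dyadic_cutoff \<phi>"
  shows "integrable lattice (dyadic_coeff \<phi> j)"
proof (rule Bochner_Integration.integrable_bound)
  define B :: real where "B = 1 + (2 * 2 powi j)\<^sup>2"
  show "integrable lattice (\<lambda>m. B\<^sup>2 * (1 / (weight m)\<^sup>2))"
    using integrable_mult_right[of "B\<^sup>2", OF integrable_weight] .
  have "dyadic_coeff \<phi> j m \<le> B\<^sup>2 * (1 / (weight m)\<^sup>2)" for m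
  proof (cases "dyadic_coeff \<phi> j m = 0")
    case False
    have p: "(2::real) powi (- j) * 2 powi j = 1" by (simp add: power_int_minus)
    have "2 powi j * (2 powi (- j) * norm (frequency m)) \<le> 2 powi j * 2"
      using dyadic_coeff_support(2)[OF \<phi> False] by (intro mult_left_mono) auto
    moreover have "2 powi j * (2 powi (- j) * norm (frequency m)) = (2 powi (- j) * 2 powi j) * norm (frequency m)"
      by (simp only: mult_ac)
    ultimately have "norm (frequency m) \<le> 2 * 2 powi j"
      unfolding p by simp
    then have "(norm (frequency m))\<^sup>2 \<le> (2 * 2 powi j)\<^sup>2" by (intro power_mono) auto
    then have "weight m \<le> B" by (simp add: B_def)
    then have "(weight m)\<^sup>2 \<le> B\<^sup>2" by (intro power_mono) auto
    then have "1 \<le> B\<^sup>2 * (1 / (weight m)\<^sup>2)" by (simp add: pos_le_divide_eq)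
    then show ?thesis using dyadic_coeff_range(2)[OF \<phi>, of j m] by linarith
  qed simp
  then show "AE m in lattice. norm (dyadic_coeff \<phi> j m) \<le> norm (B\<^sup>2 * (1 / (weight m)\<^sup>2))"
    using dyadic_coeff_range(1)[OF \<phi>] by (intro AE_I2) simp
qed simp

lemma sum_dyadic_coeff:
  assumes \<phi>: "dyadic_cutoff \<phi>" and m: "m \<noteq> 0"
  shows "integrable (count_space UNIV) (\<lambda>j. dyadic_coeff \<phi> j m)"
    and "(LINT j|count_space UNIV. dyadic_coeff \<phi> j m) = 1"
proof -
  have "frequency m \<noteq> 0" using norm_frequency_ge1[OF m] by auto
  then have hs: "((\<lambda>j. dyadic_coeff \<phi> j m) has_sum 1) UNIV"
    using \<phi> by (simp add: dyadic_cutoff_def dyadic_coeff_def)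
  then show i: "integrable (count_space UNIV) (\<lambda>j. dyadic_coeff \<phi> j m)"
    by (subst integrable_iff_summable_on_nonneg) (use dyadic_coeff_range(1)[OF \<phi>] in \<open>auto simp: summable_on_def\<close>)
  show "(LINT j|count_space UNIV. dyadic_coeff \<phi> j m) = 1"
    using infsum_eq_lebesgue_integral[OF i] infsumI[OF hs] by simp
qed

lemma dyadic_kernel_eq:
  assumes \<phi>: "dyadic_cutoff \<phi>"
  shows "dyadic_kernel \<phi> j x = fourier_series (\<lambda>m. of_real (dyadic_coeff \<phi> j m)) x"
proof -
  have "integrable lattice (\<lambda>m. complex_of_real (dyadic_coeff \<phi> j m) * emode m x)"
    using integrable_dyadic_coeff[OF \<phi>] by simp
  from infsum_eq_lebesgue_integral[OF this] show ?thesis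
    by (simp add: dyadic_kernel_def fourier_series_def dyadic_coeff_def emode_def cis_conv_exp)
qed

lemma dyadic_block_eq:
  assumes \<phi>: "dyadic_cutoff \<phi>" and f: "integrable torus_measure f"
  shows "dyadic_block \<phi> j (to_D0' f) x
    = of_real ((2 * pi) ^ 3) * (LINT m|lattice. of_real (dyadic_coeff \<phi> j m) * (fourier_coeff f m * emode m x))"
proof -
  \<comment> \<open>As a function of y, the kernel at x - y carries the opposite frequencies. This
    causes the reflection here and its reversal at the end.\<close>
  define b where "b k = complex_of_real (dyadic_coeff \<phi> j (- k)) * emode (- k) x" for k
  have ib: "integrable lattice b"
    unfolding b_def
    by (subst integral_reindex_count_space(2)[OF bij_uminus, where f="\<lambda>k. complex_of_real (dyadic_coeff \<phi> j k) * emode k x"])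
      (use integrable_dyadic_coeff[OF \<phi>] in simp)
  have kern: "dyadic_kernel \<phi> j (x - y) = fourier_series b y" for y
  proof -
    have "dyadic_kernel \<phi> j (x - y) = (LINT k|lattice. of_real (dyadic_coeff \<phi> j (- k)) * emode (- k) (x - y))"
      unfolding dyadic_kernel_eq[OF \<phi>] fourier_series_def
      by (rule integral_reindex_count_space(1)[OF bij_uminus, symmetric])
    also have "\<dots> = fourier_series b y"
      unfolding fourier_series_def b_def
      by (rule Bochner_Integration.integral_cong[OF refl]) (simp add: emode_def cis_mult inner_diff_right)
    finally show ?thesis .
  qed
  have "dyadic_block \<phi> j (to_D0' f) x = (LINT y|torus_measure. fourier_series b y * of_real (f y))"
    by (simp add: dyadic_block_def to_D0'_def kern mult.commute)
  also have "\<dots> = (LINT k|lattice. b k * (LINT y|torus_measure. emode k y * of_real (f y)))"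
    by (rule torus_integral_fourier_series(1)[OF ib]) (use f in simp)
  also have "\<dots> = (LINT k|lattice. of_real ((2 * pi) ^ 3) * (of_real (dyadic_coeff \<phi> j (- k)) * (fourier_coeff f (- k) * emode (- k) x)))"
  proof (rule Bochner_Integration.integral_cong[OF refl])
    fix k
    have "(LINT y|torus_measure. emode k y * of_real (f y)) = of_real ((2 * pi) ^ 3) * fourier_coeff f (- k)"
      by (simp add: fourier_coeff_eq mult.commute)
    then show "b k * (LINT y|torus_measure. emode k y * of_real (f y))
        = of_real ((2 * pi) ^ 3) * (of_real (dyadic_coeff \<phi> j (- k)) * (fourier_coeff f (- k) * emode (- k) x))"
      by (simp only: b_def mult_ac)
  qed
  also have "\<dots> = (LINT k|lattice. of_real ((2 * pi) ^ 3) * (of_real (dyadic_coeff \<phi> j k) * (fourier_coeff f k * emode k x)))"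
    by (rule integral_reindex_count_space(1)[OF bij_uminus, where f="\<lambda>k. of_real ((2 * pi) ^ 3) * (of_real (dyadic_coeff \<phi> j k) * (fourier_coeff f k * emode k x))"])
  finally show ?thesis by (simp only: integral_mult_right_zero)
qed

text \<open>For m other than 0 the dyadic coefficients sum to 1 over j, and for m = 0 they all
  vanish; Fubini over j and m does the rest. The mean is thus exactly what the blocks miss.\<close>

lemma dyadic_decomposition:
  assumes \<phi>: "dyadic_cutoff \<phi>" and a: "integrable lattice a"
  shows "(LINT j|count_space UNIV. LINT m|lattice. of_real (dyadic_coeff \<phi> j m) * (a m * emode m x))
      = fourier_series a x - a 0"
    and "integrable (count_space UNIV) (\<lambda>j. LINT m|lattice. of_real (dyadic_coeff \<phi> j m) * (a m * emode m x))"
proof -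
  have inner: "(\<integral>\<^sup>+j. ennreal (cmod (of_real (dyadic_coeff \<phi> j m) * (a m * emode m x))) \<partial>count_space UNIV) \<le> ennreal (cmod (a m))" for m
  proof (cases "m = 0")
    case True
    then show ?thesis by (simp add: dyadic_coeff_zero(1)[OF \<phi>])
  next
    case False
    have "(\<integral>\<^sup>+j. ennreal (cmod (of_real (dyadic_coeff \<phi> j m) * (a m * emode m x))) \<partial>count_space UNIV)
       = (\<integral>\<^sup>+j. ennreal (dyadic_coeff \<phi> j m) * ennreal (cmod (a m)) \<partial>count_space UNIV)"
      by (intro nn_integral_cong) (simp add: norm_mult ennreal_mult'[symmetric] dyadic_coeff_range[OF \<phi>])
    also have "\<dots> = ennreal (LINT j|count_space UNIV. dyadic_coeff \<phi> j m) * ennreal (cmod (a m))"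
      using sum_dyadic_coeff(1)[OF \<phi> False]
      by (subst nn_integral_multc) (auto simp: nn_integral_eq_integral dyadic_coeff_range[OF \<phi>])
    finally show ?thesis by (simp add: sum_dyadic_coeff(2)[OF \<phi> False])
  qed
  have "(\<integral>\<^sup>+m. (\<integral>\<^sup>+j. ennreal (cmod (of_real (dyadic_coeff \<phi> j m) * (a m * emode m x))) \<partial>count_space UNIV) \<partial>lattice)
      \<le> (\<integral>\<^sup>+m. ennreal (cmod (a m)) \<partial>lattice)"
    by (intro nn_integral_mono inner)
  also have "\<dots> < \<infinity>" using a by (simp add: integrable_iff_bounded)
  finally have fin: "(\<integral>\<^sup>+m. (\<integral>\<^sup>+j. ennreal (cmod (of_real (dyadic_coeff \<phi> j m) * (a m * emode m x))) \<partial>count_space UNIV) \<partial>lattice) < \<infinity>" .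
  note S = sums_swap[OF sigma_finite_measure_count_space _ fin, simplified]
  show "integrable (count_space UNIV) (\<lambda>j. LINT m|lattice. of_real (dyadic_coeff \<phi> j m) * (a m * emode m x))"
    using S(4) by simp
  have inner2: "(LINT j|count_space UNIV. of_real (dyadic_coeff \<phi> j m) * (a m * emode m x))
      = a m * emode m x - (if m = 0 then a m * emode m x else 0)" for m
  proof (cases "m = 0")
    case False
    have "(LINT j|count_space UNIV. of_real (dyadic_coeff \<phi> j m) * (a m * emode m x))
        = of_real (LINT j|count_space UNIV. dyadic_coeff \<phi> j m) * (a m * emode m x)"
      unfolding integral_complex_of_real[symmetric]
      by (rule integral_mult_left_zero)
    then show ?thesis using False by (simp add: sum_dyadic_coeff(2)[OF \<phi> False])
  qed (simp add: dyadic_coeff_zero(1)[OF \<phi>])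
  have i0: "integrable lattice (\<lambda>m. if m = 0 then a m * emode m x else 0)"
    by (rule Bochner_Integration.integrable_bound[OF integrable_mult_emode[OF a]]) auto
  have "(LINT j|count_space UNIV. LINT m|lattice. of_real (dyadic_coeff \<phi> j m) * (a m * emode m x))
      = (LINT m|lattice. LINT j|count_space UNIV. of_real (dyadic_coeff \<phi> j m) * (a m * emode m x))"
    using S(5) by simp
  also have "\<dots> = (LINT m|lattice. a m * emode m x) - (LINT m|lattice. (if m = 0 then a m * emode m x else 0))"
    unfolding inner2 by (rule Bochner_Integration.integral_diff[OF integrable_mult_emode[OF a] i0])
  also have "\<dots> = fourier_series a x - a 0"
    unfolding integral_single_count_space by (simp add: fourier_series_def)
  finally show "(LINT j|count_space UNIV. LINT m|lattice. of_real (dyadic_coeff \<phi> j m) * (a m * emode m x))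
      = fourier_series a x - a 0" .
qed

text \<open>There are countably many blocks, so a single null set serves for all \<open>j\<close>;
  this allows summing the bounds at a fixed point.\<close>

lemma besov_block_bound:
  assumes F: "F \<in> besov_inf \<phi> s"
  shows "AE x in torus_measure. \<forall>j. cmod (dyadic_block \<phi> j F x) \<le> 2 powr (- s * of_int j) * besov_inf_norm \<phi> s F"
  unfolding AE_all_countable
proof
  fix j
  let ?B = "besov_inf_norm \<phi> s F"
  have B: "besov_inf_enorm \<phi> s F = ennreal ?B"
    using F by (simp add: besov_inf_def besov_inf_norm_def)
  show "AE x in torus_measure. cmod (dyadic_block \<phi> j F x) \<le> 2 powr (- s * of_int j) * ?B"
    using esssup_AE[of "\<lambda>x. ennreal (cmod (dyadic_block \<phi> j F x))" torus_measure]
  proof eventually_elim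
    case (elim x)
    let ?c = "cmod (dyadic_block \<phi> j F x)"
    have "ennreal (2 powr (s * of_int j) * ?c) = ennreal (2 powr (s * of_int j)) * ennreal ?c"
      by (simp add: ennreal_mult')
    also have "\<dots> \<le> ennreal (2 powr (s * of_int j)) * esssup torus_measure (\<lambda>x. ennreal (cmod (dyadic_block \<phi> j F x)))"
      by (rule mult_left_mono[OF elim]) simp
    also have "\<dots> \<le> besov_inf_enorm \<phi> s F"
      unfolding besov_inf_enorm_def by (rule SUP_upper) simp
    finally have "2 powr (s * of_int j) * ?c \<le> ?B"
      unfolding B by (subst (asm) ennreal_le_iff) (simp_all add: besov_inf_norm_def)
    then have "2 powr (- s * of_int j) * (2 powr (s * of_int j) * ?c) \<le> 2 powr (- s * of_int j) * ?B"
      by (rule mult_left_mono) simp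
    then show ?case by (simp add: mult.assoc[symmetric] powr_add[symmetric])
  qed
qed

text \<open>Triangle inequality over the dyadic blocks at a point where all block bounds hold,
  against the geometric series \<open>besov_decay\<close>.\<close>

lemma (in h4_state) besov_fluctuation_bound:
  assumes \<phi>: "dyadic_cutoff \<phi>" and F: "to_D0' (\<lambda>x. u x $ i) \<in> besov_inf \<phi> (1/2)"
  shows "AE x in torus_measure. \<bar>U i x - Re (mode u i 0)\<bar> \<le> besov_const * besov_inf_norm \<phi> (1/2) (to_D0' (\<lambda>x. u x $ i))"
  using besov_block_bound[OF F]
proof eventually_elim
  case (elim x)
  let ?B = "besov_inf_norm \<phi> (1/2) (to_D0' (\<lambda>x. u x $ i))"
  define P :: real where "P = (2 * pi) ^ 3"
  have P: "P > 0" by (simp add: P_def)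
  define S where "S j = (LINT m|lattice. of_real (dyadic_coeff \<phi> j m) * (mode u i m * emode m x))" for j
  have bl: "dyadic_block \<phi> j (to_D0' (\<lambda>x. u x $ i)) x = of_real P * S j" for j
    unfolding S_def P_def mode_def by (rule dyadic_block_eq[OF \<phi> L2_torus_integrable[OF component_L2]])
  have B: "?B \<ge> 0" by (simp add: besov_inf_norm_def)
  have S: "cmod (S j) \<le> (?B / P) * besov_decay j" for j
  proof (cases "j \<ge> 0")
    case True
    have "P * cmod (S j) \<le> 2 powr (- (1/2) * of_int j) * ?B"
      using elim[rule_format, of j] P unfolding bl norm_mult by simp
    then have "cmod (S j) \<le> 2 powr (- (1/2) * of_int j) * ?B / P"
      using P by (simp add: pos_le_divide_eq mult.commute)
    then show ?thesis using True by (simp add: besov_decay_def mult.commute)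
  next
    case False
    then have "S j = 0" by (simp add: S_def dyadic_coeff_zero(2)[OF \<phi>])
    then show ?thesis using False by (simp add: besov_decay_def)
  qed
  note D = dyadic_decomposition[OF \<phi> int_mode[of i], of x, folded S_def]
  have "\<bar>U i x - Re (mode u i 0)\<bar> \<le> cmod (fourier_series (mode u i) x - mode u i 0)"
    unfolding U_def minus_complex.sel[symmetric] by (rule abs_Re_le_cmod)
  also have "\<dots> = cmod (LINT j|count_space UNIV. S j)" by (simp add: D(1))
  also have "\<dots> \<le> (LINT j|count_space UNIV. cmod (S j))" by (rule integral_norm_bound)
  also have "\<dots> \<le> (LINT j|count_space UNIV. (?B / P) * besov_decay j)"
    by (intro integral_mono integrable_mult_right integrable_besov_decay S) (use D(2) in simp)
  also have "\<dots> = besov_const * ?B" by (simp add: besov_const_def P_def)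
  finally show ?case .
qed

section \<open>Measurability in time\<close>

text \<open>Completeness of Lebesgue measure. It is the means of transferring measurability to
  expressions that contain arbitrarily chosen representatives.\<close>

lemma measurable_AE_lebesgue_on:
  fixes f g :: "'a::euclidean_space \<Rightarrow> 'b::euclidean_space"
  assumes I: "I \<in> sets lebesgue" and f: "f \<in> borel_measurable (lebesgue_on I)"
    and ae: "AE x in lebesgue_on I. f x = g x"
  shows "g \<in> borel_measurable (lebesgue_on I)"
proof -
  have "(\<lambda>x. if x \<in> I then f x else 0) \<in> borel_measurable lebesgue"
    using f I by (simp add: borel_measurable_if)
  moreover have "AE x in lebesgue. (if x \<in> I then f x else 0) = (if x \<in> I then g x else 0)"
    using ae I by (subst (asm) AE_restrict_space_iff) (auto elim!: eventually_mono)
  ultimately have "(\<lambda>x. if x \<in> I then g x else 0) \<in> borel_measurable lebesgue"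
    by (rule borel_measurable_AE)
  then show ?thesis using I by (simp add: borel_measurable_if)
qed

lemma simple_function_iff_finite_measurable:
  "simple_function M f \<longleftrightarrow> finite (f ` space M) \<and> f \<in> measurable M (count_space UNIV)"
proof
  assume "simple_function M f"
  then show "finite (f ` space M) \<and> f \<in> measurable M (count_space UNIV)"
    using measurable_simple_function by (auto simp: simple_function_def)
next
  assume a: "finite (f ` space M) \<and> f \<in> measurable M (count_space UNIV)"
  then have "f -` {x} \<inter> space M \<in> sets M" for x
    using measurable_sets[of f M "count_space UNIV" "{x}"] by simp
  then show "simple_function M f" using a by (simp add: simple_function_def)
qed

text \<open>A functional that is 1-Lipschitz for \<open>N\<close> maps the approximating simple
  functions to measurable ones that converge almost everywhere.\<close>

lemma strongly_measurable_functional: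
  fixes l :: "'b::minus \<Rightarrow> 'c::euclidean_space"
  assumes I: "I \<in> sets lebesgue" and sm: "strongly_measurable I X N u"
    and l: "\<And>x y. x \<in> X \<Longrightarrow> y \<in> X \<Longrightarrow> norm (l x - l y) \<le> N (x - y)"
  shows "(\<lambda>t. l (u t)) \<in> borel_measurable (lebesgue_on I)"
proof -
  obtain s where s: "\<And>n. simple_function (lebesgue_on I) (s n)" "\<And>n. s n ` I \<subseteq> X"
    and lim: "AE t in lebesgue_on I. (\<lambda>n. N (s n t - u t)) \<longlonglongrightarrow> 0"
    and uX: "AE t in lebesgue_on I. u t \<in> X"
    using sm unfolding strongly_measurable_def by auto
  have [measurable]: "(\<lambda>t. l (s n t)) \<in> borel_measurable (lebesgue_on I)" for n
  proof -
    have "s n \<in> measurable (lebesgue_on I) (count_space UNIV)"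
      using s(1)[of n] by (simp add: simple_function_iff_finite_measurable)
    then show ?thesis by (rule measurable_compose) simp
  qed
  have "(\<lambda>t. lim (\<lambda>n. l (s n t))) \<in> borel_measurable (lebesgue_on I)"
    by (rule borel_measurable_lim_metric) simp
  moreover have "AE t in lebesgue_on I. lim (\<lambda>n. l (s n t)) = l (u t)"
    using lim uX AE_space
  proof eventually_elim
    case (elim t)
    have "norm (l (s n t) - l (u t)) \<le> N (s n t - u t)" for n
      using l[of "s n t" "u t"] s(2)[of n] elim by auto
    then have "(\<lambda>n. l (s n t) - l (u t)) \<longlonglongrightarrow> 0"
      by (intro Lim_null_comparison[OF _ elim(1)]) simp
    then have "(\<lambda>n. l (s n t)) \<longlonglongrightarrow> l (u t)" by (simp add: LIM_zero_iff)
    then show ?case by (rule limI)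
  qed
  ultimately show ?thesis by (rule measurable_AE_lebesgue_on[OF I])
qed

text \<open>With \<open>b n = T (1 - 1 / (n + 2))\<close>, the ceiling of \<open>T / (T - t)\<close> is an index \<open>n\<close> with \<open>t < b n\<close>.\<close>

lemma strongly_measurable_glue:
  fixes u :: "real \<Rightarrow> 'b::minus"
  assumes T: "T > 0" and z: "z \<in> X"
    and sm: "\<And>b. 0 < b \<Longrightarrow> b < T \<Longrightarrow> strongly_measurable {0..<b} X N u"
    and I: "{0<..<T} \<subseteq> I" "I \<subseteq> {0..T}"
  shows "strongly_measurable I X N u"
proof -
  have Il: "I \<in> sets lebesgue"
  proof -
    have "I = {0<..<T} \<union> (I \<inter> {0}) \<union> (I \<inter> {T})" using I by force
    moreover have "I \<inter> {0} \<in> sets lebesgue" "I \<inter> {T} \<in> sets lebesgue"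
      by (cases "0 \<in> I"; simp) (cases "T \<in> I"; simp)
    ultimately show ?thesis by (metis lborelD open_greaterThanLessThan borel_open sets.Un sets_completionI_sets sets_lborel)
  qed
  define b where "b n = T * (1 - 1 / (real n + 2))" for n :: nat
  have b: "0 < b n" "b n < T" for n
    using T by (auto simp: b_def field_simps add_pos_nonneg)
  have less_b: "t < b n \<longleftrightarrow> T / (T - t) < real n + 2" if "t < T" for t n
    using T that by (simp add: b_def field_simps)
  define p where "p t = nat \<lceil>T / (T - t)\<rceil>" for t
  have t_p: "t < b (p t)" if "t < T" for t
    using that by (subst less_b) (auto simp: p_def intro: le_less_trans[OF real_nat_ceiling_ge])
  define P where "P n r \<longleftrightarrow> (\<forall>k. simple_function (lebesgue_on {0..<b n}) (r k) \<and> r k ` {0..<b n} \<subseteq> X)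
      \<and> (AE t in lebesgue_on {0..<b n}. (\<lambda>k. N (r k t - u t)) \<longlonglongrightarrow> 0)" for n r
  have "\<forall>n. \<exists>r. P n r"
    using sm[OF b] unfolding strongly_measurable_def P_def by blast
  from choice[OF this] obtain s where "\<forall>n. P n (s n)" ..
  then have s: "\<And>n k. simple_function (lebesgue_on {0..<b n}) (s n k)" "\<And>n k. s n k ` {0..<b n} \<subseteq> X"
    and lim: "\<And>n. AE t in lebesgue_on {0..<b n}. (\<lambda>k. N (s n k t - u t)) \<longlonglongrightarrow> 0"
    unfolding P_def by blast+
  \<comment> \<open>The extension by the default value \<open>z\<close> gives functions measurable
    on the whole line, which can be composed with the random index \<open>p\<close>.\<close>
  define s' where "s' n k t = (if t \<in> {0..<b n} then s n k t else z)" for n k t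
  have s'm [measurable]: "s' n k \<in> measurable lebesgue (count_space UNIV)" for n k
  proof -
    have "s n k \<in> measurable (lebesgue_on {0..<b n}) (count_space UNIV)"
      using s(1)[of n k] by (simp add: simple_function_iff_finite_measurable)
    then show ?thesis
      unfolding s'_def by (subst (asm) measurable_restrict_space_iff[where c=z]) auto
  qed
  have s'f: "finite (range (s' n k))" for n k
  proof -
    have "finite (s n k ` {0..<b n})" using s(1)[of n k] by (simp add: simple_function_def)
    then show ?thesis by (rule finite_subset[of _ "insert z (s n k ` {0..<b n})", rotated, OF finite.insertI]) (auto simp: s'_def)
  qed
  define S where "S k t = (if t < b k then s' (p t) k t else z)" for k t
  \<comment> \<open>From t < b k follows p t <= k + 2, so \<open>S k\<close> draws on finitely many
    approximations and remains simple.\<close>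
  have S_range: "S k t \<in> insert z (\<Union>n\<le>k + 2. range (s' n k))" for k t
  proof (cases "t < b k")
    case True
    then have "t < T" using b(2)[of k] by simp
    then have "T / (T - t) < real k + 2" using less_b[of t k] True by simp
    then have "p t \<le> k + 2" by (simp add: p_def ceiling_le_iff nat_le_iff)
    then show ?thesis using True by (auto simp: S_def)
  qed (simp add: S_def)
  have pm: "p \<in> measurable lebesgue (count_space UNIV)"
  proof -
    have "p \<in> measurable lborel (count_space UNIV)" unfolding p_def by measurable
    then show ?thesis by (rule measurable_completion)
  qed
  have "(\<lambda>t. s' (p t) k t) \<in> measurable lebesgue (count_space UNIV)" for k
    by (rule measurable_compose_countable[OF s'm pm])
  then have Sm: "S k \<in> measurable lebesgue (count_space UNIV)" for k
    unfolding S_def by (intro measurable_If) auto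
  have simple: "simple_function (lebesgue_on I) (S k)" for k
    unfolding simple_function_iff_finite_measurable
  proof
    show "finite (S k ` space (lebesgue_on I))"
    proof (rule finite_subset)
      show "S k ` space (lebesgue_on I) \<subseteq> insert z (\<Union>n\<le>k + 2. range (s' n k))"
        using S_range by (rule image_subsetI)
      show "finite (insert z (\<Union>n\<le>k + 2. range (s' n k)))" using s'f by simp
    qed
    show "S k \<in> measurable (lebesgue_on I) (count_space UNIV)"
      by (rule measurable_restrict_space1[OF Sm])
  qed
  have S_X: "S k ` I \<subseteq> X" for k
  proof -
    have "s n k t \<in> X" if "t \<in> {0..<b n}" for n t using s(2)[of n k] that by blast
    then show ?thesis using z by (auto simp: S_def s'_def)
  qed
  have nT: "AE t in lebesgue. t \<noteq> T" by (simp add: AE_completion_iff AE_lborel_singleton)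
  have conv: "AE t in lebesgue. t \<in> I \<longrightarrow> (\<lambda>k. N (S k t - u t)) \<longlonglongrightarrow> 0"
  proof -
    have "AE t in lebesgue. \<forall>n. t \<in> {0..<b n} \<longrightarrow> (\<lambda>k. N (s n k t - u t)) \<longlonglongrightarrow> 0"
      using lim by (subst AE_all_countable) (auto simp: AE_restrict_space_iff)
    with nT show ?thesis
    proof eventually_elim
      case (elim t)
      show ?case
      proof
        assume "t \<in> I"
        then have t: "0 \<le> t" "t < T" using I(2) elim(1) by auto
        then have 1: "(\<lambda>k. N (s (p t) k t - u t)) \<longlonglongrightarrow> 0" using elim(2) t_p by auto
        obtain K :: nat where K: "T / (T - t) < real K" using reals_Archimedean2 by blast
        have "\<forall>\<^sub>F k in sequentially. N (s (p t) k t - u t) = N (S k t - u t)"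
          using eventually_ge_at_top[of K]
        proof eventually_elim
          case (elim k)
          then have "t < b k" using K less_b[OF t(2), of k] by simp
          then show ?case using t t_p by (simp add: S_def s'_def)
        qed
        then show "(\<lambda>k. N (S k t - u t)) \<longlonglongrightarrow> 0" by (rule Lim_transform_eventually[OF 1])
      qed
    qed
  qed
  have inX: "AE t in lebesgue. t \<in> I \<longrightarrow> u t \<in> X"
  proof -
    have "AE t in lebesgue. \<forall>n. t \<in> {0..<b n} \<longrightarrow> u t \<in> X"
      using sm[OF b] by (subst AE_all_countable) (auto simp: AE_restrict_space_iff strongly_measurable_def)
    with nT show ?thesis
    proof eventually_elim
      case (elim t)
      then show ?case using t_p[of t] I(2) by fastforce
    qed
  qed
  show ?thesis
    unfolding strongly_measurable_def
    using simple S_X conv inX Il by (auto simp: AE_restrict_space_iff intro!: exI[of _ S])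
qed

section \<open>A smooth step function\<close>

text \<open>Smooth test functions in time are obtained by restricting the dyadic cutoff to a line.\<close>

lemma smooth_affine:
  fixes f :: "'a::euclidean_space \<Rightarrow> 'b::real_normed_vector" and L :: "'c::euclidean_space \<Rightarrow> 'a"
  assumes f: "smooth f" and L: "bounded_linear L"
  shows "smooth (\<lambda>x. f (p + L x))"
proof -
  have d: "((\<lambda>x. f (p + L x)) has_derivative (\<lambda>h. frechet_derivative f (at (p + L x)) (L h))) (at x)"
    if "f differentiable (at (p + L x))" for f :: "'a \<Rightarrow> 'b" and x
  proof -
    have "((\<lambda>x. p + L x) has_derivative L) (at x)"
      using bounded_linear_imp_has_derivative[OF L] by (auto intro!: derivative_eq_intros)
    moreover have "(f has_derivative frechet_derivative f (at (p + L x))) (at (p + L x))"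
      using that by (simp add: frechet_derivative_works)
    ultimately show ?thesis
      by (rule has_derivative_compose[where g=f])
  qed
  have "foldr dir_deriv vs (\<lambda>x. f (p + L x)) = (\<lambda>x. foldr dir_deriv (map L vs) f (p + L x))" for vs
  proof (induction vs)
    case (Cons v vs)
    have "foldr dir_deriv (map L vs) f differentiable (at y)" for y
      using f unfolding smooth_def by blast
    note fd = frechet_derivative_at[OF d[OF this], symmetric]
    have "foldr dir_deriv (v # vs) (\<lambda>x. f (p + L x)) = dir_deriv v (\<lambda>x. foldr dir_deriv (map L vs) f (p + L x))"
      by (simp add: Cons)
    also have "\<dots> = (\<lambda>x. dir_deriv (L v) (foldr dir_deriv (map L vs) f) (p + L x))"
      unfolding dir_deriv_def[of v] dir_deriv_def[of "L v"] fd ..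
    finally show ?case by simp
  qed simp
  moreover have "(\<lambda>x. foldr dir_deriv (map L vs) f (p + L x)) differentiable (at x)" for vs x
    using f unfolding smooth_def by (intro differentiableI[OF d]) blast
  ultimately show ?thesis by (simp add: smooth_def)
qed

lemma smooth_linear_combination:
  fixes f g :: "'a::euclidean_space \<Rightarrow> real"
  assumes f: "smooth f" and g: "smooth g"
  shows "smooth (\<lambda>x. c * f x - d * g x)"
proof -
  have D: "((\<lambda>x. c * f x - d * g x) has_derivative (\<lambda>h. c * frechet_derivative f (at x) h - d * frechet_derivative g (at x) h)) (at x)"
    if "f differentiable (at x)" "g differentiable (at x)" for f g :: "'a \<Rightarrow> real" and x
    using that unfolding frechet_derivative_works by (intro derivative_intros)
  have "foldr dir_deriv vs (\<lambda>x. c * f x - d * g x) = (\<lambda>x. c * foldr dir_deriv vs f x - d * foldr dir_deriv vs g x)" for vs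
  proof (induction vs)
    case (Cons v vs)
    have "foldr dir_deriv vs f differentiable (at y)" "foldr dir_deriv vs g differentiable (at y)" for y
      using f g unfolding smooth_def by blast+
    note fd = frechet_derivative_at[OF D[OF this], symmetric]
    have "foldr dir_deriv (v # vs) (\<lambda>x. c * f x - d * g x)
        = dir_deriv v (\<lambda>x. c * foldr dir_deriv vs f x - d * foldr dir_deriv vs g x)"
      by (simp add: Cons)
    also have "\<dots> = (\<lambda>x. c * dir_deriv v (foldr dir_deriv vs f) x - d * dir_deriv v (foldr dir_deriv vs g) x)"
      unfolding dir_deriv_def[of v] fd ..
    finally show ?case by simp
  qed simp
  moreover have "(\<lambda>x. c * foldr dir_deriv vs f x - d * foldr dir_deriv vs g x) differentiable (at x)" for vs x
    using f g unfolding smooth_def by (intro differentiableI[OF D]) blast+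
  ultimately show ?thesis by (simp add: smooth_def)
qed

text \<open>Any first derivative of \<open>B\<close> is a multiple of a smooth function, so all
  higher ones exist.\<close>

lemma smooth_antiderivative:
  fixes B \<beta> :: "real \<Rightarrow> real"
  assumes "smooth \<beta>" and D: "\<And>x. (B has_real_derivative \<beta> x) (at x)"
  shows "smooth B"
  unfolding smooth_def
proof (intro allI)
  fix vs x
  have D': "(B has_derivative (\<lambda>h. \<beta> x * h)) (at x)" for x
    using D[of x] by (simp add: has_field_derivative_def)
  show "foldr dir_deriv vs B differentiable (at x)"
  \<comment> \<open>\<open>foldr\<close> applies the last direction first, so splitting off the last
    entry exposes one derivative of \<open>B\<close>. The term with factor 0 only brings it into the
    form of \<open>smooth_linear_combination\<close>.\<close>
  proof (cases vs rule: rev_cases)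
    case Nil
    then show ?thesis using D' by (auto intro: differentiableI)
  next
    case (snoc ws w)
    have "dir_deriv w B = (\<lambda>x. w * \<beta> x - 0 * \<beta> x)"
      using frechet_derivative_at[OF D', symmetric] by (simp add: dir_deriv_def fun_eq_iff)
    then have "foldr dir_deriv vs B = foldr dir_deriv ws (\<lambda>x. w * \<beta> x - 0 * \<beta> x)" using snoc by simp
    then show ?thesis
      using smooth_linear_combination[OF assms(1) assms(1), of w 0] unfolding smooth_def by metis
  qed
qed

lemma smooth_imp_continuous:
  assumes "smooth f" shows "continuous_on UNIV f"
proof -
  have "foldr dir_deriv [] f differentiable (at x)" for x
    using assms unfolding smooth_def by blast
  then show ?thesis
    by (intro continuous_at_imp_continuous_on ballI differentiable_imp_continuous_within) simp
qed

text \<open>The dyadic sum of the cutoff along an axis is 1, so the cutoff is nonzero at some point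
  of that axis. Its restriction to the line, normalised and integrated, is the step.\<close>

lemma smooth_step_exists:
  assumes \<phi>: "dyadic_cutoff \<phi>"
  obtains B \<beta> :: "real \<Rightarrow> real" where "smooth B" "continuous_on UNIV \<beta>" "\<And>x. (B has_real_derivative \<beta> x) (at x)"
    "\<And>x. 0 \<le> \<beta> x" "\<And>x. \<bar>x\<bar> \<ge> 1 \<Longrightarrow> \<beta> x = 0" "\<And>x. x \<le> - 1 \<Longrightarrow> B x = 0" "\<And>x. x \<ge> 1 \<Longrightarrow> B x = 1"
    "\<And>x. 0 \<le> B x" "\<And>x. B x \<le> 1"
proof -
  let ?e = "axis 1 1 :: real^3"
  have "((\<lambda>j::int. \<phi> ((2 powi (- j)) *\<^sub>R ?e)) has_sum 1) UNIV"
    using \<phi> by (simp add: dyadic_cutoff_def axis_eq_0_iff)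
  moreover have "((\<lambda>j::int. 0::real) has_sum 0) UNIV" by simp
  ultimately have "(\<lambda>j::int. \<phi> ((2 powi (- j)) *\<^sub>R ?e)) \<noteq> (\<lambda>j. 0)"
  proof (intro notI)
    assume a: "((\<lambda>j::int. \<phi> ((2 powi (- j)) *\<^sub>R ?e)) has_sum 1) UNIV" and z: "((\<lambda>j::int. 0::real) has_sum 0) UNIV"
      and eq: "(\<lambda>j::int. \<phi> ((2 powi (- j)) *\<^sub>R ?e)) = (\<lambda>j. 0)"
    from has_sum_unique[OF a[unfolded eq] z] show False by simp
  qed
  then obtain j :: int where j: "\<phi> ((2 powi (- j)) *\<^sub>R ?e) \<noteq> 0" by blast
  define \<xi> where "\<xi> = (2 powi (- j)) *\<^sub>R ?e"
  have supp: "norm \<eta> < 2" if "\<phi> \<eta> \<noteq> 0" for \<eta>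
  proof -
    have "\<eta> \<in> closure {\<xi>. \<phi> \<xi> \<noteq> 0}"
      by (rule subsetD[OF closure_subset]) (use that in simp)
    then show ?thesis using \<phi> by (auto simp: dyadic_cutoff_def)
  qed
  \<comment> \<open>The base point and all points of the support have norm below 2, so speed 4 along
    the axis confines the bump to |x| < 1.\<close>
  define \<gamma> where "\<gamma> x = \<phi> (\<xi> + x *\<^sub>R (4 *\<^sub>R ?e))" for x
  have "smooth \<phi>" using \<phi> by (simp add: dyadic_cutoff_def)
  from smooth_affine[OF this bounded_linear_scaleR_left, of \<xi> "4 *\<^sub>R ?e"]
  have sm: "smooth \<gamma>" unfolding \<gamma>_def .
  have c: "continuous_on UNIV \<gamma>" by (rule smooth_imp_continuous[OF sm])
  have pos: "0 \<le> \<gamma> x" for x using \<phi> by (simp add: \<gamma>_def dyadic_cutoff_def)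
  have zero: "\<gamma> x = 0" if "\<bar>x\<bar> \<ge> 1" for x
  proof (rule ccontr)
    assume "\<gamma> x \<noteq> 0"
    then have "norm (\<xi> + x *\<^sub>R (4 *\<^sub>R ?e)) < 2" unfolding \<gamma>_def by (rule supp)
    moreover have "norm \<xi> < 2" unfolding \<xi>_def by (rule supp[OF j])
    moreover have "norm (x *\<^sub>R (4 *\<^sub>R ?e)) \<le> norm (\<xi> + x *\<^sub>R (4 *\<^sub>R ?e)) + norm \<xi>"
      by (metis add_diff_cancel_left' norm_triangle_ineq4)
    moreover have "norm (x *\<^sub>R (4 *\<^sub>R ?e)) = 4 * \<bar>x\<bar>" by simp
    ultimately show False using that by simp
  qed
  define I where "I = integral {-1..1} \<gamma>"
  have int: "\<gamma> integrable_on {a..b}" for a b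
    by (rule integrable_continuous_interval[OF continuous_on_subset[OF c]]) simp
  have "I > 0"
  proof -
    have "I \<noteq> 0"
    proof
      assume "I = 0"
      then have "(\<gamma> has_integral 0) (cbox (-1) 1)" using integrable_integral[OF int, of "-1" 1] by (simp add: I_def)
      then have "\<gamma> 0 = 0"
        by (rule has_integral_0_cbox_imp_0[rotated 2]) (auto intro: continuous_on_subset[OF c] pos)
      then show False using j by (simp add: \<gamma>_def \<xi>_def)
    qed
    moreover have "I \<ge> 0" unfolding I_def by (rule integral_nonneg[OF int]) (rule pos)
    ultimately show ?thesis by simp
  qed
  define \<beta> where "\<beta> x = (1 / I) * \<gamma> x - 0 * \<gamma> x" for x
  \<comment> \<open>The lower limit -2 lies where the bump vanishes, so every x >= -1 is interior to
    [-2, x + 1] and the fundamental theorem gives a two-sided derivative.\<close>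
  define B where "B x = (1 / I) * integral {-2..x} \<gamma>" for x
  have sm\<beta>: "smooth \<beta>" unfolding \<beta>_def by (rule smooth_linear_combination[OF sm sm])
  have B0: "B x = 0" if "x \<le> -1" for x
  proof -
    have "integral {-2..x} \<gamma> = integral {-2..x} (\<lambda>_. 0)"
      by (rule Henstock_Kurzweil_Integration.integral_cong) (use that zero in auto)
    then show ?thesis by (simp add: B_def)
  qed
  have B1: "B x = 1" if "x \<ge> 1" for x
  proof -
    have "integral {-2..x} \<gamma> = integral {-2..-1} \<gamma> + integral {-1..x} \<gamma>"
      by (rule Henstock_Kurzweil_Integration.integral_combine[symmetric]) (use that int in auto)
    also have "integral {-2..-1} \<gamma> = 0" using B0[of "-1"] \<open>I > 0\<close> by (simp add: B_def)
    also have "integral {-1..x} \<gamma> = I + integral {1..x} \<gamma>"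
      unfolding I_def by (rule Henstock_Kurzweil_Integration.integral_combine[symmetric]) (use that int in auto)
    also have "integral {1..x} \<gamma> = integral {1..x} (\<lambda>_. 0)"
      by (rule Henstock_Kurzweil_Integration.integral_cong) (use zero in auto)
    finally show ?thesis using \<open>I > 0\<close> by (simp add: B_def)
  qed
  have DB: "(B has_real_derivative \<beta> x) (at x)" for x
  proof (cases "x < -1")
    case True
    have "((\<lambda>_. 0) has_real_derivative 0) (at x)" by simp
    then have "(B has_real_derivative 0) (at x)"
      by (rule DERIV_cong_ev[THEN iffD2, rotated -1, OF _ refl _ refl])
        (use True B0 in \<open>auto intro!: eventually_nhds_in_open[of "{..<-1}", THEN eventually_mono]\<close>)
    then show ?thesis using zero[of x] True by (simp add: \<beta>_def)
  next
    case False
    have "((\<lambda>x. integral {-2..x} \<gamma>) has_real_derivative \<gamma> x) (at x within {-2..x + 1})"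
      by (rule integral_has_real_derivative) (use False in \<open>auto intro: continuous_on_subset[OF c]\<close>)
    then have "((\<lambda>x. integral {-2..x} \<gamma>) has_real_derivative \<gamma> x) (at x)"
      using False by (subst (asm) at_within_interior) auto
    then have "(B has_real_derivative (1 / I) * \<gamma> x) (at x)"
      unfolding B_def by (rule DERIV_cmult)
    then show ?thesis by (simp add: \<beta>_def)
  qed
  have mono: "B x \<le> B y" if "x \<le> y" for x y
  proof (rule DERIV_nonneg_imp_nondecreasing[OF that])
    fix z
    have "0 \<le> \<beta> z" using pos \<open>I > 0\<close> by (simp add: \<beta>_def)
    then show "\<exists>d. (B has_real_derivative d) (at z) \<and> 0 \<le> d" using DB by blast
  qed
  show ?thesis
  proof
    show "smooth B" by (rule smooth_antiderivative[OF sm\<beta> DB])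
    show "continuous_on UNIV \<beta>" by (rule smooth_imp_continuous[OF sm\<beta>])
    show "0 \<le> \<beta> x" for x using pos \<open>I > 0\<close> by (simp add: \<beta>_def)
    show "\<beta> x = 0" if "\<bar>x\<bar> \<ge> 1" for x using zero[OF that] by (simp add: \<beta>_def)
    show "0 \<le> B x" for x using mono[of "min x (-1)" x] B0[of "min x (-1)"] by simp
    show "B x \<le> 1" for x using mono[of x "max x 1"] B1[of "max x 1"] by simp
  qed (fact DB B0 B1)+
qed

section \<open>Absolutely continuous functions of time\<close>

lemma lebesgue_on_subset:
  fixes f :: "'a::euclidean_space \<Rightarrow> 'b::{banach,second_countable_topology}"
  assumes A: "A \<in> sets lebesgue" and B: "B \<in> sets lebesgue" and AB: "A \<subseteq> B"
  shows "(LINT r|lebesgue_on B. indicator A r *\<^sub>R f r) = (LINT r|lebesgue_on A. f r)"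
    and "integrable (lebesgue_on B) f \<Longrightarrow> integrable (lebesgue_on A) f"
    and "integrable (lebesgue_on B) (\<lambda>r. indicator A r *\<^sub>R f r) \<longleftrightarrow> integrable (lebesgue_on A) f"
proof -
  have eq: "indicator B r *\<^sub>R indicator A r *\<^sub>R f r = indicator A r *\<^sub>R f r" for r
    using AB by (auto simp: indicator_def)
  have eq': "(indicator B r * indicator A r) *\<^sub>R f r = indicator A r *\<^sub>R f r" for r
    using AB by (auto simp: indicator_def)
  show "(LINT r|lebesgue_on B. indicator A r *\<^sub>R f r) = (LINT r|lebesgue_on A. f r)"
    using A B by (simp add: integral_restrict_space eq')
  show iff: "integrable (lebesgue_on B) (\<lambda>r. indicator A r *\<^sub>R f r) \<longleftrightarrow> integrable (lebesgue_on A) f"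
    using A B by (simp add: integrable_restrict_space eq' set_integrable_def)
  assume f: "integrable (lebesgue_on B) f"
  have "A \<in> sets (lebesgue_on B)" using A B AB by (simp add: sets_restrict_space_iff)
  then show "integrable (lebesgue_on A) f"
    using integrable_mult_indicator[OF _ f, of A] iff by simp
qed

lemma AE_lebesgue_on_subset:
  assumes "A \<in> sets lebesgue" "B \<in> sets lebesgue" "A \<subseteq> B" "AE x in lebesgue_on B. P x"
  shows "AE x in lebesgue_on A. P x"
  using assms by (auto simp: AE_restrict_space_iff elim!: eventually_mono)

lemma interval_lebesgue [simp]:
  fixes a b :: real
  shows "{a<..<b} \<in> sets lebesgue" "{a..<b} \<in> sets lebesgue" "{a..b} \<in> sets lebesgue" "{a<..b} \<in> sets lebesgue"
  by (auto intro!: sets_completionI_sets)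

text \<open>The kernels k \<open>\<beta>\<close>(k (r - s)) with k = n + K form an approximate
  identity at s. The conditions on 1/K keep their supports in [s/2, (s + b)/2], where
  \<open>g\<close> is bounded, already from n = 0. The argument is written as constant plus linear
  term to match \<open>smooth_affine\<close>.\<close>

lemma mollifier_limit:
  fixes g \<beta> B :: "real \<Rightarrow> real"
  assumes g: "continuous_on {0..<b} g" and s: "0 < s" "s < b"
    and B: "\<And>x. (B has_real_derivative \<beta> x) (at x)" "B (- 1) = 0" "B 1 = 1"
    and \<beta>: "continuous_on UNIV \<beta>" "\<And>x. 0 \<le> \<beta> x" "\<And>x. \<bar>x\<bar> \<ge> 1 \<Longrightarrow> \<beta> x = 0"
    and K: "K > 0" "1 / K \<le> s / 2" "1 / K \<le> (b - s) / 2"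
  shows "integrable (lebesgue_on {0<..<b}) (\<lambda>r. g r * (\<beta> (- s * (real n + K) + r * (real n + K)) * (real n + K)))"
    and "(\<lambda>n. LINT r|lebesgue_on {0<..<b}. g r * (\<beta> (- s * (real n + K) + r * (real n + K)) * (real n + K))) \<longlonglongrightarrow> g s"
proof -
  define k where "k n = real n + K" for n :: nat
  have k: "k n > 0" "1 / k n \<le> 1 / K" for n using K by (auto simp: k_def frac_le)
  define F where "F n r = indicator {0<..<b} r * (g r * (\<beta> (- s * k n + r * k n) * k n))" for n r
  have g0: "continuous_on {0<..<b} g" by (rule continuous_on_subset[OF g]) auto
  have gi: "(\<lambda>r. indicator {0<..<b} r *\<^sub>R g r) \<in> borel_measurable borel"
    by (rule borel_measurable_continuous_on_indicator[OF _ g0]) simp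
  have [measurable]: "\<beta> \<in> borel_measurable borel" by (rule borel_measurable_continuous_onI[OF \<beta>(1)])
  have F_eq: "F n = (\<lambda>r. (indicator {0<..<b} r *\<^sub>R g r) * (\<beta> (- s * k n + r * k n) * k n))" for n
    by (simp add: F_def fun_eq_iff)
  have Fm [measurable]: "F n \<in> borel_measurable borel" for n
    unfolding F_eq using gi by measurable
  have conv: "(LINT r|lebesgue_on {0<..<b}. g r * (\<beta> (- s * k n + r * k n) * k n)) = (LINT r|lborel. F n r)" for n
    using integral_completion[of "F n" lborel] Fm
    by (simp add: integral_restrict_space F_def[abs_def])
  \<comment> \<open>The integrand after the substitution r = s + x / k n.\<close>
  define G where "G n x = indicator {0<..<b} (s + x / k n) * (g (s + x / k n) * \<beta> x)" for n x
  have FG: "F n (s + (1 / k n) * x) = k n * G n x" for n x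
    using k(1)[of n] by (simp add: F_def G_def field_simps)
  have subst: "(LINT r|lborel. F n r) = (LINT x|lborel. G n x)" for n
    using k(1)[of n] lborel_integral_real_affine[of "1 / k n" "F n" s] unfolding FG by simp
  have J: "s + x / k n \<in> {s / 2..(s + b) / 2}" if "\<bar>x\<bar> < 1" for n x
  proof -
    have "\<bar>x / k n\<bar> \<le> 1 / k n" using that k(1)[of n] by (simp add: field_simps)
    then have "\<bar>x / k n\<bar> \<le> s / 2" "\<bar>x / k n\<bar> \<le> (b - s) / 2" using k(2)[of n] K by linarith+
    then have "- (s / 2) \<le> x / k n" "x / k n \<le> (b - s) / 2" by linarith+
    moreover have "s + (b - s) / 2 = (s + b) / 2" by (simp add: field_simps)
    ultimately have "s / 2 \<le> s + x / k n" "s + x / k n \<le> (s + b) / 2" by linarith+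
    then show ?thesis by simp
  qed
  have "compact (g ` {s / 2..(s + b) / 2})"
    by (intro compact_continuous_image continuous_on_subset[OF g]) (use s in auto)
  then obtain C where C: "C > 0" "\<And>r. r \<in> {s / 2..(s + b) / 2} \<Longrightarrow> \<bar>g r\<bar> \<le> C"
    using compact_imp_bounded bounded_pos by (metis image_eqI real_norm_def)
  have Gb: "\<bar>G n x\<bar> \<le> C * \<beta> x" for n x
  proof (cases "\<bar>x\<bar> < 1")
    case True
    have "\<bar>g (s + x / k n) * \<beta> x\<bar> \<le> C * \<beta> x"
      using C(2)[OF J[OF True]] \<beta>(2)[of x] by (simp add: abs_mult mult_right_mono)
    then show ?thesis by (auto simp: G_def indicator_def intro: mult_nonneg_nonneg less_imp_le[OF C(1)] \<beta>(2))
  next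
    case False
    then show ?thesis using \<beta>(3)[of x] by (simp add: G_def)
  qed
  have ind\<beta>: "indicator {-1..1} x *\<^sub>R \<beta> x = \<beta> x" for x
    using \<beta>(3)[of x] by (cases "\<bar>x\<bar> \<ge> 1") (auto simp: indicator_def)
  have \<beta>i: "integrable lborel \<beta>"
    using borel_integrable_compact[OF compact_Icc continuous_on_subset[OF \<beta>(1) subset_UNIV], of "-1" 1]
    unfolding ind\<beta> .
  have \<beta>1: "(LINT x|lborel. \<beta> x) = 1"
  proof -
    have "(LINT x|lborel. indicator {-1..1} x *\<^sub>R \<beta> x) = B 1 - B (- 1)"
      by (rule integral_FTC_atLeastAtMost)
        (auto simp: has_real_derivative_iff_has_vector_derivative[symmetric]
          intro!: has_field_derivative_at_within B(1) continuous_on_subset[OF \<beta>(1)])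
    then show ?thesis unfolding ind\<beta> using B by simp
  qed
  have Gm [measurable]: "G n \<in> borel_measurable borel" for n
  proof -
    have "G n x = F n (s + (1 / k n) * x) / k n" for x unfolding FG using k(1)[of n] by simp
    then have "G n = (\<lambda>x. F n (s + (1 / k n) * x) / k n)" by (rule ext)
    then show ?thesis by simp
  qed
  have Gi: "integrable lborel (G n)" for n
    by (rule Bochner_Integration.integrable_bound[of _ "\<lambda>x. C * \<beta> x"])
      (use \<beta>i Gb in \<open>auto intro: order_trans[OF _ abs_ge_self]\<close>)
  have "integrable lborel (F n)"
    using k(1)[of n] Gi[of n] lborel_integrable_real_affine_iff[of "1 / k n" "F n" s] unfolding FG by simp
  then have "integrable lebesgue (F n)" using integrable_completion[of "F n" lborel] Fm by simp
  then show "integrable (lebesgue_on {0<..<b}) (\<lambda>r. g r * (\<beta> (- s * (real n + K) + r * (real n + K)) * (real n + K)))"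
    by (simp add: integrable_restrict_space set_integrable_def F_def[abs_def] k_def)
  have "(\<lambda>n. LINT x|lborel. G n x) \<longlonglongrightarrow> (LINT x|lborel. g s * \<beta> x)"
  proof (rule integral_dominated_convergence[where w="\<lambda>x. C * \<beta> x"])
    show "AE x in lborel. (\<lambda>n. G n x) \<longlonglongrightarrow> g s * \<beta> x"
    proof (rule AE_I2)
      fix x
      show "(\<lambda>n. G n x) \<longlonglongrightarrow> g s * \<beta> x"
      proof (cases "\<bar>x\<bar> < 1")
        case True
        have "filterlim k at_top sequentially"
          unfolding k_def by (rule filterlim_tendsto_add_at_top[of "\<lambda>_. K", unfolded add.commute[of K]])
            (auto intro: filterlim_real_sequentially)
        then have "(\<lambda>n. x / k n) \<longlonglongrightarrow> 0"
          by (intro tendsto_divide_0[OF tendsto_const] filterlim_at_top_imp_at_infinity)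
        then have "(\<lambda>n. s + x / k n) \<longlonglongrightarrow> s + 0" by (intro tendsto_intros)
        moreover have "isCont g s"
          using g0 s by (simp add: continuous_on_eq_continuous_at)
        ultimately have "(\<lambda>n. g (s + x / k n)) \<longlonglongrightarrow> g s"
          using isCont_tendsto_compose[of s g "\<lambda>n. s + x / k n"] by simp
        then have "(\<lambda>n. g (s + x / k n) * \<beta> x) \<longlonglongrightarrow> g s * \<beta> x" by (intro tendsto_intros)
        moreover have "G n x = g (s + x / k n) * \<beta> x" for n
        proof -
          have "s / 2 \<le> s + x / k n" "s + x / k n \<le> (s + b) / 2" using J[OF True, of n] by auto
          moreover have "0 < s / 2" "(s + b) / 2 < b" using s by auto
          ultimately have "s + x / k n \<in> {0<..<b}" by (simp only: greaterThanLessThan_iff) linarith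
          then show ?thesis by (simp add: G_def)
        qed
        ultimately show ?thesis by simp
      next
        case False
        then show ?thesis using \<beta>(3)[of x] by (simp add: G_def)
      qed
    qed
    show "AE x in lborel. norm (G n x) \<le> C * \<beta> x" for n using Gb by simp
  qed (use \<beta>i in auto)
  then show "(\<lambda>n. LINT r|lebesgue_on {0<..<b}. g r * (\<beta> (- s * (real n + K) + r * (real n + K)) * (real n + K))) \<longlonglongrightarrow> g s"
    using conv subst \<beta>1 by (simp add: k_def)
qed

text \<open>The test function is a smoothed indicator of (s, t), a difference of two steps. Its
  derivative is a difference of two approximate identities, so the defining identity tends to g s -
  g t on one side and to minus the integral of \<open>h\<close> over (s, t) on the other. Test
  functions vanish near 0, so s = 0 is reached only afterwards, by continuity of
  \<open>g\<close>.\<close>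

lemma distr_deriv_FTC:
  fixes a g h :: "real \<Rightarrow> real"
  assumes \<phi>: "dyadic_cutoff \<phi>"
    and d: "is_distr_deriv b a h" and h: "integrable (lebesgue_on {0<..<b}) h"
    and g: "continuous_on {0..<b} g" and ae: "AE t in lebesgue_on {0..<b}. g t = a t"
    and t: "0 \<le> t" "t < b"
  shows "g t = g 0 + (LINT r|lebesgue_on {0<..<t}. h r)"
proof (cases "t = 0")
  case True
  then show ?thesis by (simp add: integral_restrict_space)
next
  case False
  then have t0: "0 < t" using t by simp
  let ?M = "lebesgue_on {0<..<b}"
  obtain B \<beta> where smB: "smooth B" and c\<beta>: "continuous_on UNIV \<beta>"
    and B: "\<And>x. (B has_real_derivative \<beta> x) (at x)" and \<beta>': "\<And>x. 0 \<le> \<beta> x" "\<And>x. \<bar>x\<bar> \<ge> 1 \<Longrightarrow> \<beta> x = 0"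
    and B0: "\<And>x. x \<le> - 1 \<Longrightarrow> B x = 0" and B1: "\<And>x. x \<ge> 1 \<Longrightarrow> B x = 1"
    and B01: "\<And>x. 0 \<le> B x" "\<And>x. B x \<le> 1"
    by (rule smooth_step_exists[OF \<phi>]) (rule that)
  note \<beta> = c\<beta> \<beta>'
  have ae': "AE r in ?M. g r = a r" by (rule AE_lebesgue_on_subset[OF _ _ _ ae]) auto
  have gm: "g \<in> borel_measurable ?M"
    by (rule continuous_imp_measurable_on_sets_lebesgue[OF continuous_on_subset[OF g]]) auto
  have am: "a \<in> borel_measurable ?M" by (rule measurable_AE_lebesgue_on[OF _ gm ae']) simp
  have inner: "g s - g t = - (LINT r|?M. h r * indicator {s<..<t} r)" if s: "0 < s" "s < t" for s
  proof -
    \<comment> \<open>\<open>c\<close> bounds the width of the transition layers; being at most half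
      the distance of s and t from 0 and b, it keeps the support of the test functions in (0,
      b).\<close>
    define c where "c = min (min (s / 2) ((b - s) / 2)) (min (t / 2) ((b - t) / 2))"
    have c: "c > 0" "c \<le> s / 2" "c \<le> (b - s) / 2" "c \<le> t / 2" "c \<le> (b - t) / 2"
      using s t unfolding c_def by simp (simp_all only: min_le_iff_disj order_refl simp_thms)
    define K where "K = 1 / c"
    have K: "K > 0" "1 / K = c" using c by (auto simp: K_def)
    define k where "k n = real n + K" for n :: nat
    have k: "k n > 0" "1 / k n \<le> c" for n
      using K frac_le[of 1 1 K "k n"] by (auto simp: k_def)
    have kt: "filterlim k at_top sequentially"
      unfolding k_def by (rule filterlim_tendsto_add_at_top[of "\<lambda>_. K", unfolded add.commute[of K]])
        (auto intro: filterlim_real_sequentially)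
    define \<theta> where "\<theta> n r = 1 * B (- s * k n + r * k n) - 1 * B (- t * k n + r * k n)" for n r
    have D\<theta>: "(\<theta> n has_real_derivative \<beta> (- s * k n + r * k n) * k n - \<beta> (- t * k n + r * k n) * k n) (at r)" for n r
    proof -
      have "((\<lambda>r. B (- x * k n + r * k n)) has_real_derivative \<beta> (- x * k n + r * k n) * k n) (at r)" for x
        by (rule DERIV_chain2[OF B]) (auto intro!: derivative_eq_intros)
      from DERIV_diff[OF this[of s] this[of t]] show ?thesis unfolding \<theta>_def by simp
    qed
    have deriv\<theta>: "deriv (\<theta> n) r = \<beta> (- s * k n + r * k n) * k n - \<beta> (- t * k n + r * k n) * k n" for n r
      by (rule DERIV_imp_deriv[OF D\<theta>])
    have sm\<theta>: "smooth (\<theta> n)" for n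
      unfolding \<theta>_def by (intro smooth_linear_combination smooth_affine[OF smB bounded_linear_mult_left])
    have supp: "closure {r. \<theta> n r \<noteq> 0} \<subseteq> {0<..<b}" for n
    proof -
      have "{r. \<theta> n r \<noteq> 0} \<subseteq> {s - c..t + c}"
      proof
        fix r assume "r \<in> {r. \<theta> n r \<noteq> 0}"
        then have nz: "\<theta> n r \<noteq> 0" by simp
        have ck: "1 \<le> c * k n" using k[of n] by (simp add: field_simps)
        have "s - c \<le> r"
        proof (rule ccontr)
          assume "\<not> s - c \<le> r"
          then have "(s - r) * k n \<ge> c * k n" "(t - r) * k n \<ge> c * k n"
            using s k(1)[of n] by (auto intro!: mult_right_mono)
          then have "- s * k n + r * k n \<le> - 1" "- t * k n + r * k n \<le> - 1"
            using ck by (auto simp: algebra_simps)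
          then show False using nz by (simp add: \<theta>_def B0)
        qed
        moreover have "r \<le> t + c"
        proof (rule ccontr)
          assume "\<not> r \<le> t + c"
          then have "(r - s) * k n \<ge> c * k n" "(r - t) * k n \<ge> c * k n"
            using s k(1)[of n] by (auto intro!: mult_right_mono)
          then have "- s * k n + r * k n \<ge> 1" "- t * k n + r * k n \<ge> 1"
            using ck by (auto simp: algebra_simps)
          then show False using nz by (simp add: \<theta>_def B1)
        qed
        ultimately show "r \<in> {s - c..t + c}" by simp
      qed
      then have "closure {r. \<theta> n r \<noteq> 0} \<subseteq> {s - c..t + c}" by (rule closure_minimal) simp
      also have "\<dots> \<subseteq> {0<..<b}" using c s t by auto
      finally show ?thesis .
    qed
    have eq: "(LINT r|?M. a r * deriv (\<theta> n) r) = - (LINT r|?M. h r * \<theta> n r)" for n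
      using d[unfolded is_distr_deriv_def, rule_format, OF conjI[OF sm\<theta> supp]] .
    have ms: "1 / K \<le> s / 2" "1 / K \<le> (b - s) / 2" and mt: "1 / K \<le> t / 2" "1 / K \<le> (b - t) / 2"
      using c K by auto
    have sb: "s < b" using s t by simp
    note Ls = mollifier_limit[where g=g and b=b and s=s and B=B and \<beta>=\<beta> and K=K, OF g s(1) sb B B0[OF order_refl] B1[OF order_refl] \<beta> K(1) ms, folded k_def]
    note Lt = mollifier_limit[where g=g and b=b and s=t and B=B and \<beta>=\<beta> and K=K, OF g t0 t(2) B B0[OF order_refl] B1[OF order_refl] \<beta> K(1) mt, folded k_def]
    have [measurable]: "deriv (\<theta> n) \<in> borel_measurable ?M" for n
    proof -
      have deq: "deriv (\<theta> n) = (\<lambda>r. \<beta> (- s * k n + r * k n) * k n - \<beta> (- t * k n + r * k n) * k n)"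
        by (rule ext) (rule deriv\<theta>)
      have c1: "continuous_on UNIV (\<lambda>r. \<beta> (- x * k n + r * k n) * k n)" for x
      proof (rule continuous_on_mult[OF _ continuous_on_const])
        have "continuous_on UNIV (\<lambda>r. - x * k n + r * k n)" by (intro continuous_intros)
        then show "continuous_on UNIV (\<lambda>r. \<beta> (- x * k n + r * k n))"
          by (rule continuous_on_compose2[OF \<beta>(1)]) simp
      qed
      have "continuous_on UNIV (deriv (\<theta> n))"
        unfolding deq by (intro continuous_on_diff c1)
      from continuous_imp_measurable_on_sets_lebesgue[OF continuous_on_subset[OF this subset_UNIV] interval_lebesgue(1)]
      show ?thesis .
    qed
    have lhs: "(LINT r|?M. a r * deriv (\<theta> n) r)
       = (LINT r|?M. g r * (\<beta> (- s * k n + r * k n) * k n)) - (LINT r|?M. g r * (\<beta> (- t * k n + r * k n) * k n))" for n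
    proof -
      have "(LINT r|?M. a r * deriv (\<theta> n) r) = (LINT r|?M. g r * deriv (\<theta> n) r)"
        by (rule integral_cong_AE) (use ae' am gm in auto)
      also have "\<dots> = (LINT r|?M. g r * (\<beta> (- s * k n + r * k n) * k n) - g r * (\<beta> (- t * k n + r * k n) * k n))"
        unfolding deriv\<theta> by (simp only: right_diff_distrib)
      also have "\<dots> = (LINT r|?M. g r * (\<beta> (- s * k n + r * k n) * k n)) - (LINT r|?M. g r * (\<beta> (- t * k n + r * k n) * k n))"
        by (rule Bochner_Integration.integral_diff[OF Ls(1) Lt(1)])
      finally show ?thesis .
    qed
    have "(\<lambda>n. LINT r|?M. a r * deriv (\<theta> n) r) \<longlonglongrightarrow> g s - g t"
      unfolding lhs by (rule tendsto_diff[OF Ls(2) Lt(2)])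
    moreover have "(\<lambda>n. LINT r|?M. h r * \<theta> n r) \<longlonglongrightarrow> (LINT r|?M. h r * indicator {s<..<t} r)"
    proof (rule integral_dominated_convergence[where w="\<lambda>r. \<bar>h r\<bar>"])
      have c\<theta>: "continuous_on UNIV (\<theta> n)" for n by (rule smooth_imp_continuous[OF sm\<theta>])
      have [measurable]: "\<theta> n \<in> borel_measurable ?M" for n
        by (rule continuous_imp_measurable_on_sets_lebesgue[OF continuous_on_subset[OF c\<theta>]]) auto
      have [measurable]: "(indicator {s<..<t} :: real \<Rightarrow> real) \<in> borel_measurable ?M"
        by (intro measurable_restrict_space1 measurable_completion) simp
      show "(\<lambda>r. h r * indicator {s<..<t} r) \<in> borel_measurable ?M" "(\<lambda>r. h r * \<theta> n r) \<in> borel_measurable ?M" for n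
        using h by auto
      have "\<bar>\<theta> n r\<bar> \<le> 1" for n r
        using B01[of "- s * k n + r * k n"] B01[of "- t * k n + r * k n"] by (simp add: \<theta>_def abs_le_iff)
      then show "AE r in ?M. norm (h r * \<theta> n r) \<le> \<bar>h r\<bar>" for n
        by (simp add: abs_mult mult_left_le)
      have low: "\<forall>\<^sub>F n in sequentially. B (- x * k n + r * k n) = 0" if "r < x" for x r
      proof -
        have "filterlim (\<lambda>n. k n * (x - r)) at_top sequentially"
          by (rule filterlim_at_top_mult_tendsto_pos[OF tendsto_const _ kt]) (use that in simp)
        then have "\<forall>\<^sub>F n in sequentially. 1 \<le> k n * (x - r)" by (simp add: filterlim_at_top)
        then show ?thesis by eventually_elim (rule B0, simp add: algebra_simps)
      qed
      have high: "\<forall>\<^sub>F n in sequentially. B (- x * k n + r * k n) = 1" if "x < r" for x r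
      proof -
        have "filterlim (\<lambda>n. k n * (r - x)) at_top sequentially"
          by (rule filterlim_at_top_mult_tendsto_pos[OF tendsto_const _ kt]) (use that in simp)
        then have "\<forall>\<^sub>F n in sequentially. 1 \<le> k n * (r - x)" by (simp add: filterlim_at_top)
        then show ?thesis by eventually_elim (rule B1, simp add: algebra_simps)
      qed
      have lim: "(\<lambda>n. \<theta> n r) \<longlonglongrightarrow> indicator {s<..<t} r" if rs: "r \<noteq> s" "r \<noteq> t" for r
      proof -
        consider "r < s" | "s < r" "r < t" | "t < r" using rs by linarith
        then have "\<forall>\<^sub>F n in sequentially. \<theta> n r = indicator {s<..<t} r"
        proof cases
          case 1
          then have "r < t" using s by simp
          from low[OF 1] low[OF this] show ?thesis by eventually_elim (use 1 in \<open>simp add: \<theta>_def\<close>)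
        next
          case 2
          from high[OF 2(1)] low[OF 2(2)] show ?thesis by eventually_elim (use 2 in \<open>simp add: \<theta>_def\<close>)
        next
          case 3
          then have "s < r" using s by simp
          from high[OF 3] high[OF this] show ?thesis by eventually_elim (use 3 in \<open>simp add: \<theta>_def\<close>)
        qed
        then show ?thesis by (rule tendsto_eventually)
      qed
      have "AE r in lebesgue. r \<noteq> s \<and> r \<noteq> t"
        by (simp add: AE_completion_iff AE_lborel_singleton)
      then have "AE r in lebesgue. r \<in> {0<..<b} \<longrightarrow> (\<lambda>n. h r * \<theta> n r) \<longlonglongrightarrow> h r * indicator {s<..<t} r"
        by (rule eventually_mono) (intro impI tendsto_mult tendsto_const lim, simp_all)
      then show "AE r in ?M. (\<lambda>n. h r * \<theta> n r) \<longlonglongrightarrow> h r * indicator {s<..<t} r"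
        by (subst AE_restrict_space_iff) auto
    qed (use h in auto)
    then have "(\<lambda>n. LINT r|?M. a r * deriv (\<theta> n) r) \<longlonglongrightarrow> - (LINT r|?M. h r * indicator {s<..<t} r)"
      unfolding eq by (rule tendsto_minus)
    ultimately show ?thesis by (rule LIMSEQ_unique)
  qed
  \<comment> \<open>Any sequence in (0, t) that tends to 0 would do; here the left endpoint is
    removed.\<close>
  define s where "s n = t / (real n + 2)" for n :: nat
  have s: "0 < s n" "s n < t" for n using t0 by (auto simp: s_def field_simps add_pos_nonneg)
  have s0: "s \<longlonglongrightarrow> 0"
  proof -
    have "filterlim (\<lambda>n. real n + 2) at_top sequentially"
      by (rule filterlim_tendsto_add_at_top[of "\<lambda>_. 2", unfolded add.commute[of 2]]) (auto intro: filterlim_real_sequentially)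
    then show ?thesis
      unfolding s_def by (intro tendsto_divide_0[OF tendsto_const] filterlim_at_top_imp_at_infinity)
  qed
  have "(\<lambda>n. g (s n)) \<longlonglongrightarrow> g 0"
  proof (rule continuous_on_tendsto_compose[OF g s0])
    show "0 \<in> {0..<b}" using t by simp
    have "s n \<in> {0..<b}" for n using s(1)[of n] s(2)[of n] t by simp
    then show "\<forall>\<^sub>F n in sequentially. s n \<in> {0..<b}" by simp
  qed
  then have "(\<lambda>n. g (s n) - g t) \<longlonglongrightarrow> g 0 - g t" by (intro tendsto_intros)
  moreover have "(\<lambda>n. - (LINT r|?M. h r * indicator {s n<..<t} r)) \<longlonglongrightarrow> - (LINT r|?M. h r * indicator {0<..<t} r)"
  proof (intro tendsto_minus integral_dominated_convergence[where w="\<lambda>r. \<bar>h r\<bar>"])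
    have [measurable]: "(indicator {x<..<t} :: real \<Rightarrow> real) \<in> borel_measurable ?M" for x
      by (intro measurable_restrict_space1 measurable_completion) simp
    show "(\<lambda>r. h r * indicator {0<..<t} r) \<in> borel_measurable ?M" "(\<lambda>r. h r * indicator {s n<..<t} r) \<in> borel_measurable ?M" for n
      using h by auto
    show "AE r in ?M. (\<lambda>n. h r * indicator {s n<..<t} r) \<longlonglongrightarrow> h r * indicator {0<..<t} r"
    proof (rule AE_I2)
      fix r assume "r \<in> space ?M"
      then have "0 < r" by simp
      with s0 have "\<forall>\<^sub>F n in sequentially. s n < r" by (simp add: order_tendstoD(2))
      then have "\<forall>\<^sub>F n in sequentially. h r * indicator {s n<..<t} r = h r * indicator {0<..<t} r"
        by eventually_elim (use \<open>0 < r\<close> in \<open>auto simp: indicator_def\<close>)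
      then show "(\<lambda>n. h r * indicator {s n<..<t} r) \<longlonglongrightarrow> h r * indicator {0<..<t} r"
        by (rule tendsto_eventually)
    qed
  qed (use h in \<open>auto simp: indicator_def\<close>)
  ultimately have "g 0 - g t = - (LINT r|?M. h r * indicator {0<..<t} r)"
    unfolding inner[OF s] by (rule LIMSEQ_unique)
  moreover have "(LINT r|?M. h r * indicator {0<..<t} r) = (LINT r|lebesgue_on {0<..<t}. h r)"
  proof -
    have "{0<..<t} \<subseteq> {0<..<b}" using t by auto
    from lebesgue_on_subset(1)[OF _ _ this, of h] show ?thesis by (simp add: mult.commute)
  qed
  ultimately show ?thesis by simp
qed

lemma sigma_finite_lebesgue_on:
  fixes A :: "'a::euclidean_space set"
  shows "A \<in> sets lebesgue \<Longrightarrow> sigma_finite_measure (lebesgue_on A)"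
proof (rule sigma_finite_measure_restrict_space)
  obtain A :: "'a set set" where "countable A" "A \<subseteq> sets lborel" "\<Union>A = space lborel" "\<forall>a\<in>A. emeasure lborel a \<noteq> \<infinity>"
    using lborel.sigma_finite_countable by blast
  then show "sigma_finite_measure (lebesgue :: 'a measure)"
    unfolding sigma_finite_measure_def by (intro exI[of _ A]) (auto simp: subset_iff)
qed

text \<open>No differentiation almost everywhere is involved: the integral of h(r) h(s) over the
  triangle r < s equals that over the mirrored triangle, the diagonal is null, and both together
  give the square of the integral of \<open>h\<close>.\<close>

lemma square_FTC_real:
  fixes h :: "real \<Rightarrow> real" and c :: real
  assumes t: "0 \<le> t" and h: "integrable (lebesgue_on {0<..<t}) h"
  defines "H \<equiv> \<lambda>s. c + (LINT r|lebesgue_on {0<..<s}. h r)"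
  shows "(H t)\<^sup>2 = c\<^sup>2 + (LINT s|lebesgue_on {0<..<t}. 2 * H s * h s)"
    and "integrable (lebesgue_on {0<..<t}) (\<lambda>s. 2 * H s * h s)"
proof -
  let ?M = "lebesgue_on {0<..<t}"
  interpret M: sigma_finite_measure ?M by (rule sigma_finite_lebesgue_on) simp
  interpret P: pair_sigma_finite ?M ?M ..
  have [measurable]: "h \<in> borel_measurable ?M" using h by simp
  have [measurable]: "(\<lambda>x. x) \<in> borel_measurable ?M"
    by (intro measurable_restrict_space1 measurable_completion) simp
  have int: "integrable (?M \<Otimes>\<^sub>M ?M) (\<lambda>(r, s). h r * h s)"
    by (rule P.Fubini_integrable) (use h in \<open>auto simp: abs_mult\<close>)
  define q where "q r s = of_bool (r < s) * (h r * h s)" for r s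
  have qm [measurable]: "(\<lambda>(r, s). q r s) \<in> borel_measurable (?M \<Otimes>\<^sub>M ?M)"
    unfolding q_def by measurable
  have q: "integrable (?M \<Otimes>\<^sub>M ?M) (\<lambda>(r, s). q r s)"
    by (rule Bochner_Integration.integrable_bound[OF int qm]) (auto simp: q_def)
  define H0 where "H0 s = (LINT r|lebesgue_on {0<..<s}. h r)" for s
  have H0: "H0 s = (LINT r|?M. of_bool (r < s) * h r)" if "s \<in> {0<..<t}" for s
  proof -
    have "H0 s = (LINT r|?M. indicator {0<..<s} r *\<^sub>R h r)"
      unfolding H0_def by (rule lebesgue_on_subset(1)[symmetric]) (use that in auto)
    also have "\<dots> = (LINT r|?M. of_bool (r < s) * h r)"
      by (rule Bochner_Integration.integral_cong) (auto simp: indicator_def)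
    finally show ?thesis .
  qed
  have inner: "(LINT r|?M. q r s) = H0 s * h s" if "s \<in> {0<..<t}" for s
    unfolding H0[OF that] q_def by (simp add: mult.assoc[symmetric])
  have i1: "integrable ?M (\<lambda>s. H0 s * h s)"
    using P.integrable_snd[OF q] by (subst Bochner_Integration.integrable_cong[OF refl, of _ _ "\<lambda>s. LINT r|?M. q r s"]) (auto simp: inner)
  have A: "(LINT s|?M. H0 s * h s) = (LINT s|?M. LINT r|?M. q r s)"
    by (rule Bochner_Integration.integral_cong) (auto simp: inner)
  have swap: "(LINT s|?M. LINT r|?M. q r s) = (LINT s|?M. LINT r|?M. q s r)"
    by (rule P.Fubini_integral[OF q])
  have q': "integrable (?M \<Otimes>\<^sub>M ?M) (\<lambda>(r, s). q s r)"
    using P.integrable_product_swap[OF q] by (simp add: split_beta')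
  have "(LINT s|?M. LINT r|?M. q r s) + (LINT s|?M. LINT r|?M. q s r) = (LINT s|?M. (LINT r|?M. q r s) + (LINT r|?M. q s r))"
    by (rule Bochner_Integration.integral_add[OF P.integrable_snd[OF q] P.integrable_snd[OF q'], symmetric])
  also have "\<dots> = (LINT s|?M. LINT r|?M. h r * h s)"
  proof (rule integral_cong_AE)
    show "AE s in ?M. (LINT r|?M. q r s) + (LINT r|?M. q s r) = (LINT r|?M. h r * h s)"
      using P.AE_integrable_snd[OF q] P.AE_integrable_snd[OF q']
    proof eventually_elim
      case (elim s)
      then have "(LINT r|?M. q r s) + (LINT r|?M. q s r) = (LINT r|?M. q r s + q s r)"
        by (rule Bochner_Integration.integral_add[symmetric])
      also have "\<dots> = (LINT r|?M. h r * h s)"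
      proof (rule integral_cong_AE)
        have "AE r in lebesgue. r \<noteq> s" by (simp add: AE_completion_iff AE_lborel_singleton)
        then have "AE r in ?M. r \<noteq> s" by (subst AE_restrict_space_iff) (auto elim!: eventually_mono)
        then show "AE r in ?M. q r s + q s r = h r * h s"
          by eventually_elim (auto simp: q_def)
        show "(\<lambda>r. q r s + q s r) \<in> borel_measurable ?M" unfolding q_def by measurable
      qed measurable
      finally show ?case .
    qed
    show "(\<lambda>s. (LINT r|?M. q r s) + (LINT r|?M. q s r)) \<in> borel_measurable ?M"
      using P.integrable_snd[OF q] P.integrable_snd[OF q'] by simp
    show "(\<lambda>s. LINT r|?M. h r * h s) \<in> borel_measurable ?M"
      using P.integrable_snd[OF int] by simp
  qed
  also have "\<dots> = (H0 t)\<^sup>2" by (simp add: H0_def power2_eq_square)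
  finally have main: "2 * (LINT s|?M. H0 s * h s) = (H0 t)\<^sup>2" using swap A by simp
  have eq: "2 * H s * h s = 2 * c * h s + 2 * (H0 s * h s)" for s
    by (simp add: H_def H0_def algebra_simps)
  show "integrable ?M (\<lambda>s. 2 * H s * h s)" unfolding eq using h i1 by simp
  have "(LINT s|?M. 2 * H s * h s) = 2 * c * H0 t + (H0 t)\<^sup>2"
    unfolding eq using h i1 main by (simp add: H0_def)
  then show "(H t)\<^sup>2 = c\<^sup>2 + (LINT s|?M. 2 * H s * h s)"
    by (simp add: H_def H0_def power2_eq_square algebra_simps)
qed

text \<open>Real and imaginary parts separately. This is the balance of the squared modulus of one
  Fourier coefficient.\<close>

lemma square_FTC:
  fixes h :: "real \<Rightarrow> complex" and c :: complex
  assumes t: "0 \<le> t" and h: "integrable (lebesgue_on {0<..<t}) h"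
  defines "H \<equiv> \<lambda>s. c + (LINT r|lebesgue_on {0<..<s}. h r)"
  shows "(cmod (H t))\<^sup>2 = (cmod c)\<^sup>2 + (LINT s|lebesgue_on {0<..<t}. 2 * Re (cnj (H s) * h s))"
    and "integrable (lebesgue_on {0<..<t}) (\<lambda>s. 2 * Re (cnj (H s) * h s))"
proof -
  let ?M = "lebesgue_on {0<..<t}"
  have sub: "integrable (lebesgue_on {0<..<s}) h" if "s \<le> t" for s
    by (rule lebesgue_on_subset(2)[OF _ _ _ h]) (use that in auto)
  have Re: "Re (H s) = Re c + (LINT r|lebesgue_on {0<..<s}. Re (h r))"
    and Im: "Im (H s) = Im c + (LINT r|lebesgue_on {0<..<s}. Im (h r))" if "s \<le> t" for s
    using sub[OF that] by (simp_all add: H_def)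
  note R = square_FTC_real[OF t integrable_Re[OF h], of "Re c"]
  note I = square_FTC_real[OF t integrable_Im[OF h], of "Im c"]
  have eq: "2 * Re (cnj (H s) * h s) = 2 * (Re c + (LINT r|lebesgue_on {0<..<s}. Re (h r))) * Re (h s)
      + 2 * (Im c + (LINT r|lebesgue_on {0<..<s}. Im (h r))) * Im (h s)" if "s \<in> space ?M" for s
    using that by (simp add: Re[symmetric] Im[symmetric])
  show "integrable ?M (\<lambda>s. 2 * Re (cnj (H s) * h s))"
    by (subst Bochner_Integration.integrable_cong[OF refl eq], assumption)
      (rule Bochner_Integration.integrable_add[OF R(2) I(2)])
  have "(LINT s|?M. 2 * Re (cnj (H s) * h s))
     = (LINT s|?M. 2 * (Re c + (LINT r|lebesgue_on {0<..<s}. Re (h r))) * Re (h s)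
      + 2 * (Im c + (LINT r|lebesgue_on {0<..<s}. Im (h r))) * Im (h s))"
    by (rule Bochner_Integration.integral_cong[OF refl eq])
  also have "\<dots> = (LINT s|?M. 2 * (Re c + (LINT r|lebesgue_on {0<..<s}. Re (h r))) * Re (h s))
      + (LINT s|?M. 2 * (Im c + (LINT r|lebesgue_on {0<..<s}. Im (h r))) * Im (h s))"
    by (rule Bochner_Integration.integral_add[OF R(2) I(2)])
  finally show "(cmod (H t))\<^sup>2 = (cmod c)\<^sup>2 + (LINT s|?M. 2 * Re (cnj (H s) * h s))"
    unfolding cmod_power2 using R(1) I(1) Re[of t] Im[of t] by simp
qed

lemma integral_interval_split:
  fixes G :: "real \<Rightarrow> real"
  assumes "0 \<le> s" "s \<le> r" and G: "integrable (lebesgue_on {0<..<r}) G"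
  shows "(LINT x|lebesgue_on {0<..<r}. G x) = (LINT x|lebesgue_on {0<..<s}. G x) + (LINT x|lebesgue_on {s<..<r}. G x)"
proof -
  let ?M = "lebesgue_on {0<..<r}"
  have s1: "{0<..<s} \<subseteq> {0<..<r}" "{s<..<r} \<subseteq> {0<..<r}" using assms by auto
  have i: "integrable ?M (\<lambda>x. indicator {0<..<s} x *\<^sub>R G x)" "integrable ?M (\<lambda>x. indicator {s<..<r} x *\<^sub>R G x)"
    using lebesgue_on_subset(2)[OF _ _ s1(1) G] lebesgue_on_subset(2)[OF _ _ s1(2) G]
      lebesgue_on_subset(3)[OF _ _ s1(1), of G] lebesgue_on_subset(3)[OF _ _ s1(2), of G] by simp_all
  have "(LINT x|?M. G x) = (LINT x|?M. indicator {0<..<s} x *\<^sub>R G x + indicator {s<..<r} x *\<^sub>R G x)"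
  proof (rule integral_cong_AE)
    have "AE x in lebesgue. x \<noteq> s" by (simp add: AE_completion_iff AE_lborel_singleton)
    then show "AE x in ?M. G x = indicator {0<..<s} x *\<^sub>R G x + indicator {s<..<r} x *\<^sub>R G x"
      by (subst AE_restrict_space_iff) (auto elim!: eventually_mono simp: indicator_def)
  qed (use G i in auto)
  also have "\<dots> = (LINT x|?M. indicator {0<..<s} x *\<^sub>R G x) + (LINT x|?M. indicator {s<..<r} x *\<^sub>R G x)"
    by (rule Bochner_Integration.integral_add[OF i])
  finally show ?thesis
    unfolding lebesgue_on_subset(1)[OF interval_lebesgue(1) interval_lebesgue(1) s1(1)]
      lebesgue_on_subset(1)[OF interval_lebesgue(1) interval_lebesgue(1) s1(2)] .
qed

text \<open>
  Since \<open>E\<close> is already bounded on compact subintervals of \<open>[0, T)\<close>, only a final interval on which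
  the Gronwall kernel has integral at most \<open>1/2\<close> matters. The majorant \<open>k\<close> need not be
  measurable; it is replaced by the measurable \<open>max 0 (G + Y) / E\<close> (with \<open>x / 0 = 0\<close>).
\<close>

lemma tail_gronwall:
  fixes E G Y :: "real \<Rightarrow> real" and k :: "real \<Rightarrow> ennreal"
  assumes T: "T > 0"
    and Gm [measurable]: "G \<in> borel_measurable (lebesgue_on {0<..<T})"
    and G: "\<And>b. 0 < b \<Longrightarrow> b < T \<Longrightarrow> integrable (lebesgue_on {0<..<b}) G"
    and E: "\<And>t. 0 \<le> t \<Longrightarrow> t < T \<Longrightarrow> E t = E0 + (LINT r|lebesgue_on {0<..<t}. G r)"
    and E_nonneg: "\<And>t. 0 \<le> t \<Longrightarrow> t < T \<Longrightarrow> 0 \<le> E t"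
    and Ym [measurable]: "Y \<in> borel_measurable (lebesgue_on {0<..<T})" and Y: "\<And>t. 0 \<le> Y t"
    and ae: "AE t in lebesgue_on {0<..<T}. \<exists>c\<ge>0. ennreal c \<le> k t \<and> G t + Y t \<le> c * E t"
    and k: "(\<integral>\<^sup>+t. k t \<partial>lebesgue_on {0<..<T}) < \<infinity>"
  shows "\<exists>C. \<forall>t. 0 \<le> t \<longrightarrow> t < T \<longrightarrow> E t \<le> C"
    and "(\<integral>\<^sup>+t. ennreal (Y t) \<partial>lebesgue_on {0<..<T}) < \<infinity>"
proof -
  let ?M = "lebesgue_on {0<..<T}"
  interpret M: sigma_finite_measure ?M by (rule sigma_finite_lebesgue_on) simp
  have [measurable]: "(\<lambda>x. x) \<in> borel_measurable ?M"
    by (intro measurable_restrict_space1 measurable_completion) simp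
  have Em [measurable]: "E \<in> borel_measurable ?M"
  proof -
    have "E t = E0 + (LINT r|?M. of_bool (r < t) * G r)" if "t \<in> space ?M" for t
    proof -
      have "(LINT r|lebesgue_on {0<..<t}. G r) = (LINT r|?M. indicator {0<..<t} r *\<^sub>R G r)"
        by (rule lebesgue_on_subset(1)[symmetric]) (use that in auto)
      also have "\<dots> = (LINT r|?M. of_bool (r < t) * G r)"
        by (rule Bochner_Integration.integral_cong) (auto simp: indicator_def)
      finally show ?thesis using E[of t] that by simp
    qed
    moreover have "(\<lambda>t. E0 + (LINT r|?M. of_bool (r < t) * G r)) \<in> borel_measurable ?M"
      by measurable
    ultimately show ?thesis by (subst measurable_cong)
  qed
  define \<kappa> where "\<kappa> t = max 0 (G t + Y t) / E t" for t
  have \<kappa>m [measurable]: "\<kappa> \<in> borel_measurable ?M" unfolding \<kappa>_def by measurable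
  have \<kappa>: "AE t in ?M. ennreal (\<kappa> t) \<le> k t \<and> 0 \<le> \<kappa> t \<and> G t + Y t \<le> \<kappa> t * E t"
    using ae AE_space
  proof eventually_elim
    case (elim t)
    then obtain c where c: "c \<ge> 0" "ennreal c \<le> k t" "G t + Y t \<le> c * E t" by blast
    have Et: "0 \<le> E t" using E_nonneg elim by simp
    show ?case
    proof (cases "E t = 0")
      case True
      then show ?thesis using c by (simp add: \<kappa>_def)
    next
      case False
      then have pos: "E t > 0" using Et by simp
      have "\<kappa> t \<le> c" using c pos by (simp add: \<kappa>_def pos_divide_le_eq)
      then have "ennreal (\<kappa> t) \<le> k t" using c(2) ennreal_leI order_trans by blast
      then show ?thesis using pos by (auto simp: \<kappa>_def)
    qed
  qed
  have \<kappa>i: "integrable ?M \<kappa>"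
  proof (rule integrableI_nonneg)
    have "(\<integral>\<^sup>+t. ennreal (\<kappa> t) \<partial>?M) \<le> (\<integral>\<^sup>+t. k t \<partial>?M)"
      by (rule nn_integral_mono_AE) (use \<kappa> in auto)
    then show "(\<integral>\<^sup>+t. ennreal (\<kappa> t) \<partial>?M) < \<infinity>" using k by (rule le_less_trans)
  qed (use \<kappa> in auto)
  define b where "b n = T - T / (real n + 2)" for n :: nat
  have b: "0 < b n" "b n < T" for n using T by (auto simp: b_def field_simps add_pos_nonneg)
  have b_lim: "b \<longlonglongrightarrow> T"
  proof -
    have "filterlim (\<lambda>n. real n + 2) at_top sequentially"
      by (rule filterlim_tendsto_add_at_top[of "\<lambda>_. 2", unfolded add.commute[of 2]]) (auto intro: filterlim_real_sequentially)
    then have "(\<lambda>n. T / (real n + 2)) \<longlonglongrightarrow> 0"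
      by (intro tendsto_divide_0[OF tendsto_const] filterlim_at_top_imp_at_infinity)
    then have "(\<lambda>n. T - T / (real n + 2)) \<longlonglongrightarrow> T - 0" by (intro tendsto_intros)
    then show ?thesis by (simp add: b_def[abs_def])
  qed
  have ind [measurable]: "(indicator {x<..<y} :: real \<Rightarrow> real) \<in> borel_measurable ?M" for x y
    by (intro measurable_restrict_space1 measurable_completion) simp
  have "(\<lambda>n. LINT r|?M. indicator {b n<..<T} r * \<kappa> r) \<longlonglongrightarrow> (LINT r|?M. 0)"
  proof (rule integral_dominated_convergence[where w="\<lambda>r. \<bar>\<kappa> r\<bar>"])
    show "AE r in ?M. (\<lambda>n. indicator {b n<..<T} r * \<kappa> r) \<longlonglongrightarrow> 0"
    proof (rule AE_I2)
      fix r assume "r \<in> space ?M"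
      then have "r < T" by simp
      then have "\<forall>\<^sub>F n in sequentially. r < b n" by (rule order_tendstoD(1)[OF b_lim])
      then have "\<forall>\<^sub>F n in sequentially. indicator {b n<..<T} r * \<kappa> r = 0"
        by eventually_elim simp
      then show "(\<lambda>n. indicator {b n<..<T} r * \<kappa> r) \<longlonglongrightarrow> 0" by (rule tendsto_eventually)
    qed
  qed (use \<kappa>i in \<open>auto simp: indicator_def\<close>)
  then have "(\<lambda>n. LINT r|?M. indicator {b n<..<T} r * \<kappa> r) \<longlonglongrightarrow> 0" by simp
  then have "\<forall>\<^sub>F n in sequentially. (LINT r|?M. indicator {b n<..<T} r * \<kappa> r) < 1/2"
    by (rule order_tendstoD) simp
  \<comment> \<open>Kernel mass below 1/2 on the final interval is what allows the absorption
    below.\<close>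
  then obtain n0 where n0: "(LINT r|?M. indicator {b n0<..<T} r * \<kappa> r) < 1/2"
    by (auto simp: eventually_sequentially)
  define s where "s = b n0"
  have s: "0 < s" "s < T" using b by (auto simp: s_def)
  have upper: "E t \<le> \<bar>E0\<bar> + (LINT r|lebesgue_on {0<..<t'}. \<bar>G r\<bar>)" if "0 \<le> t" "t \<le> t'" "0 < t'" "t' < T" for t t'
  proof -
    have Gt': "integrable (lebesgue_on {0<..<t'}) (\<lambda>r. \<bar>G r\<bar>)" using G[OF that(3,4)] by simp
    have "E t = E0 + (LINT r|lebesgue_on {0<..<t}. G r)" using E that by simp
    also have "\<dots> \<le> \<bar>E0\<bar> + (LINT r|lebesgue_on {0<..<t}. \<bar>G r\<bar>)"
      using integral_abs_bound[of "lebesgue_on {0<..<t}" G] by linarith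
    also have "(LINT r|lebesgue_on {0<..<t}. \<bar>G r\<bar>) \<le> (LINT r|lebesgue_on {0<..<t'}. \<bar>G r\<bar>)"
      unfolding integral_interval_split[OF that(1,2) Gt'] by (simp add: integral_nonneg_AE)
    finally show ?thesis by simp
  qed
  \<comment> \<open>Absorption: the supremum \<open>S\<close> of \<open>E\<close> over [s, t]
    satisfies S <= E s + S / 2. It is finite since \<open>G\<close> is integrable up to t < T, so S
    <= 2 E s, a bound independent of t.\<close>
  have tail: "E t \<le> 2 * E s" if t: "s \<le> t" "t < T" for t
  proof -
    define D where "D = \<bar>E0\<bar> + (LINT r|lebesgue_on {0<..<t}. \<bar>G r\<bar>)"
    have bdd: "bdd_above (E ` {s..t})"
      by (rule bdd_aboveI2[where M=D]) (use upper s t in \<open>auto simp: D_def\<close>)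
    define S where "S = (SUP r\<in>{s..t}. E r)"
    have ES: "E r \<le> S" if "r \<in> {s..t}" for r unfolding S_def by (rule cSUP_upper[OF that bdd])
    have S0: "0 \<le> S" using ES[of s] E_nonneg[of s] s t by simp
    have step: "E r \<le> E s + S / 2" if r: "s \<le> r" "r \<le> t" for r
    proof -
      let ?N = "lebesgue_on {s<..<r}"
      have Gr: "integrable (lebesgue_on {0<..<r}) G" by (rule G) (use s r t in auto)
      have sub1: "{s<..<r} \<subseteq> {0<..<r}" and sub2: "{s<..<r} \<subseteq> {0<..<T}" using s r t by auto
      have GN: "integrable ?N G" by (rule lebesgue_on_subset(2)[OF _ _ sub1 Gr]) auto
      have \<kappa>N: "integrable ?N \<kappa>" by (rule lebesgue_on_subset(2)[OF _ _ sub2 \<kappa>i]) auto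
      have "AE x in ?N. ennreal (\<kappa> x) \<le> k x \<and> 0 \<le> \<kappa> x \<and> G x + Y x \<le> \<kappa> x * E x"
        by (rule AE_lebesgue_on_subset[OF _ _ sub2 \<kappa>]) auto
      then have "AE x in ?N. G x \<le> S * \<kappa> x"
        using AE_space
      proof eventually_elim
        case (elim x)
        have "\<kappa> x * E x \<le> \<kappa> x * S" by (rule mult_left_mono[OF ES]) (use elim r in auto)
        then show ?case using elim Y[of x] by (simp add: mult.commute)
      qed
      then have "(LINT x|?N. G x) \<le> (LINT x|?N. S * \<kappa> x)"
        by (intro integral_mono_AE GN integrable_mult_right \<kappa>N)
      also have "\<dots> = S * (LINT x|?N. \<kappa> x)" by simp
      also have "\<dots> \<le> S * (1/2)"
      proof (rule mult_left_mono[OF _ S0])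
        have "(LINT x|?N. \<kappa> x) = (LINT x|?M. indicator {s<..<r} x *\<^sub>R \<kappa> x)"
          by (rule lebesgue_on_subset(1)[symmetric]) (use sub2 in auto)
        also have "\<dots> \<le> (LINT x|?M. indicator {s<..<T} x * \<kappa> x)"
        proof (rule integral_mono_AE)
          show "integrable ?M (\<lambda>x. indicator {s<..<r} x *\<^sub>R \<kappa> x)"
            by (rule Bochner_Integration.integrable_bound[OF \<kappa>i]) (auto simp: indicator_def)
          show "integrable ?M (\<lambda>x. indicator {s<..<T} x * \<kappa> x)"
            by (rule Bochner_Integration.integrable_bound[OF \<kappa>i]) (auto simp: indicator_def)
          show "AE x in ?M. indicator {s<..<r} x *\<^sub>R \<kappa> x \<le> indicator {s<..<T} x * \<kappa> x"
            using \<kappa> by eventually_elim (use r t in \<open>auto simp: indicator_def\<close>)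
        qed
        also have "\<dots> \<le> 1/2" using n0 by (simp add: s_def)
        finally show "(LINT x|?N. \<kappa> x) \<le> 1/2" .
      qed
      finally have "(LINT x|?N. G x) \<le> S / 2" by simp
      moreover have "E r = E s + (LINT x|?N. G x)"
        using E[of r] E[of s] integral_interval_split[OF _ r(1) Gr] s r t by simp
      ultimately show ?thesis by simp
    qed
    have "S \<le> E s + S / 2"
      unfolding S_def[symmetric] by (subst S_def, rule cSUP_least) (use t step in auto)
    then have "S \<le> 2 * E s" by simp
    then show ?thesis using ES[of t] t by simp
  qed
  define C where "C = max (\<bar>E0\<bar> + (LINT r|lebesgue_on {0<..<s}. \<bar>G r\<bar>)) (2 * E s)"
  have EC: "E t \<le> C" if "0 \<le> t" "t < T" for t
  proof (cases "t \<le> s")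
    case True
    then show ?thesis using upper[of t s] that s by (simp add: C_def)
  next
    case False
    then show ?thesis using tail[of t] that by (simp add: C_def)
  qed
  then show "\<exists>C. \<forall>t. 0 \<le> t \<longrightarrow> t < T \<longrightarrow> E t \<le> C" by blast
  have C0: "0 \<le> C" using EC[of 0] E_nonneg[of 0] T by simp
  \<comment> \<open>The result of integrating Y <= C \<open>\<kappa>\<close> - G over (0, c) and
    dropping the nonpositive term - E c.\<close>
  define Q where "Q = C * (LINT x|?M. \<kappa> x) + E0"
  \<comment> \<open>\<open>G\<close> is known to be integrable only up to c < T. The bound is
    uniform in c, and monotone convergence then reaches T.\<close>
  have YQ: "(\<integral>\<^sup>+x. ennreal (Y x) * indicator {0<..<c} x \<partial>?M) \<le> ennreal Q" if c: "0 < c" "c < T" for c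
  proof -
    let ?N = "lebesgue_on {0<..<c}"
    have sub: "{0<..<c} \<subseteq> {0<..<T}" using c by auto
    have \<kappa>N: "integrable ?N \<kappa>" by (rule lebesgue_on_subset(2)[OF _ _ sub \<kappa>i]) auto
    have GN: "integrable ?N G" by (rule G[OF c])
    have i: "integrable ?N (\<lambda>x. C * \<kappa> x - G x)" using \<kappa>N GN by simp
    have "AE x in ?N. ennreal (\<kappa> x) \<le> k x \<and> 0 \<le> \<kappa> x \<and> G x + Y x \<le> \<kappa> x * E x"
      by (rule AE_lebesgue_on_subset[OF _ _ sub \<kappa>]) auto
    then have ub: "AE x in ?N. Y x \<le> C * \<kappa> x - G x"
      using AE_space
    proof eventually_elim
      case (elim x)
      have "\<kappa> x * E x \<le> \<kappa> x * C" by (rule mult_left_mono[OF EC]) (use elim c in auto)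
      then show ?case using elim by (simp add: mult.commute)
    qed
    have "(\<integral>\<^sup>+x. ennreal (Y x) * indicator {0<..<c} x \<partial>?M) = (\<integral>\<^sup>+x. ennreal (Y x) \<partial>?N)"
    proof -
      have e: "indicator {0<..<c} x * indicator {0<..<T} x = (indicator {0<..<c} x :: ennreal)" for x
        using c by (auto simp: indicator_def)
      show ?thesis
        by (simp add: nn_integral_restrict_space mult.assoc e)
    qed
    also have "\<dots> \<le> (\<integral>\<^sup>+x. ennreal (C * \<kappa> x - G x) \<partial>?N)"
      by (rule nn_integral_mono_AE) (use ub in \<open>auto intro: ennreal_leI elim!: eventually_mono\<close>)
    also have "\<dots> = ennreal (LINT x|?N. C * \<kappa> x - G x)"
    proof (rule nn_integral_eq_integral[OF i])
      show "AE x in ?N. 0 \<le> C * \<kappa> x - G x"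
        using ub by eventually_elim (use Y order_trans in blast)
    qed
    also have "\<dots> \<le> ennreal Q"
    proof (rule ennreal_leI)
      have "(LINT x|?N. C * \<kappa> x - G x) = C * (LINT x|?N. \<kappa> x) + E0 - E c"
        using \<kappa>N GN E[of c] c by simp
      moreover have "(LINT x|?N. \<kappa> x) \<le> (LINT x|?M. \<kappa> x)"
      proof -
        have "(LINT x|?N. \<kappa> x) = (LINT x|?M. indicator {0<..<c} x *\<^sub>R \<kappa> x)"
          by (rule lebesgue_on_subset(1)[symmetric]) (use sub in auto)
        also have "\<dots> \<le> (LINT x|?M. \<kappa> x)"
        proof (rule integral_mono_AE[OF _ \<kappa>i])
          show "integrable ?M (\<lambda>x. indicator {0<..<c} x *\<^sub>R \<kappa> x)"
            by (rule Bochner_Integration.integrable_bound[OF \<kappa>i]) (auto simp: indicator_def)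
          show "AE x in ?M. indicator {0<..<c} x *\<^sub>R \<kappa> x \<le> \<kappa> x"
            using \<kappa> by eventually_elim (auto simp: indicator_def)
        qed
        finally show ?thesis .
      qed
      ultimately show "(LINT x|?N. C * \<kappa> x - G x) \<le> Q"
        using E_nonneg[of c] c mult_left_mono[OF _ C0, of "LINT x|?N. \<kappa> x" "LINT x|?M. \<kappa> x"] by (simp add: Q_def)
    qed
    finally show ?thesis .
  qed
  have "(\<integral>\<^sup>+x. ennreal (Y x) \<partial>?M) = (\<integral>\<^sup>+x. (SUP n. ennreal (Y x) * indicator {0<..<b n} x) \<partial>?M)"
  proof (rule nn_integral_cong)
    fix x assume "x \<in> space ?M"
    then have x: "0 < x" "x < T" by auto
    then obtain n where n: "x < b n"
      using order_tendstoD(1)[OF b_lim, of x] by (auto simp: eventually_sequentially)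
    show "ennreal (Y x) = (SUP n. ennreal (Y x) * indicator {0<..<b n} x)"
    proof (rule SUP_eqI[symmetric])
      show "ennreal (Y x) * indicator {0<..<b i} x \<le> ennreal (Y x)" for i by (simp add: indicator_def)
      show "ennreal (Y x) \<le> z" if "\<And>i. i \<in> UNIV \<Longrightarrow> ennreal (Y x) * indicator {0<..<b i} x \<le> z" for z
        using that[of n] n x by simp
    qed
  qed
  also have "\<dots> = (SUP n. \<integral>\<^sup>+x. ennreal (Y x) * indicator {0<..<b n} x \<partial>?M)"
  proof (rule nn_integral_monotone_convergence_SUP)
    have "b n \<le> b m" if "n \<le> m" for n m
      using T that by (auto simp: b_def intro!: divide_left_mono mult_pos_pos add_nonneg_pos)
    then show "incseq (\<lambda>n x. ennreal (Y x) * indicator {0<..<b n} x)"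
      by (auto simp: incseq_def le_fun_def indicator_def intro: less_le_trans)
    have "(indicator {0<..<b n} :: real \<Rightarrow> ennreal) \<in> borel_measurable ?M" for n
      by (intro measurable_restrict_space1 measurable_completion) simp
    then show "(\<lambda>x. ennreal (Y x) * indicator {0<..<b n} x) \<in> borel_measurable ?M" for n
      by measurable
  qed
  also have "\<dots> \<le> ennreal Q" by (rule SUP_least) (rule YQ[OF b])
  finally show "(\<integral>\<^sup>+x. ennreal (Y x) \<partial>?M) < \<infinity>" by (rule le_less_trans) simp
qed

section \<open>Evolution of the Fourier modes\<close>

lemma sobolev_diff:
  assumes x: "x \<in> sobolev s" and y: "y \<in> sobolev s"
  shows "x - y \<in> sobolev s" and "mode (x - y) i m = mode x i m - mode y i m"
proof -
  have L2: "(\<lambda>t. x t $ i) \<in> L2_torus" "(\<lambda>t. y t $ i) \<in> L2_torus" for i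
    using x y by (auto simp: sobolev_iff)
  have sq: "(a - b)\<^sup>2 \<le> 2 * a\<^sup>2 + 2 * b\<^sup>2" for a b :: real
    using zero_le_power2[of "a + b"] by (simp add: power2_eq_square algebra_simps)
  have diff: "mode (x - y) i m = mode x i m - mode y i m" for i m
    using fourier_coeff_diff[OF L2_torus_integrable[OF L2(1)] L2_torus_integrable[OF L2(2)], of i i m]
    by (simp add: mode_def)
  then show "mode (x - y) i m = mode x i m - mode y i m" .
  have L2d: "(\<lambda>t. (x - y) t $ i) \<in> L2_torus" for i
  proof -
    have [measurable]: "(\<lambda>t. x t $ i) \<in> borel_measurable torus_measure" "(\<lambda>t. y t $ i) \<in> borel_measurable torus_measure"
      using L2[of i] by (auto simp: L2_torus_def)
    have "integrable torus_measure (\<lambda>t. (x t $ i - y t $ i)\<^sup>2)"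
    proof (rule Bochner_Integration.integrable_bound)
      show "integrable torus_measure (\<lambda>t. 2 * (x t $ i)\<^sup>2 + 2 * (y t $ i)\<^sup>2)"
        using L2[of i] by (simp add: L2_torus_def)
      show "AE t in torus_measure. norm ((x t $ i - y t $ i)\<^sup>2) \<le> norm (2 * (x t $ i)\<^sup>2 + 2 * (y t $ i)\<^sup>2)"
        using sq by (intro AE_I2) simp
    qed measurable
    then show ?thesis using L2[of i] by (simp add: L2_torus_def periodic_def)
  qed
  have "integrable lattice (\<lambda>m. weight m ^ s * mode_sq (x - y) m)"
  proof (rule Bochner_Integration.integrable_bound)
    show "integrable lattice (\<lambda>m. 2 * (weight m ^ s * mode_sq x m) + 2 * (weight m ^ s * mode_sq y m))"
      using x y by (simp add: sobolev_iff)
    have "mode_sq (x - y) m \<le> 2 * mode_sq x m + 2 * mode_sq y m" for m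
    proof -
      have "(cmod (mode x i m - mode y i m))\<^sup>2 \<le> 2 * (cmod (mode x i m))\<^sup>2 + 2 * (cmod (mode y i m))\<^sup>2" for i
      proof -
        have "(cmod (mode x i m - mode y i m))\<^sup>2 \<le> (cmod (mode x i m) + cmod (mode y i m))\<^sup>2"
          by (intro power_mono norm_triangle_ineq4) simp
        also have "\<dots> \<le> 2 * (cmod (mode x i m))\<^sup>2 + 2 * (cmod (mode y i m))\<^sup>2"
          using sq[of "cmod (mode x i m)" "- cmod (mode y i m)"] by simp
        finally show ?thesis .
      qed
      then have "(\<Sum>i\<in>UNIV. (cmod (mode x i m - mode y i m))\<^sup>2)
          \<le> (\<Sum>i\<in>UNIV. 2 * (cmod (mode x i m))\<^sup>2 + 2 * (cmod (mode y i m))\<^sup>2)"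
        by (rule sum_mono)
      then show ?thesis by (simp add: mode_sq_def diff sum.distrib sum_distrib_left)
    qed
    then have "weight m ^ s * mode_sq (x - y) m \<le> weight m ^ s * (2 * mode_sq x m + 2 * mode_sq y m)" for m
      by (intro mult_left_mono) auto
    then show "AE m in lattice. norm (weight m ^ s * mode_sq (x - y) m)
        \<le> norm (2 * (weight m ^ s * mode_sq x m) + 2 * (weight m ^ s * mode_sq y m))"
      by (intro AE_I2) (simp add: algebra_simps)
  qed simp
  then show "x - y \<in> sobolev s" using L2d unfolding sobolev_iff by blast
qed

lemma zero_sobolev: "(\<lambda>_. 0) \<in> sobolev s"
proof -
  have "mode_sq (\<lambda>_. 0) m = 0" for m by (simp add: mode_sq_def mode_def fourier_coeff_def)
  then show ?thesis by (simp add: sobolev_iff L2_torus_def periodic_def)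
qed

lemma cmod_mode_sq_le_energy:
  assumes "u \<in> sobolev s"
  shows "(cmod (mode u i m))\<^sup>2 \<le> energy s u"
proof -
  have "1 * (cmod (mode u i m))\<^sup>2 \<le> weight m ^ s * mode_sq u m"
    by (intro mult_mono cmod_mode_sq_le) auto
  also have "\<dots> \<le> energy s u"
    unfolding energy_def by (rule le_integral_count_space) (use assms in \<open>auto simp: sobolev_iff\<close>)
  finally show ?thesis by simp
qed

text \<open>The Lipschitz property by which strong measurability of the solution passes to its
  Fourier coefficients.\<close>

lemma mode_diff_le:
  assumes "x \<in> sobolev s" "y \<in> sobolev s"
  shows "cmod (mode x i m - mode y i m) \<le> sobolev_norm s (x - y)"
proof -
  have "(cmod (mode x i m - mode y i m))\<^sup>2 \<le> energy s (x - y)"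
    using cmod_mode_sq_le_energy[OF sobolev_diff(1)[OF assms], of i m] by (simp add: sobolev_diff(2)[OF assms])
  then show ?thesis
    unfolding sobolev_norm_eq[OF sobolev_diff(1)[OF assms]] by (rule real_le_rsqrt)
qed

lemma torus_inner_trig_test:
  assumes "u \<in> sobolev s"
  shows "torus_inner u (trig_test m \<alpha> (axis i 1)) = (2 * pi) ^ 3 * Re (cis (- \<alpha>) * mode u i m)"
proof -
  have "(\<lambda>x. u x $ i) \<in> L2_torus" using assms by (simp add: sobolev_iff)
  from torus_integral_trig[OF L2_torus_integrable[OF this], of m \<alpha>] show ?thesis
    by (simp add: torus_inner_def trig_test_def inner_axis mult.commute mode_def)
qed

text \<open>Carries measurability in time from single modes over to energies, fluxes and point
  values of Fourier series.\<close>

lemma lattice_integral_measurable: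
  fixes f :: "'a \<Rightarrow> int^3 \<Rightarrow> 'b::{banach,second_countable_topology}"
  assumes "\<And>m. (\<lambda>t. f t m) \<in> borel_measurable M"
  shows "(\<lambda>t. LINT m|lattice. f t m) \<in> borel_measurable M"
proof -
  interpret Z: sigma_finite_measure lattice by (rule sigma_finite_measure_count_space)
  have "case_prod (\<lambda>m t. f t m) \<in> borel_measurable (lattice \<Otimes>\<^sub>M M)"
    by (rule measurable_pair_measure_countable1) (use assms in auto)
  then have "(\<lambda>p. case_prod (\<lambda>m t. f t m) (snd p, fst p)) \<in> borel_measurable (M \<Otimes>\<^sub>M lattice)"
    by (rule measurable_compose[rotated]) measurable
  then have "case_prod f \<in> borel_measurable (M \<Otimes>\<^sub>M lattice)"
    by (simp add: split_beta')
  then show ?thesis by (rule Z.borel_measurable_lebesgue_integral)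
qed

text \<open>The Bochner spaces occur over intervals with different endpoints, while the estimates
  are proved on the open interval.\<close>

lemma interval_endpoints_AE:
  assumes I: "{0<..<T} \<subseteq> I" "I \<subseteq> {0..(T::real)}" "I \<in> sets lebesgue"
  shows "(AE t in lebesgue_on {0<..<T}. P t) \<Longrightarrow> (AE t in lebesgue_on I. P t)"
    and "(\<integral>\<^sup>+t. f t \<partial>lebesgue_on I) = (\<integral>\<^sup>+t. f t \<partial>lebesgue_on {0<..<T})"
proof -
  have ne: "AE t in lebesgue. t \<noteq> 0 \<and> t \<noteq> T"
    by (simp add: AE_completion_iff AE_lborel_singleton)
  show "AE t in lebesgue_on I. P t" if P: "AE t in lebesgue_on {0<..<T}. P t"
  proof -
    have "AE t in lebesgue. t \<in> {0<..<T} \<longrightarrow> P t" using P by (subst (asm) AE_restrict_space_iff) auto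
    with ne have "AE t in lebesgue. t \<in> I \<longrightarrow> P t"
    proof eventually_elim
      case (elim t)
      show ?case
      proof
        assume "t \<in> I"
        then have "t \<in> {0..T}" using I(2) by blast
        then have "t \<in> {0<..<T}" using elim(1) by auto
        then show "P t" using elim(2) by blast
      qed
    qed
    then show ?thesis using I(3) by (subst AE_restrict_space_iff) auto
  qed
  have "(\<integral>\<^sup>+t. f t \<partial>lebesgue_on I) = (\<integral>\<^sup>+t. f t * indicator I t \<partial>lebesgue)"
    using I(3) by (simp add: nn_integral_restrict_space)
  also have "\<dots> = (\<integral>\<^sup>+t. f t * indicator {0<..<T} t \<partial>lebesgue)"
  proof (rule nn_integral_cong_AE)
    show "AE t in lebesgue. f t * indicator I t = f t * indicator {0<..<T} t"
      using ne
    proof eventually_elim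
      case (elim t)
      have "t \<in> I \<longleftrightarrow> t \<in> {0<..<T}"
      proof
        assume "t \<in> I"
        then have "t \<in> {0..T}" using I(2) by blast
        then show "t \<in> {0<..<T}" using elim by auto
      qed (use I(1) in blast)
      then show ?case by (simp add: indicator_def)
    qed
  qed
  also have "\<dots> = (\<integral>\<^sup>+t. f t \<partial>lebesgue_on {0<..<T})"
    by (simp add: nn_integral_restrict_space)
  finally show "(\<integral>\<^sup>+t. f t \<partial>lebesgue_on I) = (\<integral>\<^sup>+t. f t \<partial>lebesgue_on {0<..<T})" .
qed

lemma AE_exhaust_interval:
  assumes "T > (0::real)" "\<And>b. 0 < b \<Longrightarrow> b < T \<Longrightarrow> AE t in lebesgue_on {0<..<b}. P t"
  shows "AE t in lebesgue_on {0<..<T}. P t"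
proof -
  define b where "b n = T - T / (real n + 2)" for n :: nat
  have b: "0 < b n" "b n < T" for n using assms(1) by (auto simp: b_def field_simps add_pos_nonneg)
  have ex: "\<exists>n. t < b n" if "t < T" for t
  proof -
    obtain n :: nat where "T / (T - t) < real n" using reals_Archimedean2 by blast
    then have "T / (T - t) < real n + 2" by simp
    then have "T < (real n + 2) * (T - t)" using that by (simp add: pos_divide_less_eq)
    then have "T / (real n + 2) < T - t" by (simp add: pos_divide_less_eq mult.commute add_nonneg_pos)
    then have "t < b n" by (simp add: b_def)
    then show ?thesis by blast
  qed
  have "AE t in lebesgue. \<forall>n. t \<in> {0<..<b n} \<longrightarrow> P t"
    using assms(2)[OF b] by (subst AE_all_countable) (auto simp: AE_restrict_space_iff)
  then have "AE t in lebesgue. t \<in> {0<..<T} \<longrightarrow> P t"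
  proof eventually_elim
    case (elim t)
    then show ?case using ex[of t] by auto
  qed
  then show ?thesis by (subst AE_restrict_space_iff) auto
qed

text \<open>The cutoff belongs to the context of the evolution because the smooth steps in time,
  hence \<open>distr_deriv_FTC\<close>, are built from it.\<close>

locale ks_solution =
  fixes T lam :: real and u0 :: "real^3 \<Rightarrow> real^3" and u :: "real \<Rightarrow> real^3 \<Rightarrow> real^3"
    and \<phi> :: "real^3 \<Rightarrow> real"
  assumes T: "T > 0" and \<phi>: "dyadic_cutoff \<phi>" and u0: "u0 \<in> sobolev 2"
    and sol: "solution_on lam u0 T u"
begin

abbreviation "M \<equiv> lebesgue_on {0<..<T}"

lemma strong_solution_before: "0 < b \<Longrightarrow> b < T \<Longrightarrow> strong_solution lam u0 b u"
  using sol by (simp add: solution_on_def)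

lemma strongly_measurable_H4: "{0<..<T} \<subseteq> I \<Longrightarrow> I \<subseteq> {0..T} \<Longrightarrow> strongly_measurable I (sobolev 4) (sobolev_norm 4) u"
  by (rule strongly_measurable_glue[OF T zero_sobolev])
    (use strong_solution_before in \<open>auto simp: strong_solution_def bochner_L2_def\<close>)

lemma strongly_measurable_H2: "{0<..<T} \<subseteq> I \<Longrightarrow> I \<subseteq> {0..T} \<Longrightarrow> strongly_measurable I (sobolev 2) (sobolev_norm 2) u"
  by (rule strongly_measurable_glue[OF T zero_sobolev])
    (use strong_solution_before in \<open>auto simp: strong_solution_def bochner_Linf_def\<close>)

lemma strongly_measurable_H4_open: "strongly_measurable {0<..<T} (sobolev 4) (sobolev_norm 4) u"
  by (rule strongly_measurable_H4) auto

lemma AE_H4: "AE t in M. u t \<in> sobolev 4"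
  using strongly_measurable_H4_open by (simp add: strongly_measurable_def)

lemma mode_measurable [measurable]: "(\<lambda>t. mode (u t) i m) \<in> borel_measurable M"
  by (rule strongly_measurable_functional[OF _ strongly_measurable_H4_open, where l="\<lambda>f. mode f i m"]) (auto intro: mode_diff_le)

lemma nonlin_measurable [measurable]: "(\<lambda>t. nonlin (u t) i m) \<in> borel_measurable M"
proof (rule measurable_AE_lebesgue_on)
  show "(\<lambda>t. \<Sum>j\<in>UNIV. LINT k|lattice. deriv_coeff j (mode (u t) i) k * mode (u t) j (m - k)) \<in> borel_measurable M"
    unfolding deriv_coeff_def by (intro borel_measurable_sum lattice_integral_measurable) measurable
  show "AE t in M. (\<Sum>j\<in>UNIV. LINT k|lattice. deriv_coeff j (mode (u t) i) k * mode (u t) j (m - k)) = nonlin (u t) i m"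
    using AE_H4 by eventually_elim (simp add: h4_state.nonlin_formula[OF h4_state.intro])
qed simp

lemma rhs_measurable [measurable]: "(\<lambda>t. mode_rhs lam (u t) i m) \<in> borel_measurable M"
  unfolding mode_rhs_def by measurable

lemma cnj_measurable [measurable]: "cnj \<in> borel_measurable borel"
  by (intro borel_measurable_continuous_onI continuous_intros)

lemma flux_measurable [measurable]: "(\<lambda>t. flux lam s (u t) m) \<in> borel_measurable M"
  unfolding flux_def by measurable

lemma energy_measurable [measurable]: "(\<lambda>t. energy s (u t)) \<in> borel_measurable M"
  unfolding energy_def mode_sq_def by (rule lattice_integral_measurable) measurable

definition G :: "nat \<Rightarrow> real \<Rightarrow> real" where
  "G s t = (LINT m|lattice. flux lam s (u t) m)"

lemma G_measurable [measurable]: "G s \<in> borel_measurable M"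
  unfolding G_def[abs_def] by (rule lattice_integral_measurable) measurable

lemma restrict_measurable:
  fixes f :: "real \<Rightarrow> 'b::topological_space"
  assumes "f \<in> borel_measurable M" "b \<le> T"
  shows "f \<in> borel_measurable (lebesgue_on {0<..<b})"
proof -
  have "{0<..<b} \<in> sets M" using assms(2) by (auto simp: sets_restrict_space_iff)
  moreover have "lebesgue_on {0<..<b} = restrict_space M {0<..<b}"
  proof -
    have "{0<..<T} \<inter> {0<..<b} = {0<..<b}" using assms(2) by auto
    then show ?thesis by (simp add: restrict_restrict_space)
  qed
  ultimately show ?thesis using assms(1) by (simp add: measurable_restrict_space1)
qed

lemma AE_sub: "AE t in M. P t \<Longrightarrow> b \<le> T \<Longrightarrow> AE t in lebesgue_on {0<..<b}. P t"
  by (rule AE_lebesgue_on_subset[of _ "{0<..<T}"]) auto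

lemma local_H2_bound:
  assumes b: "0 < b" "b < T"
  obtains C where "C \<ge> 0" "AE t in lebesgue_on {0<..<b}. energy 2 (u t) \<le> C"
proof -
  have "\<exists>C. AE t in lebesgue_on {0..<b}. sobolev_norm 2 (u t) \<le> C"
    using strong_solution_before[OF b] by (simp add: strong_solution_def bochner_Linf_def)
  then obtain C where "AE t in lebesgue_on {0..<b}. sobolev_norm 2 (u t) \<le> C" by blast
  then have C: "AE t in lebesgue_on {0<..<b}. sobolev_norm 2 (u t) \<le> C"
    by (rule AE_lebesgue_on_subset[rotated -1]) auto
  have "AE t in lebesgue_on {0<..<b}. energy 2 (u t) \<le> C\<^sup>2"
    using C AE_sub[OF AE_H4 less_imp_le[OF b(2)]]
  proof eventually_elim
    case (elim t)
    have "sobolev_norm 2 (u t) = sqrt (energy 2 (u t))"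
      by (rule sobolev_norm_eq[OF sobolev_mono[OF elim(2)]]) simp
    then have "sqrt (energy 2 (u t)) \<le> C" using elim by simp
    then have "(sqrt (energy 2 (u t)))\<^sup>2 \<le> C\<^sup>2" by (intro power_mono) auto
    then show ?case by simp
  qed
  then show ?thesis using that[of "C\<^sup>2"] by simp
qed

lemma local_H4_bound:
  assumes b: "0 < b" "b < T"
  shows "(\<integral>\<^sup>+t. ennreal (energy 4 (u t)) \<partial>lebesgue_on {0<..<b}) < \<infinity>"
proof -
  have "(\<integral>\<^sup>+t. ennreal (energy 4 (u t)) \<partial>lebesgue_on {0<..<b})
     = (\<integral>\<^sup>+t. ennreal ((sobolev_norm 4 (u t))\<^sup>2) \<partial>lebesgue_on {0<..<b})"
  proof (rule nn_integral_cong_AE)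
    show "AE t in lebesgue_on {0<..<b}. ennreal (energy 4 (u t)) = ennreal ((sobolev_norm 4 (u t))\<^sup>2)"
      using AE_sub[OF AE_H4 less_imp_le[OF b(2)]] by eventually_elim (simp add: sobolev_norm_eq)
  qed
  also have "\<dots> = (\<integral>\<^sup>+t. ennreal ((sobolev_norm 4 (u t))\<^sup>2) \<partial>lebesgue_on {0..<b})"
    by (rule interval_endpoints_AE(2)[symmetric]) auto
  also have "\<dots> < \<infinity>" using strong_solution_before[OF b] by (simp add: strong_solution_def bochner_L2_def)
  finally show ?thesis .
qed

text \<open>Up to b < T the H^2 norm is essentially bounded; it bounds a single coefficient of the
  field directly, and one of the nonlinearity through \<open>nonlin_sq\<close>.\<close>

lemma rhs_integrable:
  assumes b: "0 < b" "b < T"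
  shows "integrable (lebesgue_on {0<..<b}) (\<lambda>t. mode_rhs lam (u t) i m)"
proof -
  obtain C where C: "C \<ge> 0" "AE t in lebesgue_on {0<..<b}. energy 2 (u t) \<le> C"
    using local_H2_bound[OF b] .
  interpret finite_measure "lebesgue_on {0<..<b}" by (rule finite_measure_lebesgue_on) simp
  show ?thesis
  proof (rule integrable_const_bound)
    show "(\<lambda>t. mode_rhs lam (u t) i m) \<in> borel_measurable (lebesgue_on {0<..<b})"
      by (rule restrict_measurable) (use b in auto)
    show "AE t in lebesgue_on {0<..<b}. cmod (mode_rhs lam (u t) i m)
        \<le> \<bar>growth lam m\<bar> * (1 + C) + (1 + 3 * weight_const * C\<^sup>2)"
      using C(2) AE_sub[OF AE_H4 less_imp_le[OF b(2)]]
    proof eventually_elim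
      case (elim t)
      interpret h4_state "u t" by (rule h4_state.intro) (rule elim)
      have le1: "x \<le> 1 + x\<^sup>2" for x :: real
        using zero_le_power2[of "x - 1/2"] by (simp add: power2_eq_square algebra_simps)
      have "(cmod (mode (u t) i m))\<^sup>2 \<le> C" using cmod_mode_sq_le_energy[OF H2, of i m] elim by simp
      then have 1: "cmod (mode (u t) i m) \<le> 1 + C" using le1[of "cmod (mode (u t) i m)"] by linarith
      have "(cmod (nonlin (u t) i m))\<^sup>2 \<le> (\<Sum>i\<in>UNIV. (cmod (nonlin (u t) i m))\<^sup>2)"
        by (rule member_le_sum) auto
      also have "\<dots> \<le> (LINT m|lattice. (\<Sum>i\<in>UNIV. (cmod (nonlin (u t) i m))\<^sup>2))"
        by (rule le_integral_count_space[OF nonlin_sq(1)]) (simp add: sum_nonneg)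
      also have "\<dots> \<le> 3 * weight_const * (energy 2 (u t))\<^sup>2" by (rule nonlin_sq(2))
      also have "\<dots> \<le> 3 * weight_const * C\<^sup>2"
        using elim(1) weight_const_nonneg by (intro mult_left_mono power_mono) auto
      finally have 2: "cmod (nonlin (u t) i m) \<le> 1 + 3 * weight_const * C\<^sup>2"
        using le1[of "cmod (nonlin (u t) i m)"] by linarith
      have "cmod (mode_rhs lam (u t) i m) \<le> cmod (of_real (growth lam m) * mode (u t) i m) + cmod (nonlin (u t) i m)"
        unfolding mode_rhs_def by (rule norm_triangle_ineq4)
      also have "\<dots> \<le> \<bar>growth lam m\<bar> * (1 + C) + (1 + 3 * weight_const * C\<^sup>2)"
        using 1 2 by (intro add_mono) (auto simp: norm_mult intro: mult_left_mono)
      finally show ?case .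
    qed
  qed
qed

text \<open>The absolutely continuous representative of a Fourier coefficient of the solution, with
  its initial value taken from the datum.\<close>

definition c :: "3 \<Rightarrow> int^3 \<Rightarrow> real \<Rightarrow> complex" where
  "c i m t = mode u0 i m + (LINT r|lebesgue_on {0<..<t}. mode_rhs lam (u r) i m)"

text \<open>The equation is tested with trigonometric fields and integrated in time by
  \<open>distr_deriv_FTC\<close>; the continuous representative in the definition of a strong
  solution brings in the initial value.\<close>

lemma AE_mode_eq: "AE t in M. mode (u t) i m = c i m t"
proof (rule AE_exhaust_interval[OF T])
  fix b assume b: "0 < b" "b < T"
  define P :: real where "P = (2 * pi) ^ 3"
  have P: "P \<noteq> 0" by (simp add: P_def)
  have H4b: "AE t in lebesgue_on {0<..<b}. u t \<in> sobolev 4" by (rule AE_sub[OF AE_H4]) (use b in simp)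
  have main: "AE t in lebesgue_on {0<..<b}. Re (cis (- \<alpha>) * mode (u t) i m) = Re (cis (- \<alpha>) * c i m t)" for \<alpha>
  proof -
    define \<psi> :: "real^3 \<Rightarrow> real^3" where "\<psi> = trig_test m \<alpha> (axis i 1)"
    define h where "h = (\<lambda>t. lam * grad_inner (u t) \<psi> - torus_inner (convection (u t)) \<psi> - torus_inner (weak_laplacian (u t)) (laplacian \<psi>))"
    define h' where "h' t = P * Re (cis (- \<alpha>) * mode_rhs lam (u t) i m)" for t
    have \<psi>: "\<psi> \<in> smooth_periodic" unfolding \<psi>_def by (rule trig_test_smooth_periodic)
    have d: "is_distr_deriv b (\<lambda>t. torus_inner (u t) \<psi>) h"
      using strong_solution_before[OF b] \<psi> unfolding strong_solution_def h_def by blast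
    have "\<exists>g. continuous_on {0..<b} g \<and> (AE t in lebesgue_on {0..<b}. g t = torus_inner (u t) \<psi>) \<and> g 0 = torus_inner u0 \<psi>"
      using strong_solution_before[OF b] \<psi> unfolding strong_solution_def by blast
    then obtain g where g: "continuous_on {0..<b} g" "AE t in lebesgue_on {0..<b}. g t = torus_inner (u t) \<psi>"
      "g 0 = torus_inner u0 \<psi>" by blast
    have h'i: "integrable (lebesgue_on {0<..<b}) h'"
      unfolding h'_def by (intro integrable_mult_right integrable_Re rhs_integrable b)
    have hh': "AE t in lebesgue_on {0<..<b}. h' t = h t"
      using H4b
    proof eventually_elim
      case (elim t)
      then interpret h4_state "u t" by (rule h4_state.intro)
      show ?case using rhs_trig[of lam m \<alpha> i] by (simp only: h_def h'_def \<psi>_def P_def)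
    qed
    \<comment> \<open>\<open>h\<close> is assembled from weak derivatives chosen time by time; its
      measurability is inherited from \<open>h'\<close>, which involves only modes.\<close>
    have hm: "h \<in> borel_measurable (lebesgue_on {0<..<b})"
      by (rule measurable_AE_lebesgue_on[OF _ borel_measurable_integrable[OF h'i] hh']) simp
    have hi: "integrable (lebesgue_on {0<..<b}) h"
      using integrable_cong_AE[OF borel_measurable_integrable[OF h'i] hm hh'] h'i by simp
    have "AE t in lebesgue_on {0<..<b}. g t = torus_inner (u t) \<psi>"
      by (rule AE_lebesgue_on_subset[OF _ _ _ g(2)]) auto
    then show ?thesis
      using H4b AE_space
    proof eventually_elim
      case (elim t)
      then have t: "0 \<le> t" "t < b" by auto
      have sub: "{0<..<t} \<subseteq> {0<..<b}" using t by auto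
      have ri: "integrable (lebesgue_on {0<..<t}) (\<lambda>r. mode_rhs lam (u r) i m)"
        by (rule lebesgue_on_subset(2)[OF _ _ sub rhs_integrable[OF b]]) auto
      have "g t = g 0 + (LINT r|lebesgue_on {0<..<t}. h r)"
        by (rule distr_deriv_FTC[OF \<phi> d hi g(1,2) t])
      also have "(LINT r|lebesgue_on {0<..<t}. h r) = (LINT r|lebesgue_on {0<..<t}. h' r)"
      proof (rule integral_cong_AE)
        show "h \<in> borel_measurable (lebesgue_on {0<..<t})" "h' \<in> borel_measurable (lebesgue_on {0<..<t})"
          using lebesgue_on_subset(2)[OF _ _ sub hi] lebesgue_on_subset(2)[OF _ _ sub h'i] by auto
        have "AE r in lebesgue_on {0<..<t}. h' r = h r"
          by (rule AE_lebesgue_on_subset[OF _ _ sub hh']) auto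
        then show "AE r in lebesgue_on {0<..<t}. h r = h' r" by eventually_elim simp
      qed
      also have "\<dots> = P * Re (cis (- \<alpha>) * (LINT r|lebesgue_on {0<..<t}. mode_rhs lam (u r) i m))"
        unfolding h'_def using integral_Re[OF integrable_mult_right[of "cis (- \<alpha>)", OF ri]]
        by (simp only: integral_mult_right_zero)
      also have "g 0 = P * Re (cis (- \<alpha>) * mode u0 i m)"
        unfolding g(3) \<psi>_def P_def by (rule torus_inner_trig_test[OF u0])
      finally have "g t = P * Re (cis (- \<alpha>) * c i m t)"
        by (simp only: c_def distrib_left plus_complex.sel)
      moreover have "g t = P * Re (cis (- \<alpha>) * mode (u t) i m)"
        unfolding elim(1) \<psi>_def P_def by (rule torus_inner_trig_test[OF elim(2)])
      ultimately have "P * Re (cis (- \<alpha>) * mode (u t) i m) = P * Re (cis (- \<alpha>) * c i m t)" by (simp only:)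
      then show ?case by (rule iffD1[OF mult_left_cancel[OF P]])
    qed
  qed
  show "AE t in lebesgue_on {0<..<b}. mode (u t) i m = c i m t"
    \<comment> \<open>The phases 0 and pi/2 recover the real and the imaginary part.\<close>
    using main[of 0] main[of "pi / 2"]
    by eventually_elim (simp add: complex_eq_iff)
qed

section \<open>Summation of the mode balances to energy identities\<close>

lemma flux_finite:
  assumes b: "0 < b" "b < T" and s: "s \<le> 2"
  shows "(\<integral>\<^sup>+t. (\<integral>\<^sup>+m. ennreal (norm (flux lam s (u t) m)) \<partial>lattice) \<partial>lebesgue_on {0<..<b}) < \<infinity>"
proof -
  obtain C where C: "C \<ge> 0" "AE t in lebesgue_on {0<..<b}. energy 2 (u t) \<le> C"
    using local_H2_bound[OF b] .
  interpret finite_measure "lebesgue_on {0<..<b}" by (rule finite_measure_lebesgue_on) simp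
  have [measurable]: "(\<lambda>t. energy 4 (u t)) \<in> borel_measurable (lebesgue_on {0<..<b})"
    by (rule restrict_measurable) (use b in auto)
  \<comment> \<open>The flux bound is linear in the H^4 energy and quadratic in the H^2 energy; the
    first is integrable and the second essentially bounded on (0, b), so the bound is integrable in
    time.\<close>
  let ?a = "2 * \<bar>lam\<bar> + 3" and ?d = "3 * weight_const * C\<^sup>2"
  have d: "?d \<ge> 0" using weight_const_nonneg by simp
  have "(\<integral>\<^sup>+t. (\<integral>\<^sup>+m. ennreal (norm (flux lam s (u t) m)) \<partial>lattice) \<partial>lebesgue_on {0<..<b})
     \<le> (\<integral>\<^sup>+t. ennreal ?a * ennreal (energy 4 (u t)) + ennreal ?d \<partial>lebesgue_on {0<..<b})"
  proof (rule nn_integral_mono_AE)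
    show "AE t in lebesgue_on {0<..<b}. (\<integral>\<^sup>+m. ennreal (norm (flux lam s (u t) m)) \<partial>lattice)
        \<le> ennreal ?a * ennreal (energy 4 (u t)) + ennreal ?d"
      using C(2) AE_sub[OF AE_H4 less_imp_le[OF b(2)]]
    proof eventually_elim
      case (elim t)
      interpret h4_state "u t" by (rule h4_state.intro) (rule elim)
      have "(\<integral>\<^sup>+m. ennreal (norm (flux lam s (u t) m)) \<partial>lattice) = ennreal (LINT m|lattice. \<bar>flux lam s (u t) m\<bar>)"
        using flux_integrable[OF s, of lam] by (subst nn_integral_eq_integral) auto
      also have "\<dots> \<le> ennreal (?a * energy 4 (u t) + ?d)"
      proof (rule ennreal_leI)
        have "3 * weight_const * (energy 2 (u t))\<^sup>2 \<le> ?d"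
          using elim(1) weight_const_nonneg by (intro mult_left_mono power_mono) auto
        then show "(LINT m|lattice. \<bar>flux lam s (u t) m\<bar>) \<le> ?a * energy 4 (u t) + ?d"
          using flux_l1_bound[OF s, of lam] by linarith
      qed
      also have "\<dots> = ennreal ?a * ennreal (energy 4 (u t)) + ennreal ?d"
      proof -
        have "ennreal (?a * energy 4 (u t) + ?d) = ennreal (?a * energy 4 (u t)) + ennreal ?d"
          by (rule ennreal_plus) (use d in auto)
        also have "ennreal (?a * energy 4 (u t)) = ennreal ?a * ennreal (energy 4 (u t))"
          by (rule ennreal_mult') simp
        finally show ?thesis .
      qed
      finally show ?case .
    qed
  qed
  also have "\<dots> = ennreal ?a * (\<integral>\<^sup>+t. ennreal (energy 4 (u t)) \<partial>lebesgue_on {0<..<b}) + ennreal ?d * emeasure (lebesgue_on {0<..<b}) {0<..<b}"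
    by (subst nn_integral_add) (auto simp: nn_integral_cmult)
  also have "\<dots> < \<infinity>"
  proof -
    have "emeasure (lebesgue_on {0<..<b}) {0<..<b} < \<infinity>"
      by (simp add: emeasure_eq_measure)
    then show ?thesis using local_H4_bound[OF b] by (simp add: ennreal_mult_less_top)
  qed
  finally show ?thesis .
qed

text \<open>The integrated energy balance taken as a definition. It has a value at every time, which
  \<open>energy s (u t)\<close> determines only almost everywhere.\<close>

definition Es :: "nat \<Rightarrow> real \<Rightarrow> real" where
  "Es s t = energy s u0 + (LINT r|lebesgue_on {0<..<t}. G s r)"

lemma G_integrable: "0 < b \<Longrightarrow> b < T \<Longrightarrow> s \<le> 2 \<Longrightarrow> integrable (lebesgue_on {0<..<b}) (G s)"
  unfolding G_def[abs_def]
  by (rule sums_swap(2)[OF sigma_finite_lebesgue_on _ flux_finite])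
    (auto intro: restrict_measurable)

text \<open>The balance \<open>square_FTC\<close> of each coefficient, weighted and summed over the
  lattice, with Fubini moving the sum into the time integral. Inside that integral the
  representatives \<open>c\<close> may be replaced by the modes of the solution, which produces the
  flux.\<close>

lemma Es_eq:
  assumes t: "0 \<le> t" "t < T" and s: "s \<le> 2"
  shows "Es s t = (LINT m|lattice. weight m ^ s * (\<Sum>i\<in>UNIV. (cmod (c i m t))\<^sup>2))"
proof -
  define b where "b = (t + T) / 2"
  have b: "0 < b" "b < T" "t < b" using t T by (auto simp: b_def)
  let ?N = "lebesgue_on {0<..<t}"
  have sub: "{0<..<t} \<subseteq> {0<..<b}" using b by auto
  have fm: "(\<lambda>r. flux lam s (u r) m) \<in> borel_measurable ?N" for m
    by (rule restrict_measurable[OF flux_measurable]) (use t in simp)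
  have fin: "(\<integral>\<^sup>+t. (\<integral>\<^sup>+m. ennreal (norm (flux lam s (u t) m)) \<partial>lattice) \<partial>?N) < \<infinity>"
  proof -
    have e: "indicator {0<..<t} x \<le> (indicator {0<..<b} x :: ennreal)" for x
      using sub by (auto simp: indicator_def)
    have "(\<integral>\<^sup>+t. (\<integral>\<^sup>+m. ennreal (norm (flux lam s (u t) m)) \<partial>lattice) \<partial>?N)
        \<le> (\<integral>\<^sup>+t. (\<integral>\<^sup>+m. ennreal (norm (flux lam s (u t) m)) \<partial>lattice) \<partial>lebesgue_on {0<..<b})"
      by (simp add: nn_integral_restrict_space) (intro nn_integral_mono mult_left_mono e, simp)
    then show ?thesis using flux_finite[OF b(1,2) s] by (rule le_less_trans)
  qed
  note S = sums_swap[OF sigma_finite_lebesgue_on fm fin, OF interval_lebesgue(1)]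
  have ri: "integrable ?N (\<lambda>r. mode_rhs lam (u r) i m)" for i m
    by (rule lebesgue_on_subset(2)[OF _ _ sub rhs_integrable[OF b(1,2)]]) auto
  have pw: "weight m ^ s * (\<Sum>i\<in>UNIV. (cmod (c i m t))\<^sup>2) = weight m ^ s * mode_sq u0 m + (LINT r|?N. flux lam s (u r) m)" for m
  proof -
    note Q = square_FTC[OF t(1) ri, of "mode u0 i m" i m for i, folded c_def]
    have "(\<Sum>i\<in>UNIV. (cmod (c i m t))\<^sup>2) = mode_sq u0 m + (\<Sum>i\<in>UNIV. LINT r|?N. 2 * Re (cnj (c i m r) * mode_rhs lam (u r) i m))"
      unfolding Q(1) mode_sq_def by (rule sum.distrib)
    also have "(\<Sum>i\<in>UNIV. LINT r|?N. 2 * Re (cnj (c i m r) * mode_rhs lam (u r) i m))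
       = (LINT r|?N. (\<Sum>i\<in>UNIV. 2 * Re (cnj (c i m r) * mode_rhs lam (u r) i m)))"
      by (rule Bochner_Integration.integral_sum[symmetric]) (rule Q(2))
    also have "\<dots> = (LINT r|?N. (\<Sum>i\<in>UNIV. 2 * Re (cnj (mode (u r) i m) * mode_rhs lam (u r) i m)))"
    proof (rule integral_cong_AE)
      show "(\<lambda>r. \<Sum>i\<in>UNIV. 2 * Re (cnj (c i m r) * mode_rhs lam (u r) i m)) \<in> borel_measurable ?N"
        by (rule borel_measurable_sum) (rule borel_measurable_integrable[OF Q(2)])
      show "(\<lambda>r. \<Sum>i\<in>UNIV. 2 * Re (cnj (mode (u r) i m) * mode_rhs lam (u r) i m)) \<in> borel_measurable ?N"
        by (rule restrict_measurable) (use t in auto)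
      have "AE r in ?N. \<forall>i\<in>UNIV. mode (u r) i m = c i m r"
        by (rule AE_finite_allI) (auto intro!: AE_sub[OF AE_mode_eq] less_imp_le t)
      then show "AE r in ?N. (\<Sum>i\<in>UNIV. 2 * Re (cnj (c i m r) * mode_rhs lam (u r) i m))
          = (\<Sum>i\<in>UNIV. 2 * Re (cnj (mode (u r) i m) * mode_rhs lam (u r) i m))"
        by eventually_elim simp
    qed
    finally show ?thesis
      unfolding flux_def integral_mult_right_zero by (simp only: distrib_left)
  qed
  have i0: "integrable lattice (\<lambda>m. weight m ^ s * mode_sq u0 m)" by (rule integrable_energy_le[OF u0 s])
  show ?thesis
    unfolding pw Es_def G_def S(5) energy_def
    by (rule Bochner_Integration.integral_add[OF i0 S(4), symmetric])
qed

lemma Es_nonneg: "0 \<le> t \<Longrightarrow> t < T \<Longrightarrow> s \<le> 2 \<Longrightarrow> 0 \<le> Es s t"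
  unfolding Es_eq by (rule integral_nonneg_AE) (simp add: sum_nonneg)

text \<open>The exceptional times of countably many modes form one null set.\<close>

lemma AE_energy_eq:
  assumes s: "s \<le> 2"
  shows "AE t in M. energy s (u t) = Es s t"
proof -
  have "AE t in M. \<forall>m. \<forall>i\<in>UNIV. mode (u t) i m = c i m t"
    unfolding AE_all_countable by (intro allI AE_finite_allI AE_mode_eq) auto
  then show ?thesis
    using AE_space
  proof eventually_elim
    case (elim t)
    then show ?case using Es_eq[of t s] s by (simp add: energy_def mode_sq_def)
  qed
qed

end

section \<open>The solution up to the final time\<close>

lemma deriv_zero_outside_support:
  assumes "x \<notin> closure {t. \<theta> t \<noteq> (0::real)}"
  shows "deriv \<theta> x = 0" and "\<theta> (x::real) = 0"
proof -
  have "\<forall>\<^sub>F t in nhds x. t \<in> - closure {t. \<theta> t \<noteq> 0}"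
    by (rule eventually_nhds_in_open[OF open_Compl[OF closed_closure]]) (rule Compl_iff[THEN iffD2, OF assms])
  then have ev: "\<forall>\<^sub>F t in nhds x. \<theta> t = 0"
  proof eventually_elim
    case (elim t)
    show ?case
    proof (rule ccontr)
      assume "\<theta> t \<noteq> 0"
      then have "t \<in> {t. \<theta> t \<noteq> 0}" by (rule CollectI)
      then have "t \<in> closure {t. \<theta> t \<noteq> 0}" by (rule subsetD[OF closure_subset])
      then show False using elim by simp
    qed
  qed
  have "deriv \<theta> x = deriv (\<lambda>_. 0) x" by (rule deriv_cong_ev[OF ev refl])
  then show "deriv \<theta> x = 0" by simp
  show "\<theta> x = 0" using ev by (rule eventually_nhds_x_imp_x)
qed

text \<open>A compact support inside (0, T) already lies in (0, b) for some b < T.\<close>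

lemma is_distr_deriv_exhaust:
  assumes T: "T > 0" and d: "\<And>b. 0 < b \<Longrightarrow> b < T \<Longrightarrow> is_distr_deriv b g h"
  shows "is_distr_deriv T g h"
  unfolding is_distr_deriv_def
proof (intro allI impI)
  fix \<theta> :: "real \<Rightarrow> real"
  assume \<theta>: "smooth \<theta> \<and> closure {t. \<theta> t \<noteq> 0} \<subseteq> {0<..<T}"
  let ?K = "closure {t. \<theta> t \<noteq> 0}"
  have "bounded ?K" using \<theta> by (meson bounded_Ioo bounded_subset)
  then have cK: "compact ?K" by (simp add: compact_eq_bounded_closed)
  obtain b where b: "0 < b" "b < T" "?K \<subseteq> {0<..<b}"
  proof (cases "?K = {}")
    case True
    then show ?thesis using that[of "T / 2"] T by simp
  next
    case False
    obtain s where s: "s \<in> ?K" "\<forall>t\<in>?K. t \<le> s" using compact_attains_sup[OF cK False] by blast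
    have s0: "0 < s" "s < T" using s(1) \<theta> by auto
    have "?K \<subseteq> {0<..<(s + T) / 2}"
    proof
      fix t assume "t \<in> ?K"
      then have "0 < t" "t \<le> s" using s(2) \<theta> by auto
      moreover have "s < (s + T) / 2" using s0 by simp
      ultimately show "t \<in> {0<..<(s + T) / 2}" by simp
    qed
    then show ?thesis using that[of "(s + T) / 2"] s0 by simp
  qed
  have restr: "(LINT t|lebesgue_on {0<..<T}. f t) = (LINT t|lebesgue_on {0<..<b}. f t)"
    if "\<And>t. t \<notin> ?K \<Longrightarrow> f t = 0" for f :: "real \<Rightarrow> real"
  proof -
    have "f t = indicator {0<..<b} t *\<^sub>R f t" for t
    proof (cases "t \<in> ?K")
      case True
      then have "t \<in> {0<..<b}" using b(3) by blast
      then show ?thesis by simp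
    qed (simp add: that)
    then have "(LINT t|lebesgue_on {0<..<T}. f t) = (LINT t|lebesgue_on {0<..<T}. indicator {0<..<b} t *\<^sub>R f t)"
      by (rule Bochner_Integration.integral_cong[OF refl])
    also have "\<dots> = (LINT t|lebesgue_on {0<..<b}. f t)"
      by (rule lebesgue_on_subset(1)) (use b in auto)
    finally show ?thesis .
  qed
  have "(LINT t|lebesgue_on {0<..<b}. g t * deriv \<theta> t) = - (LINT t|lebesgue_on {0<..<b}. h t * \<theta> t)"
    using d[OF b(1,2), unfolded is_distr_deriv_def, rule_format, OF conjI[OF conjunct1[OF \<theta>] b(3)]] .
  moreover have "(LINT t|lebesgue_on {0<..<T}. g t * deriv \<theta> t) = (LINT t|lebesgue_on {0<..<b}. g t * deriv \<theta> t)"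
  proof (rule restr)
    fix t assume "t \<notin> ?K"
    from deriv_zero_outside_support(1)[OF this] show "g t * deriv \<theta> t = 0" by simp
  qed
  moreover have "(LINT t|lebesgue_on {0<..<T}. h t * \<theta> t) = (LINT t|lebesgue_on {0<..<b}. h t * \<theta> t)"
  proof (rule restr)
    fix t assume "t \<notin> ?K"
    from deriv_zero_outside_support(2)[OF this] show "h t * \<theta> t = 0" by simp
  qed
  ultimately show "(LINT t|lebesgue_on {0<..<T}. g t * deriv \<theta> t) = - (LINT t|lebesgue_on {0<..<T}. h t * \<theta> t)"
    by (simp only:)
qed

text \<open>Within the open interval the set of agreement is relatively closed and of full measure.
  Time 0 lies outside, hence the separate hypothesis.\<close>

lemma continuous_AE_eq:
  fixes f g :: "real \<Rightarrow> real"
  assumes f: "continuous_on {0..<b} f" and g: "continuous_on {0..<b} g"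
    and ae: "AE t in lebesgue_on {0..<b}. f t = g t" and 0: "f 0 = g 0" and t: "t \<in> {0..<b}"
  shows "f t = g t"
proof (cases "t = 0")
  case False
  have "continuous_on {0<..<b} (\<lambda>t. f t - g t)"
    by (intro continuous_intros continuous_on_subset[OF f] continuous_on_subset[OF g]) auto
  from continuous_closedin_preimage_constant[OF this, of 0]
  obtain C where C: "closed C" "{x \<in> {0<..<b}. f x - g x = 0} = {0<..<b} \<inter> C"
    unfolding closedin_closed by blast
  have ae': "AE x in lebesgue. x \<in> {0<..<b} \<longrightarrow> f x = g x"
    using ae by (subst (asm) AE_restrict_space_iff) (auto elim!: eventually_mono)
  have sub: "x \<in> {0<..<b} \<Longrightarrow> f x = g x \<longleftrightarrow> x \<in> C" for x
    using eq_iff_diff_eq_0[of "f x" "g x"] C(2) by blast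
  have "AE x\<in>{0<..<b} in lebesgue. x \<in> C"
    by (rule eventually_mono[OF ae']) (use sub in blast)
  moreover have tb: "t \<in> {0<..<b}" using t False by simp
  ultimately have "t \<in> C"
    by (rule mem_closed_if_AE_lebesgue_open[OF open_greaterThanLessThan C(1)])
  then show ?thesis using sub[OF tb] by simp
qed (use 0 in simp)

text \<open>Representatives for different intervals agree where both are defined, by continuity, and
  therefore patch together.\<close>

lemma glue_continuous_representatives:
  fixes a :: "real \<Rightarrow> real"
  assumes T: "T > 0"
    and ex: "\<And>b. 0 < b \<Longrightarrow> b < T \<Longrightarrow> \<exists>g. continuous_on {0..<b} g \<and> (AE t in lebesgue_on {0..<b}. g t = a t) \<and> g 0 = v"
  shows "\<exists>g. continuous_on {0..<T} g \<and> (AE t in lebesgue_on {0..<T}. g t = a t) \<and> g 0 = v"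
proof -
  define P where "P b g \<longleftrightarrow> continuous_on {0..<b} g \<and> (AE t in lebesgue_on {0..<b}. g t = a t) \<and> g 0 = v" for b g
  have "\<forall>b. \<exists>g. 0 < b \<and> b < T \<longrightarrow> P b g" using ex unfolding P_def by blast
  from choice[OF this] obtain g where "\<forall>b. 0 < b \<and> b < T \<longrightarrow> P b (g b)" by blast
  then have g: "continuous_on {0..<b} (g b)" "AE t in lebesgue_on {0..<b}. g b t = a t" "g b 0 = v" if "0 < b" "b < T" for b
    using that unfolding P_def by blast+
  have agree: "g b t = g b' t" if b: "0 < b" "b \<le> b'" "b' < T" and t: "t \<in> {0..<b}" for b b' t
  proof (rule continuous_AE_eq[OF _ _ _ _ t])
    show "continuous_on {0..<b} (g b)" using g(1) b by simp
    show "continuous_on {0..<b} (g b')" by (rule continuous_on_subset[OF g(1)]) (use b in auto)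
    show "g b 0 = g b' 0" using g(3) b by simp
    have "AE t in lebesgue_on {0..<b}. g b' t = a t"
      by (rule AE_lebesgue_on_subset[OF _ _ _ g(2)]) (use b in auto)
    moreover have "AE t in lebesgue_on {0..<b}. g b t = a t" by (rule g(2)) (use b in auto)
    ultimately show "AE t in lebesgue_on {0..<b}. g b t = g b' t" by eventually_elim simp
  qed
  \<comment> \<open>At time t the representative is the one whose interval ends halfway between t
    and T.\<close>
  define w where "w t = g ((t + T) / 2) t" for t
  have w: "w t = g b t" if b: "0 < b" "b < T" and t: "t \<in> {0..<b}" for b t
  proof -
    have t': "0 < (t + T) / 2" "(t + T) / 2 < T" "t \<in> {0..<(t + T) / 2}" using t b T by auto
    show ?thesis
    proof (cases "b \<le> (t + T) / 2")
      case True
      then show ?thesis unfolding w_def by (rule agree[OF b(1) _ t'(2) t, symmetric])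
    next
      case False
      then have "(t + T) / 2 \<le> b" by simp
      then show ?thesis unfolding w_def by (rule agree[OF t'(1) _ b(2) t'(3)])
    qed
  qed
  have "continuous (at t within {0..<T}) w" if t: "t \<in> {0..<T}" for t
  proof -
    define b where "b = (t + T) / 2"
    have b: "0 < b" "b < T" "t \<in> {0..<b}" using t T by (auto simp: b_def)
    have "continuous_on {0..<b} w"
    proof (rule continuous_on_eq[OF g(1)[OF b(1,2)]])
      fix x assume "x \<in> {0..<b}"
      from w[OF b(1,2) this] show "g b x = w x" by (rule sym)
    qed
    then have "continuous (at t within {0..<b}) w" using b(3) by (simp add: continuous_on_eq_continuous_within)
    moreover have "at t within {0..<b} = at t within {0..<T}"
      by (rule at_within_nhd[of t "{..<b}"]) (use b in auto)
    ultimately show ?thesis by simp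
  qed
  then have "continuous_on {0..<T} w" by (simp add: continuous_on_eq_continuous_within)
  moreover have "w 0 = v" using w[of "T / 2" 0] g(3)[of "T / 2"] T by simp
  moreover have "AE t in lebesgue_on {0..<T}. w t = a t"
  proof (rule interval_endpoints_AE(1))
    show "AE t in lebesgue_on {0<..<T}. w t = a t"
    proof (rule AE_exhaust_interval[OF T])
      fix b assume b: "0 < b" "b < T"
      have "AE t in lebesgue_on {0<..<b}. g b t = a t"
        by (rule AE_lebesgue_on_subset[OF _ _ _ g(2)[OF b]]) auto
      then show "AE t in lebesgue_on {0<..<b}. w t = a t"
        using AE_space by eventually_elim (use w[OF b] in auto)
    qed
  qed auto
  ultimately show ?thesis by blast
qed

context ks_solution
begin

lemma finite_M: "emeasure M {0<..<T} < \<infinity>"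
proof -
  interpret finite_measure M by (rule finite_measure_lebesgue_on) simp
  show ?thesis by (simp add: emeasure_eq_measure)
qed

text \<open>Used with (s, r) = (0, 2) and (2, 4). Gronwall runs on \<open>Es\<close>, which is
  defined at all times, and the result is read off for the solution almost everywhere.\<close>

lemma gronwall_energy:
  assumes s: "s \<le> 2"
    and ae: "AE t in M. \<exists>c\<ge>0. ennreal c \<le> k t \<and> G s t + energy r (u t) / 2 \<le> c * energy s (u t)"
    and k: "(\<integral>\<^sup>+t. k t \<partial>M) < \<infinity>"
  shows "\<exists>C. AE t in M. energy s (u t) \<le> C" and "(\<integral>\<^sup>+t. ennreal (energy r (u t)) \<partial>M) < \<infinity>"
proof -
  have ae': "AE t in M. \<exists>c\<ge>0. ennreal c \<le> k t \<and> G s t + energy r (u t) / 2 \<le> c * Es s t"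
    using ae AE_energy_eq[OF s] by eventually_elim (simp only:)
  have Ym: "(\<lambda>t. energy r (u t) / 2) \<in> borel_measurable M" by measurable
  have Y: "0 \<le> energy r (u t) / 2" for t by simp
  note TG = tail_gronwall[OF T G_measurable G_integrable[OF _ _ s] Es_def Es_nonneg[OF _ _ s] Ym Y ae' k]
  from TG(1) obtain C where C: "\<forall>t. 0 \<le> t \<longrightarrow> t < T \<longrightarrow> Es s t \<le> C" ..
  have "AE t in M. energy s (u t) \<le> C"
    using AE_energy_eq[OF s] AE_space
  proof eventually_elim
    case (elim t)
    have "Es s t \<le> C" by (rule C[rule_format]) (use elim(2) in simp_all)
    then show ?case by (simp only: elim(1))
  qed
  then show "\<exists>C. AE t in M. energy s (u t) \<le> C" ..
  have "(\<integral>\<^sup>+t. ennreal (energy r (u t)) \<partial>M) = (\<integral>\<^sup>+t. ennreal 2 * ennreal (energy r (u t) / 2) \<partial>M)"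
    by (intro nn_integral_cong, subst ennreal_mult'[symmetric]) simp_all
  also have "\<dots> = ennreal 2 * (\<integral>\<^sup>+t. ennreal (energy r (u t) / 2) \<partial>M)"
    by (rule nn_integral_cmult) measurable
  also have "\<dots> < \<infinity>" using TG(2) by (simp add: ennreal_mult_less_top)
  finally show "(\<integral>\<^sup>+t. ennreal (energy r (u t)) \<partial>M) < \<infinity>" .
qed

end

text \<open>
  The norm \<open>t \<mapsto> N (u t)\<close> may fail to be measurable, and the nonnegative integral is then a lower
  integral. The fluctuations are therefore measured by a supremum over a countable dense set,
  which is measurable in time and dominated by the Besov norm.
\<close>

locale ks_besov = ks_solution +
  assumes besov: "\<And>i. i \<in> {1, 2} \<Longrightarrow>
    (\<lambda>t. to_D0' (\<lambda>x. u t x $ i)) \<in> bochner_L2 {0<..<T} (besov_inf \<phi> (1/2)) (besov_inf_norm \<phi> (1/2))"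
begin

lemma L2_energy_estimate: "(\<integral>\<^sup>+t. ennreal (energy 2 (u t)) \<partial>M) < \<infinity>"
proof -
  obtain D where D: "countable D" "D \<subseteq> cell" "cell \<subseteq> closure D"
    using separable[of cell] by blast
  define fluct where "fluct i t x = \<bar>Re (fourier_series (mode (u t) i) x) - Re (mode (u t) i 0)\<bar>" for i t x
  define a where "a i t = (SUP x\<in>D. ennreal (fluct i t x))" for i t
  define N where "N i t = besov_inf_norm \<phi> (1/2) (to_D0' (\<lambda>x. u t x $ i))" for i t
  have am [measurable]: "a i \<in> borel_measurable M" for i
  proof -
    have "(\<lambda>t. fourier_series (mode (u t) i) x) \<in> borel_measurable M" for x
      unfolding fourier_series_def by (rule lattice_integral_measurable) measurable
    then have "(\<lambda>t. ennreal (fluct i t x)) \<in> borel_measurable M" for x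
      unfolding fluct_def by measurable
    then show ?thesis unfolding a_def by (rule borel_measurable_SUP[OF D(1)])
  qed
  \<comment> \<open>The bound for almost every point holds on the whole cell: the fluctuation is
    continuous, and a closed set of full measure in the open box contains its closure. The constant
    is enlarged by 1 so that it is positive and can be divided by.\<close>
  have aN: "AE t in M. a i t \<le> ennreal ((besov_const + 1) * N i t)" if i: "i \<in> {1, 2}" for i
  proof -
    have "AE t in M. to_D0' (\<lambda>x. u t x $ i) \<in> besov_inf \<phi> (1/2)"
      using besov[OF i] by (simp add: bochner_L2_def strongly_measurable_def)
    then show ?thesis
      using AE_H4
    proof eventually_elim
      case (elim t)
      interpret h4_state "u t" by (rule h4_state.intro) (rule elim)
      have N0: "N i t \<ge> 0" by (simp add: N_def besov_inf_norm_def)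
      let ?B = "besov_const * N i t"
      have "AE x in torus_measure. \<bar>U i x - Re (mode (u t) i 0)\<bar> \<le> ?B"
        unfolding N_def by (rule besov_fluctuation_bound[OF \<phi> elim(1)])
      then have ae: "AE x\<in>box 0 (\<chi> i. 2 * pi) in lebesgue. x \<in> {x. \<bar>U i x - Re (mode (u t) i 0)\<bar> \<le> ?B}"
        unfolding torus_measure_def
        by (subst (asm) AE_restrict_space_iff) (use box_subset_cbox in \<open>auto elim!: eventually_mono\<close>)
      have cl: "closed {x. \<bar>U i x - Re (mode (u t) i 0)\<bar> \<le> ?B}"
        by (intro closed_Collect_le continuous_intros)
      have "box 0 (\<chi> i. 2 * pi) \<subseteq> {x. \<bar>U i x - Re (mode (u t) i 0)\<bar> \<le> ?B}"
        using mem_closed_if_AE_lebesgue_open[OF open_box cl ae] by blast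
      then have "closure (box 0 (\<chi> i. 2 * pi)) \<subseteq> {x. \<bar>U i x - Re (mode (u t) i 0)\<bar> \<le> ?B}"
        by (rule closure_minimal[OF _ cl])
      moreover have "closure (box 0 (\<chi> i. 2 * pi)) = cell"
      proof (rule closure_box)
        have "(\<chi> i. pi) \<in> box (0 :: real^3) (\<chi> i. 2 * pi)" by (simp add: mem_box_cart)
        then show "box 0 (\<chi> i. 2 * pi) \<noteq> ({} :: (real^3) set)" by blast
      qed
      ultimately have "fluct i t x \<le> ?B" if "x \<in> D" for x
        using D(2) that unfolding fluct_def U_def by blast
      moreover have "?B \<le> (besov_const + 1) * N i t" using N0 by (simp add: distrib_right)
      ultimately have "fluct i t x \<le> (besov_const + 1) * N i t" if "x \<in> D" for x
        using order_trans that by blast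
      then show ?case unfolding a_def by (intro SUP_least ennreal_leI)
    qed
  qed
  have B: "besov_const + 1 > 0" using besov_const_nonneg by simp
  have a2: "(\<integral>\<^sup>+t. a i t * a i t \<partial>M) < \<infinity>" if i: "i \<in> {1, 2}" for i
  proof -
    let ?q = "ennreal (1 / (besov_const + 1)\<^sup>2)"
    have q: "0 < ?q" using B by (simp add: zero_less_power)
    have "?q * (\<integral>\<^sup>+t. a i t * a i t \<partial>M) = (\<integral>\<^sup>+t. ?q * (a i t * a i t) \<partial>M)"
      by (rule nn_integral_cmult[symmetric]) measurable
    also have "\<dots> \<le> (\<integral>\<^sup>+t. ennreal ((N i t)\<^sup>2) \<partial>M)"
    proof (rule nn_integral_mono_AE)
      show "AE t in M. ?q * (a i t * a i t) \<le> ennreal ((N i t)\<^sup>2)"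
        using aN[OF i]
      proof eventually_elim
        case (elim t)
        have N0: "N i t \<ge> 0" by (simp add: N_def besov_inf_norm_def)
        have "?q * (a i t * a i t) \<le> ?q * (ennreal ((besov_const + 1) * N i t) * ennreal ((besov_const + 1) * N i t))"
          by (intro mult_left_mono mult_mono elim) auto
        also have "\<dots> = ennreal ((1 / (besov_const + 1)\<^sup>2) * (((besov_const + 1) * N i t) * ((besov_const + 1) * N i t)))"
          using N0 B by (simp add: ennreal_mult'[symmetric] ennreal_mult''[symmetric])
        also have "(1 / (besov_const + 1)\<^sup>2) * (((besov_const + 1) * N i t) * ((besov_const + 1) * N i t)) = (N i t)\<^sup>2"
          using B by (simp add: power2_eq_square)
        finally show ?case .
      qed
    qed
    also have "\<dots> < \<infinity>" using besov[OF i] by (simp add: bochner_L2_def N_def)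
    finally show ?thesis using q by (auto simp: ennreal_mult_less_top)
  qed
  \<comment> \<open>The 40 comes from 20 (A1 + A2)^2 <= 40 A1^2 + 40 A2^2.\<close>
  define k where "k t = ennreal (growth_const lam) + (ennreal 40 * (a 1 t * a 1 t) + ennreal 40 * (a 2 t * a 2 t))" for t
  have fin: "(\<integral>\<^sup>+t. k t \<partial>M) < \<infinity>"
  proof -
    have "(\<integral>\<^sup>+t. k t \<partial>M) = ennreal (growth_const lam) * emeasure M {0<..<T}
        + (ennreal 40 * (\<integral>\<^sup>+t. a 1 t * a 1 t \<partial>M) + ennreal 40 * (\<integral>\<^sup>+t. a 2 t * a 2 t \<partial>M))"
      unfolding k_def by (simp add: nn_integral_add nn_integral_cmult)
    also have "\<dots> < \<infinity>" using finite_M a2[of 1] a2[of 2] by (simp add: ennreal_mult_less_top)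
    finally show ?thesis .
  qed
  have ae: "AE t in M. \<exists>c\<ge>0. ennreal c \<le> k t \<and> G 0 t + energy 2 (u t) / 2 \<le> c * energy 0 (u t)"
    using aN[OF insertI1] aN[OF insertI2[OF singletonI]] AE_H4
  proof eventually_elim
    case (elim t)
    interpret h4_state "u t" by (rule h4_state.intro) (rule elim)
    have top: "a 1 t < \<infinity>" "a 2 t < \<infinity>"
      using elim(1,2) by (auto intro: le_less_trans)
    define A1 A2 where "A1 = enn2real (a 1 t)" and "A2 = enn2real (a 2 t)"
    have A: "a 1 t = ennreal A1" "a 2 t = ennreal A2" "A1 \<ge> 0" "A2 \<ge> 0"
      using top by (auto simp: A1_def A2_def)
    \<comment> \<open>\<open>flux0_le\<close> takes one bound for both components, hence the sum A1
      + A2. The supremum over the dense set controls every point of the cell by continuity.\<close>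
    have all: "\<bar>U i x - Re (mode (u t) i 0)\<bar> \<le> A1 + A2" if i: "i \<in> {1, 2}" and x: "x \<in> cell" for i x
    proof -
      let ?S = "{x. \<bar>U i x - Re (mode (u t) i 0)\<bar> \<le> A1 + A2}"
      have "D \<subseteq> ?S"
      proof
        fix y assume y: "y \<in> D"
        have "ennreal (fluct i t y) \<le> a i t" unfolding a_def by (rule SUP_upper[OF y])
        also have "\<dots> \<le> ennreal (A1 + A2)" using i A by (auto intro: ennreal_leI)
        finally have "fluct i t y \<le> A1 + A2" using A(3,4) by (subst (asm) ennreal_le_iff) simp_all
        then show "y \<in> ?S" by (simp add: fluct_def U_def)
      qed
      moreover have "closed ?S" by (intro closed_Collect_le continuous_intros)
      ultimately have "closure D \<subseteq> ?S" by (rule closure_minimal)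
      then show ?thesis using D(3) x by blast
    qed
    have "G 0 t + energy 2 (u t) / 2 \<le> (growth_const lam + 20 * (A1 + A2)\<^sup>2) * energy 0 (u t)"
      unfolding G_def by (rule flux0_le) (use all in \<open>auto intro!: AE_I2\<close>)
    also have "\<dots> \<le> (growth_const lam + 40 * (A1 * A1) + 40 * (A2 * A2)) * energy 0 (u t)"
    proof (rule mult_right_mono)
      show "growth_const lam + 20 * (A1 + A2)\<^sup>2 \<le> growth_const lam + 40 * (A1 * A1) + 40 * (A2 * A2)"
        using zero_le_power2[of "A1 - A2"] by (simp add: power2_eq_square algebra_simps)
    qed simp
    finally have le: "G 0 t + energy 2 (u t) / 2 \<le> (growth_const lam + 40 * (A1 * A1) + 40 * (A2 * A2)) * energy 0 (u t)" .
    have "k t = ennreal (growth_const lam + (40 * (A1 * A1) + 40 * (A2 * A2)))"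
      unfolding k_def A(1,2) using A(3,4) growth_const_pos[of lam]
      by (simp add: ennreal_mult'[symmetric] ennreal_plus[symmetric] del: ennreal_plus ennreal_numeral)
    then show ?case
      using le A(3,4) growth_const_pos[of lam]
      by (intro exI[of _ "growth_const lam + 40 * (A1 * A1) + 40 * (A2 * A2)"]) (simp add: add.assoc)
  qed
  show ?thesis by (rule gronwall_energy(2)[OF _ ae fin]) simp
qed

text \<open>The kernel K (1 + E_2) from \<open>flux2_le\<close> is integrable up to T by the L^2
  estimate, which closes the argument.\<close>

lemma H2_energy_estimate:
  shows "\<exists>C. AE t in M. energy 2 (u t) \<le> C" and "(\<integral>\<^sup>+t. ennreal (energy 4 (u t)) \<partial>M) < \<infinity>"
proof -
  define K where "K = growth_const lam + 6 * weight_const"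
  have K: "K \<ge> 0" using growth_const_pos[of lam] weight_const_nonneg by (simp add: K_def)
  define k where "k t = ennreal K * (1 + ennreal (energy 2 (u t)))" for t
  have "(\<integral>\<^sup>+t. k t \<partial>M) = ennreal K * (emeasure M {0<..<T} + (\<integral>\<^sup>+t. ennreal (energy 2 (u t)) \<partial>M))"
    unfolding k_def by (simp add: nn_integral_add nn_integral_cmult)
  also have "\<dots> < \<infinity>" using finite_M L2_energy_estimate by (simp add: ennreal_mult_less_top)
  finally have fin: "(\<integral>\<^sup>+t. k t \<partial>M) < \<infinity>" .
  have ae: "AE t in M. \<exists>c\<ge>0. ennreal c \<le> k t \<and> G 2 t + energy 4 (u t) / 2 \<le> c * energy 2 (u t)"
    using AE_H4
  proof eventually_elim
    case (elim t)
    interpret h4_state "u t" by (rule h4_state.intro) (rule elim)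
    have "ennreal (1 + energy 2 (u t)) = 1 + ennreal (energy 2 (u t))"
      using ennreal_plus[of 1 "energy 2 (u t)"] by simp
    then have "ennreal (K * (1 + energy 2 (u t))) = k t"
      using ennreal_mult'[OF K, of "1 + energy 2 (u t)"] by (simp only: k_def)
    then show ?case
      using flux2_le[of lam] K unfolding G_def K_def[symmetric]
      by (intro exI[of _ "K * (1 + energy 2 (u t))"]) simp
  qed
  show "\<exists>C. AE t in M. energy 2 (u t) \<le> C" "(\<integral>\<^sup>+t. ennreal (energy 4 (u t)) \<partial>M) < \<infinity>"
    using gronwall_energy[OF order_refl ae fin] by blast+
qed

section \<open>Regularity and the equation up to the final time\<close>

lemma bochner_final:
  assumes I: "{0<..<T} \<subseteq> I" "I \<subseteq> {0..T}" "I \<in> sets lebesgue"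
  shows "u \<in> bochner_Linf I (sobolev 2) (sobolev_norm 2)" and "u \<in> bochner_L2 I (sobolev 4) (sobolev_norm 4)"
proof -
  obtain C where C: "AE t in M. energy 2 (u t) \<le> C" using H2_energy_estimate(1) by blast
  have "AE t in M. sobolev_norm 2 (u t) \<le> sqrt C"
    using C AE_H4
  proof eventually_elim
    case (elim t)
    have "sobolev_norm 2 (u t) = sqrt (energy 2 (u t))"
      by (rule sobolev_norm_eq[OF sobolev_mono[OF elim(2)]]) simp
    then show ?case using elim by simp
  qed
  then have "AE t in lebesgue_on I. sobolev_norm 2 (u t) \<le> sqrt C" by (rule interval_endpoints_AE(1)[OF I])
  then show "u \<in> bochner_Linf I (sobolev 2) (sobolev_norm 2)"
    using strongly_measurable_H2[OF I(1,2)] by (auto simp: bochner_Linf_def)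
  have "(\<integral>\<^sup>+t. ennreal ((sobolev_norm 4 (u t))\<^sup>2) \<partial>lebesgue_on I) = (\<integral>\<^sup>+t. ennreal ((sobolev_norm 4 (u t))\<^sup>2) \<partial>M)"
    by (rule interval_endpoints_AE(2)[OF I])
  also have "\<dots> = (\<integral>\<^sup>+t. ennreal (energy 4 (u t)) \<partial>M)"
  proof (rule nn_integral_cong_AE)
    show "AE t in M. ennreal ((sobolev_norm 4 (u t))\<^sup>2) = ennreal (energy 4 (u t))"
      using AE_H4 by eventually_elim (simp add: sobolev_norm_eq)
  qed
  also have "\<dots> < \<infinity>" by (rule H2_energy_estimate(2))
  finally show "u \<in> bochner_L2 I (sobolev 4) (sobolev_norm 4)"
    using strongly_measurable_H4[OF I(1,2)] by (simp add: bochner_L2_def)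
qed

lemma strong_solution_final: "strong_solution lam u0 T u"
  unfolding strong_solution_def
proof (intro conjI ballI)
  show "u \<in> bochner_Linf {0..<T} (sobolev 2) (sobolev_norm 2)" "u \<in> bochner_L2 {0..<T} (sobolev 4) (sobolev_norm 4)"
    by (rule bochner_final; auto)+
  fix \<psi> :: "real^3 \<Rightarrow> real^3" assume \<psi>: "\<psi> \<in> smooth_periodic"
  show "is_distr_deriv T (\<lambda>t. torus_inner (u t) \<psi>)
     (\<lambda>t. lam * grad_inner (u t) \<psi> - torus_inner (convection (u t)) \<psi> - torus_inner (weak_laplacian (u t)) (laplacian \<psi>))"
  proof (rule is_distr_deriv_exhaust[OF T])
    fix b assume b: "0 < b" "b < T"
    show "is_distr_deriv b (\<lambda>t. torus_inner (u t) \<psi>)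
       (\<lambda>t. lam * grad_inner (u t) \<psi> - torus_inner (convection (u t)) \<psi> - torus_inner (weak_laplacian (u t)) (laplacian \<psi>))"
      using strong_solution_before[OF b] \<psi> unfolding strong_solution_def by blast
  qed
  show "\<exists>g. continuous_on {0..<T} g \<and> (AE t in lebesgue_on {0..<T}. g t = torus_inner (u t) \<psi>) \<and> g 0 = torus_inner u0 \<psi>"
  proof (rule glue_continuous_representatives[OF T])
    fix b assume b: "0 < b" "b < T"
    show "\<exists>g. continuous_on {0..<b} g \<and> (AE t in lebesgue_on {0..<b}. g t = torus_inner (u t) \<psi>) \<and> g 0 = torus_inner u0 \<psi>"
      using strong_solution_before[OF b] \<psi> unfolding strong_solution_def by blast
  qed
qed

end

theorem theorem3p7:
  fixes T lam :: real and u0 :: "real^3 \<Rightarrow> real^3" and u :: "real \<Rightarrow> real^3 \<Rightarrow> real^3"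
    and \<phi> :: "real^3 \<Rightarrow> real"
  assumes "T > 0" and "lam > 0"
    and "dyadic_cutoff \<phi>"
    and "u0 \<in> sobolev 2"
    and "solution_on lam u0 T u"
    and "\<And>i s. i \<in> {1, 2} \<Longrightarrow> s \<in> {- 1/2, 1/2} \<Longrightarrow>
           (\<lambda>t. to_D0' (\<lambda>x. u t x $ i))
             \<in> bochner_L2 {0<..<T} (besov_inf \<phi> s) (besov_inf_norm \<phi> s)"
  shows "strong_solution lam u0 T u
    \<and> u \<in> bochner_Linf {0..T} (sobolev 2) (sobolev_norm 2)
    \<and> u \<in> bochner_L2 {0..T} (sobolev 4) (sobolev_norm 4)"
proof -
  interpret ks_besov T lam u0 u \<phi>
    by unfold_locales (use assms in auto)
  have "{0<..<T} \<subseteq> {0..T}" by auto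
  then show ?thesis
    using strong_solution_final bochner_final[of "{0..T}"] by simp
qed

end
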